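(* (1) There is no non-totally geodesic $n$-dimensional spacelike submanifold of $\mathbb{S}^{n+1}\times\mathbb{R}$ with null second fundamental form. (2) Let $\varphi$ be an immersion of class $C^4$ of an $n$-dimensional manifold $\mathcal{M}$ into $\mathbb{S}^{n+1}$. Denote by $\nu$ the Gauss map of $\varphi$ and by $\kappa_1,\dots,\kappa_p$ its $p$ distinct principal curvatures, with multiplicities $m_i$. Then the polynomial $$P(s):=\sum_{i=1}^p m_i(\kappa_i s+1)\prod_{j\ne i}^p(s-\kappa_j)$$ admits exactly $p-1$ roots $s_i$ if $\varphi$ is minimal and $p$ roots otherwise. Moreover, the $p-1$ or $p$ immersions $\bar\varphi_i:\mathcal{M}\to\mathbb{S}^{n+1}\times\mathbb{R}$ defined by $$\bar\varphi_i:=\left(\frac{s_i\varphi+\nu}{\sqrt{1+s_i^2}},\ \cot^{-1}s_i\right),\qquad 1\le i\le p-1\ \text{or}\ p,$$ are marginally trapped. Conversely, any $n$-dimensional spacelike marginally trapped submanifold of $\mathbb{S}^{n+1}\times\mathbb{R}$ is locally congruent to the image of such an immersion. (3) In particular, in the case $n=2$, given a non-minimal $C^4$-immersion $\varphi$ of a surface into $\mathbb{S}^3$, with Gauss map $\nu$ and principal curvatures $\kappa_1,\kappa_2$, and $$a:=\frac{\kappa_1\kappa_2-1}{\kappa_1+\kappa_2},$$ the two immersions into $\mathbb{S}^3\times\mathbb{R}$ defined by $$\bar\varphi_\pm:=\left(\frac{(a\pm\sqrt{a^2+1})\varphi+\nu}{\sqrt2\,\sqrt{a^2+1\pm a\sqrt{a^2+1}}},\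 \cot^{-1}\big(a\pm\sqrt{a^2+1}\big)\right)$$ are marginally trapped.
   Context: $\mathbb{S}^{n+1}=\{x\in\mathbb{R}^{n+2}:\langle x,x\rangle_0=1\}$ is the unit sphere with its round metric $\langle\cdot,\cdot\rangle_0$ (induced by the Euclidean metric), and $\mathbb{S}^{n+1}\times\mathbb{R}$ is endowed with the Lorentzian metric $\langle\cdot,\cdot\rangle_0-dx_{n+3}^2$, where $x_{n+3}$ is the canonical coordinate of $\mathbb{R}$. An immersion is spacelike if its induced metric is positive definite. For an immersion with non-degenerate induced metric, the second fundamental form is $h(X,Y)=(D_XY)^\perp$, where $D$ is the Levi-Civita connection of the ambient manifold and $(\cdot)^\perp$ the projection onto the normal space; the mean curvature vector $\vec H$ is its trace with respect to the induced metric (possibly normalized by $1/n$). A submanifold with non-degenerate induced metric of a pseudo-Riemannian manifold with metric $g$ is marginally trapped if $g(\vec H,\vec H)$ vanishes identically (so $\vec H=0$ is allowed). A second fundamental form is null if it takes values in a null line of the normal bundle, i.e. locally $h(X,Y)$ is collinear to a fixed nowhere vanishing null normal field. The Gauss map $\nu$ of $\varphi$ is the $\mathbb{S}^{n+1}$-valued unit normal field along $\varphi$ tangent to $\mathbb{S}^{n+1}$; principal curvatures are the eigenvalues of the shape operator $A=-d\nu$. The coefficients of $P$ depend on the point of $\mathcal{M}$, so its (real) roots $s_i$ are functions on $\mathcal{M}$. $\cot^{-1}$ takes values in $(0,\pi)$. In (3), non-minimality is used for $a$ to be defined, i.e. $\kappa_1+\kappa_2\neq0$. Two submanifolds are congruent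 if one is mapped onto the other by an isometry of the ambient space.
   Formalization: (1) needs n≥2. Roots are counted pointwise; root functions taken where p is constant and H is zero or nowhere zero, or continuous. Converse: class C^5, at points near which H lies in one continuous null line (e.g. H≠0), a dense set. (3): where κ1≠κ2 or the map is an immersion. *)

theory Defs
  imports "HOL-Analysis.Analysis" "HOL-Computational_Algebra.Polynomial"
begin

section \<open>Differentiability of finite order on open sets\<close>

text \<open>Meant for open \<open>S\<close>. All iterated directional derivatives up to order \<open>k\<close> exist
  (as Frechet derivatives) and are continuous.\<close>

primrec Ck_on :: "nat \<Rightarrow> 'a::real_normed_vector set \<Rightarrow> ('a \<Rightarrow> 'b::real_normed_vector) \<Rightarrow> bool" where
  "Ck_on 0 S f \<longleftrightarrow> continuous_on S f"
| "Ck_on (Suc k) S f \<longleftrightarrow> (\<forall>x\<in>S. f differentiable at x) \<and>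
     (\<forall>v. Ck_on k S (\<lambda>x. frechet_derivative f (at x) v))"

definition smooth_on :: "'a::real_normed_vector set \<Rightarrow> ('a \<Rightarrow> 'b::real_normed_vector) \<Rightarrow> bool" where
  "smooth_on S f \<longleftrightarrow> (\<forall>k. Ck_on k S f)"


section \<open>Abstract manifolds\<close>

text \<open>A manifold is the whole type \<open>'m\<close>, modelled on \<open>'e\<close>. The atlas is indexed by points:
  \<open>M x = (U, c)\<close> is a chart \<open>c\<close> with domain \<open>U\<close> around \<open>x\<close>. The tangent space at \<open>x\<close> is
  identified with \<open>'e\<close> by means of the chart \<open>M x\<close>. The geometric notions below do not depend
  on which chart around \<open>x\<close> has been picked.\<close>

type_synonym ('m, 'e) charts = "'m \<Rightarrow> 'm set \<times> ('m \<Rightarrow> 'e)"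

abbreviation chart_dom :: "('m, 'e) charts \<Rightarrow> 'm \<Rightarrow> 'm set" where
  "chart_dom M x \<equiv> fst (M x)"

abbreviation chart :: "('m, 'e) charts \<Rightarrow> 'm \<Rightarrow> 'm \<Rightarrow> 'e" where
  "chart M x \<equiv> snd (M x)"

definition coord_rep :: "('m, 'e) charts \<Rightarrow> 'm \<Rightarrow> ('m \<Rightarrow> 'b) \<Rightarrow> 'e \<Rightarrow> 'b" where
  "coord_rep M x f = f \<circ> inv_into (chart_dom M x) (chart M x)"

definition smooth_manifold ::
  "('m::{t2_space,second_countable_topology}, 'e::euclidean_space) charts \<Rightarrow> bool" where
  "smooth_manifold M \<longleftrightarrow>
     (\<forall>x. open (chart_dom M x) \<and> x \<in> chart_dom M x \<and>
          open (chart M x ` chart_dom M x) \<and>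
          homeomorphism (chart_dom M x) (chart M x ` chart_dom M x) (chart M x)
            (inv_into (chart_dom M x) (chart M x))) \<and>
     (\<forall>x y. smooth_on (chart M x ` (chart_dom M x \<inter> chart_dom M y))
              (coord_rep M x (chart M y)))"

definition Ck_map ::
  "('m, 'e::euclidean_space) charts \<Rightarrow> nat \<Rightarrow> 'm set \<Rightarrow> ('m \<Rightarrow> 'b::real_normed_vector) \<Rightarrow> bool" where
  "Ck_map M k W f \<longleftrightarrow>
     (\<forall>x. Ck_on k (chart M x ` (chart_dom M x \<inter> W)) (coord_rep M x f))"

definition diff1 ::
  "('m, 'e::euclidean_space) charts \<Rightarrow> ('m \<Rightarrow> 'b::real_normed_vector) \<Rightarrow> 'm \<Rightarrow> 'e \<Rightarrow> 'b" where
  "diff1 M f x X = frechet_derivative (coord_rep M x f) (at (chart M x x)) X"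

text \<open>Derivative in direction \<open>X\<close> of \<open>df(Y)\<close>, where \<open>Y\<close> is extended to a vector field that is
  constant in the chart at \<open>x\<close>.\<close>

definition diff2 ::
  "('m, 'e::euclidean_space) charts \<Rightarrow> ('m \<Rightarrow> 'b::real_normed_vector) \<Rightarrow> 'm \<Rightarrow> 'e \<Rightarrow> 'e \<Rightarrow> 'b" where
  "diff2 M f x X Y =
     frechet_derivative (\<lambda>u. frechet_derivative (coord_rep M x f) (at u) Y) (at (chart M x x)) X"

definition immersion ::
  "('m, 'e::euclidean_space) charts \<Rightarrow> nat \<Rightarrow> 'b set \<Rightarrow> 'm set \<Rightarrow>
     ('m \<Rightarrow> 'b::real_normed_vector) \<Rightarrow> bool" where
  "immersion M k Q W f \<longleftrightarrow> Ck_map M k W f \<and> f ` W \<subseteq> Q \<and> (\<forall>x\<in>W. inj (diff1 M f x))"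


section \<open>Second fundamental form and mean curvature\<close>

text \<open>The ambient manifold is a submanifold of a vector space \<open>'b\<close> with a non-degenerate
  symmetric bilinear form \<open>B\<close>; \<open>T p\<close> is its tangent space at \<open>p\<close> (on which \<open>B\<close> is again
  non-degenerate), and its metric is the restriction of \<open>B\<close>.\<close>

definition ambient_tangent_part ::
  "('b \<Rightarrow> 'b \<Rightarrow> real) \<Rightarrow> ('b \<Rightarrow> 'b set) \<Rightarrow> 'b \<Rightarrow> 'b \<Rightarrow> 'b::real_vector" where
  "ambient_tangent_part B T p w = (THE z. z \<in> T p \<and> (\<forall>t\<in>T p. B (w - z) t = 0))"

text \<open>By the Gauss formula, the Levi-Civita connection of the ambient manifold is the part
  tangent to it of the flat derivative in \<open>'b\<close>.\<close>

definition cov_deriv ::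
  "('b \<Rightarrow> 'b \<Rightarrow> real) \<Rightarrow> ('b \<Rightarrow> 'b set) \<Rightarrow> ('m, 'e::euclidean_space) charts \<Rightarrow>
     ('m \<Rightarrow> 'b::real_normed_vector) \<Rightarrow> 'm \<Rightarrow> 'e \<Rightarrow> 'e \<Rightarrow> 'b" where
  "cov_deriv B T M f x X Y = ambient_tangent_part B T (f x) (diff2 M f x X Y)"

definition induced_metric ::
  "('b \<Rightarrow> 'b \<Rightarrow> real) \<Rightarrow> ('m, 'e::euclidean_space) charts \<Rightarrow>
     ('m \<Rightarrow> 'b::real_normed_vector) \<Rightarrow> 'm \<Rightarrow> 'e \<Rightarrow> 'e \<Rightarrow> real" where
  "induced_metric B M f x X Y = B (diff1 M f x X) (diff1 M f x Y)"

definition normal_space ::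
  "('b \<Rightarrow> 'b \<Rightarrow> real) \<Rightarrow> ('b \<Rightarrow> 'b set) \<Rightarrow> ('m, 'e::euclidean_space) charts \<Rightarrow>
     ('m \<Rightarrow> 'b::real_normed_vector) \<Rightarrow> 'm \<Rightarrow> 'b set" where
  "normal_space B T M f x = {w \<in> T (f x). \<forall>X. B w (diff1 M f x X) = 0}"

definition normal_part ::
  "('b \<Rightarrow> 'b \<Rightarrow> real) \<Rightarrow> ('b \<Rightarrow> 'b set) \<Rightarrow> ('m, 'e::euclidean_space) charts \<Rightarrow>
     ('m \<Rightarrow> 'b::real_normed_vector) \<Rightarrow> 'm \<Rightarrow> 'b \<Rightarrow> 'b" where
  "normal_part B T M f x w =
     (THE z. z \<in> normal_space B T M f x \<and> w - z \<in> range (diff1 M f x))"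

definition second_ff ::
  "('b \<Rightarrow> 'b \<Rightarrow> real) \<Rightarrow> ('b \<Rightarrow> 'b set) \<Rightarrow> ('m, 'e::euclidean_space) charts \<Rightarrow>
     ('m \<Rightarrow> 'b::real_normed_vector) \<Rightarrow> 'm \<Rightarrow> 'e \<Rightarrow> 'e \<Rightarrow> 'b" where
  "second_ff B T M f x X Y = normal_part B T M f x (cov_deriv B T M f x X Y)"

definition nondegenerate :: "('e::euclidean_space \<Rightarrow> 'e \<Rightarrow> real) \<Rightarrow> bool" where
  "nondegenerate g \<longleftrightarrow> (\<forall>X. (\<forall>Y. g X Y = 0) \<longrightarrow> X = 0)"

text \<open>The trace \<open>g\<^sup>i\<^sup>j h\<^sub>i\<^sub>j\<close> with respect to the metric \<open>g\<close>: since
  \<open>metric_sharp g b\<close> is the vector with \<open>g\<close>-dual the covector \<open>b \<bullet> _\<close>,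
  \<open>metric_sharp g e\<^sub>i = g\<^sup>i\<^sup>j e\<^sub>j\<close> for the canonical basis \<open>e\<^sub>i\<close>.\<close>

definition metric_sharp :: "('e::euclidean_space \<Rightarrow> 'e \<Rightarrow> real) \<Rightarrow> 'e \<Rightarrow> 'e" where
  "metric_sharp g b = (THE v. \<forall>w. g v w = b \<bullet> w)"

definition metric_trace ::
  "('e::euclidean_space \<Rightarrow> 'e \<Rightarrow> real) \<Rightarrow> ('e \<Rightarrow> 'e \<Rightarrow> 'b::real_vector) \<Rightarrow> 'b" where
  "metric_trace g h = (\<Sum>b\<in>Basis. h b (metric_sharp g b))"

definition mean_curvature ::
  "('b \<Rightarrow> 'b \<Rightarrow> real) \<Rightarrow> ('b \<Rightarrow> 'b set) \<Rightarrow> ('m, 'e::euclidean_space) charts \<Rightarrow>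
     ('m \<Rightarrow> 'b::real_normed_vector) \<Rightarrow> 'm \<Rightarrow> 'b" where
  "mean_curvature B T M f x = metric_trace (induced_metric B M f x) (second_ff B T M f x)"


section \<open>The sphere and the Lorentzian cylinder\<close>

definition unit_sphere :: "'v::euclidean_space set" where
  "unit_sphere = {x. x \<bullet> x = 1}"

definition sphere_tangent :: "'v::euclidean_space \<Rightarrow> 'v set" where
  "sphere_tangent p = {w. w \<bullet> p = 0}"

definition cylinder :: "('v::euclidean_space \<times> real) set" where
  "cylinder = unit_sphere \<times> UNIV"

definition cylinder_tangent :: "'v::euclidean_space \<times> real \<Rightarrow> ('v \<times> real) set" where
  "cylinder_tangent p = sphere_tangent (fst p) \<times> UNIV"

definition lor :: "'v::euclidean_space \<times> real \<Rightarrow> 'v \<times> real \<Rightarrow> real" where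
  "lor p q = fst p \<bullet> fst q - snd p * snd q"

abbreviation sphere_mean_curvature ::
  "('m, 'e::euclidean_space) charts \<Rightarrow> ('m \<Rightarrow> 'v::euclidean_space) \<Rightarrow> 'm \<Rightarrow> 'v" where
  "sphere_mean_curvature \<equiv> mean_curvature (\<bullet>) sphere_tangent"

abbreviation cyl_second_ff ::
  "('m, 'e::euclidean_space) charts \<Rightarrow> ('m \<Rightarrow> 'v::euclidean_space \<times> real) \<Rightarrow>
     'm \<Rightarrow> 'e \<Rightarrow> 'e \<Rightarrow> 'v \<times> real" where
  "cyl_second_ff \<equiv> second_ff lor cylinder_tangent"

abbreviation cyl_mean_curvature ::
  "('m, 'e::euclidean_space) charts \<Rightarrow> ('m \<Rightarrow> 'v::euclidean_space \<times> real) \<Rightarrow> 'm \<Rightarrow> 'v \<times> real" where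
  "cyl_mean_curvature \<equiv> mean_curvature lor cylinder_tangent"

definition spacelike ::
  "('m, 'e::euclidean_space) charts \<Rightarrow> 'm set \<Rightarrow> ('m \<Rightarrow> 'v::euclidean_space \<times> real) \<Rightarrow> bool" where
  "spacelike M W f \<longleftrightarrow> (\<forall>x\<in>W. \<forall>X. X \<noteq> 0 \<longrightarrow> induced_metric lor M f x X X > 0)"

definition marginally_trapped ::
  "('m, 'e::euclidean_space) charts \<Rightarrow> 'm set \<Rightarrow> ('m \<Rightarrow> 'v::euclidean_space \<times> real) \<Rightarrow> bool" where
  "marginally_trapped M W f \<longleftrightarrow>
     (\<forall>x\<in>W. nondegenerate (induced_metric lor M f x) \<and>
        lor (cyl_mean_curvature M f x) (cyl_mean_curvature M f x) = 0)"

definition null_normal_field ::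
  "('m::topological_space, 'e::euclidean_space) charts \<Rightarrow> 'm set \<Rightarrow>
     ('m \<Rightarrow> 'v::euclidean_space \<times> real) \<Rightarrow> ('m \<Rightarrow> 'v \<times> real) \<Rightarrow> bool" where
  "null_normal_field M U f \<xi> \<longleftrightarrow> continuous_on U \<xi> \<and>
     (\<forall>x\<in>U. \<xi> x \<noteq> 0 \<and> \<xi> x \<in> normal_space lor cylinder_tangent M f x \<and> lor (\<xi> x) (\<xi> x) = 0)"

definition null_second_ff ::
  "('m::topological_space, 'e::euclidean_space) charts \<Rightarrow>
     ('m \<Rightarrow> 'v::euclidean_space \<times> real) \<Rightarrow> bool" where
  "null_second_ff M f \<longleftrightarrow>
     (\<forall>x. \<exists>U \<xi>. open U \<and> x \<in> U \<and> null_normal_field M U f \<xi> \<and>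
        (\<forall>y\<in>U. \<forall>X Y. \<exists>c. cyl_second_ff M f y X Y = c *\<^sub>R \<xi> y))"

definition null_mean_curvature_near ::
  "('m::topological_space, 'e::euclidean_space) charts \<Rightarrow>
     ('m \<Rightarrow> 'v::euclidean_space \<times> real) \<Rightarrow> 'm \<Rightarrow> bool" where
  "null_mean_curvature_near M f x \<longleftrightarrow>
     (\<exists>U \<xi>. open U \<and> x \<in> U \<and> null_normal_field M U f \<xi> \<and>
        (\<forall>y\<in>U. \<exists>c. cyl_mean_curvature M f y = c *\<^sub>R \<xi> y))"

definition totally_geodesic ::
  "('m, 'e::euclidean_space) charts \<Rightarrow> ('m \<Rightarrow> 'v::euclidean_space \<times> real) \<Rightarrow> bool" where
  "totally_geodesic M f \<longleftrightarrow> (\<forall>x X Y. cyl_second_ff M f x X Y = 0)"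

definition cyl_isometry :: "('v::euclidean_space \<times> real \<Rightarrow> 'v \<times> real) \<Rightarrow> bool" where
  "cyl_isometry F \<longleftrightarrow> bij_betw F cylinder cylinder \<and>
     (\<exists>V G. open V \<and> cylinder \<subseteq> V \<and> smooth_on V G \<and> (\<forall>p\<in>cylinder. G p = F p) \<and>
        (\<forall>p\<in>cylinder. \<forall>X\<in>cylinder_tangent p. \<forall>Y\<in>cylinder_tangent p.
           lor (frechet_derivative G (at p) X) (frechet_derivative G (at p) Y) = lor X Y)) \<and>
     (\<exists>V G. open V \<and> cylinder \<subseteq> V \<and> smooth_on V G \<and>
        (\<forall>p\<in>cylinder. G p = inv_into cylinder F p))"


section \<open>Hypersurfaces of the sphere\<close>

definition gauss_map ::
  "('m::topological_space, 'e::euclidean_space) charts \<Rightarrow> 'm set \<Rightarrow>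
     ('m \<Rightarrow> 'v::euclidean_space) \<Rightarrow> ('m \<Rightarrow> 'v) \<Rightarrow> bool" where
  "gauss_map M W \<phi> \<nu> \<longleftrightarrow> continuous_on W \<nu> \<and>
     (\<forall>x\<in>W. \<nu> x \<in> unit_sphere \<and> \<nu> x \<in> normal_space (\<bullet>) sphere_tangent M \<phi> x)"

text \<open>\<open>A = -d\<nu>\<close>, where the tangent space is identified with its image under \<open>d\<phi>\<close>.\<close>

definition shape_operator ::
  "('m, 'e::euclidean_space) charts \<Rightarrow> ('m \<Rightarrow> 'v::euclidean_space) \<Rightarrow> ('m \<Rightarrow> 'v) \<Rightarrow>
     'm \<Rightarrow> 'e \<Rightarrow> 'e" where
  "shape_operator M \<phi> \<nu> x X = (THE Y. diff1 M \<phi> x Y = - diff1 M \<nu> x X)"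

definition principal_curvatures ::
  "('m, 'e::euclidean_space) charts \<Rightarrow> ('m \<Rightarrow> 'v::euclidean_space) \<Rightarrow> ('m \<Rightarrow> 'v) \<Rightarrow>
     'm \<Rightarrow> real set" where
  "principal_curvatures M \<phi> \<nu> x = {\<kappa>. \<exists>X. X \<noteq> 0 \<and> shape_operator M \<phi> \<nu> x X = \<kappa> *\<^sub>R X}"

definition curvature_mult ::
  "('m, 'e::euclidean_space) charts \<Rightarrow> ('m \<Rightarrow> 'v::euclidean_space) \<Rightarrow> ('m \<Rightarrow> 'v) \<Rightarrow>
     'm \<Rightarrow> real \<Rightarrow> nat" where
  "curvature_mult M \<phi> \<nu> x \<kappa> = dim {X. shape_operator M \<phi> \<nu> x X = \<kappa> *\<^sub>R X}"

definition curvature_poly ::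
  "('m, 'e::euclidean_space) charts \<Rightarrow> ('m \<Rightarrow> 'v::euclidean_space) \<Rightarrow> ('m \<Rightarrow> 'v) \<Rightarrow>
     'm \<Rightarrow> real poly" where
  "curvature_poly M \<phi> \<nu> x =
     (\<Sum>\<kappa>\<in>principal_curvatures M \<phi> \<nu> x.
        smult (real (curvature_mult M \<phi> \<nu> x \<kappa>))
          ([:1, \<kappa>:] * (\<Prod>\<kappa>'\<in>principal_curvatures M \<phi> \<nu> x - {\<kappa>}. [:- \<kappa>', 1:])))"

definition curvature_roots ::
  "('m, 'e::euclidean_space) charts \<Rightarrow> ('m \<Rightarrow> 'v::euclidean_space) \<Rightarrow> ('m \<Rightarrow> 'v) \<Rightarrow>
     'm \<Rightarrow> real set" where
  "curvature_roots M \<phi> \<nu> x = {s. poly (curvature_poly M \<phi> \<nu> x) s = 0}"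

text \<open>The number of roots may jump where principal curvatures meet or where the mean curvature
  vanishes, hence the continuity requirement on the selection of a root.\<close>

definition root_function ::
  "('m::topological_space, 'e::euclidean_space) charts \<Rightarrow> 'm set \<Rightarrow>
     ('m \<Rightarrow> 'v::euclidean_space) \<Rightarrow> ('m \<Rightarrow> 'v) \<Rightarrow> ('m \<Rightarrow> real) \<Rightarrow> bool" where
  "root_function M W \<phi> \<nu> s \<longleftrightarrow>
     continuous_on W s \<and> (\<forall>x\<in>W. s x \<in> curvature_roots M \<phi> \<nu> x)"

definition arccot :: "real \<Rightarrow> real" where
  "arccot s = (THE \<theta>. 0 < \<theta> \<and> \<theta> < pi \<and> cot \<theta> = s)"

definition phibar ::
  "('m \<Rightarrow> 'v::euclidean_space) \<Rightarrow> ('m \<Rightarrow> 'v) \<Rightarrow> ('m \<Rightarrow> real) \<Rightarrow> 'm \<Rightarrow> 'v \<times> real" where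
  "phibar \<phi> \<nu> s x =
     ((1 / sqrt (1 + (s x)\<^sup>2)) *\<^sub>R (s x *\<^sub>R \<phi> x + \<nu> x), arccot (s x))"

text \<open>Near \<open>x\<close>, the submanifold \<open>f\<close> is congruent to the image of some \<open>phibar \<phi> \<nu> s\<close>.\<close>

definition locally_congruent_to_phibar ::
  "('m::topological_space, 'e::euclidean_space) charts \<Rightarrow>
     ('m \<Rightarrow> 'v::euclidean_space \<times> real) \<Rightarrow> 'm \<Rightarrow> bool" where
  "locally_congruent_to_phibar M f x \<longleftrightarrow>
     (\<exists>U \<phi> \<nu> s F. open U \<and> x \<in> U \<and> immersion M 4 unit_sphere U \<phi> \<and> gauss_map M U \<phi> \<nu> \<and>
        root_function M U \<phi> \<nu> s \<and> cyl_isometry F \<and> F ` f ` U = phibar \<phi> \<nu> s ` U)"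

text \<open>The explicit immersions for surfaces; \<open>\<sigma>\<close> is the sign \<open>1\<close> or \<open>-1\<close>.\<close>

definition surface_coeff :: "('m \<Rightarrow> real) \<Rightarrow> ('m \<Rightarrow> real) \<Rightarrow> 'm \<Rightarrow> real" where
  "surface_coeff \<kappa>1 \<kappa>2 x = (\<kappa>1 x * \<kappa>2 x - 1) / (\<kappa>1 x + \<kappa>2 x)"

definition phibar_surface ::
  "real \<Rightarrow> ('m \<Rightarrow> 'v::euclidean_space) \<Rightarrow> ('m \<Rightarrow> 'v) \<Rightarrow> ('m \<Rightarrow> real) \<Rightarrow> 'm \<Rightarrow> 'v \<times> real" where
  "phibar_surface \<sigma> \<phi> \<nu> a x =
     ((1 / (sqrt 2 * sqrt ((a x)\<^sup>2 + 1 + \<sigma> * a x * sqrt ((a x)\<^sup>2 + 1)))) *\<^sub>R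
        ((a x + \<sigma> * sqrt ((a x)\<^sup>2 + 1)) *\<^sub>R \<phi> x + \<nu> x),
      arccot (a x + \<sigma> * sqrt ((a x)\<^sup>2 + 1)))"

end

theory Submission
  imports Defs
begin

text \<open>
  Write a spacelike immersion into the cylinder as \<open>f = (\<psi>, \<tau>)\<close>. A null normal of \<open>f\<close>
  has a nonzero last component, so it can be scaled to \<open>(\<mu>, 1)\<close>; then \<open>\<mu>\<close> is a unit vector
  orthogonal to \<open>\<psi>\<close> with \<open>\<langle>\<mu>, d\<psi>\<rangle> = d\<tau>\<close>. Everything comes from rotating the
  orthonormal pair \<open>(\<psi>, \<mu>)\<close> by an angle \<open>\<theta>\<close> that differs from \<open>\<tau>\<close> by a constant:
  for \<open>\<phi> = cos \<theta> \<psi> - sin \<theta> \<mu>\<close> and \<open>\<nu> = sin \<theta> \<psi> + cos \<theta> \<mu>\<close>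
  the identity \<open>\<langle>\<mu>, d\<psi>\<rangle> = d\<tau>\<close> says exactly that \<open>\<langle>\<nu>, d\<phi>\<rangle> = 0\<close>, that
  is, \<open>\<nu>\<close> is a Gauss map of \<open>\<phi>\<close>, and conversely \<open>\<phi>\<close>, \<open>\<nu>\<close>, \<open>\<theta>\<close> give back
  \<open>f\<close> up to a translation along the axis.

  Let \<open>A\<close> be the shape operator of \<open>\<phi>\<close>, \<open>g\<close> its first fundamental form and \<open>s = cot \<theta>\<close>.
  Then \<open>d\<psi> = d\<phi> \<circ> B + d\<theta> \<mu>\<close> with \<open>B = sin \<theta> (s - A)\<close>, so the induced metric is
  \<open>g(B X, B Y)\<close>, and the second fundamental form of \<open>f\<close> paired with \<open>(\<mu>, 1)\<close> is
  \<open>sin \<theta> g(B Y, (1 + s A) X)\<close>. In an eigenbasis of \<open>A\<close> the trace of the latter with respect to the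
  former is the sum of \<open>(1 + s \<kappa>) / (s - \<kappa>)\<close> over the principal curvatures, counted with
  multiplicity (\<open>lift_mean_curvature_trace\<close>). The numerator of this rational function is the polynomial
  of the theorem. Hence \<open>s\<close> is a root iff the mean curvature vector is orthogonal to \<open>(\<mu>, 1)\<close>; as
  the normal plane is Lorentzian, the mean curvature vector is then a multiple of \<open>(\<mu>, 1)\<close>
  and so is null (\<open>lift_null_mean_curvature\<close>).

  \<^emph>\<open>Counting the roots.\<close> The partial fractions \<open>\<kappa> + (1 + \<kappa>\<^sup>2) / (s - \<kappa>)\<close> make the
  rational function strictly decreasing between its poles. So there is a root in each of the \<open>p - 1\<close>
  gaps, and one more outside iff the limit at infinity, the mean curvature, does not vanish
  (\<open>card_weighted_poly_roots\<close>).

  \<^emph>\<open>Regularity of the roots.\<close> Principal curvatures need not be differentiable where they meet.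
  The equation is therefore written as \<open>tr ((s A + 1) (s - A)\<^sup>-\<^sup>1) = 0\<close>, whose left side is as regular
  as \<open>A\<close>; its derivative in \<open>s\<close> is negative, and the implicit function theorem applies to every
  continuous root (\<open>root_function_Ck\<close>).

  \<^emph>\<open>The converse.\<close> The normal plane contains two null lines, which are spanned locally by two continuous
  fields (\<open>local_null_normals\<close>). The mean curvature vector is null iff one of its products with these
  fields vanishes (\<open>null_decomposition\<close>). Near a point where it is not zero, one product is
  nonzero, hence the other one vanishes on a neighbourhood, and the rotation above applies with this field
  (\<open>locally_congruent_if_null\<close>). The same works where the mean curvature vector vanishes on an open set.
  These two kinds of points are dense. The constant in \<open>\<theta>\<close> is chosen so that \<open>\<theta>\<close> is small and
  positive at the given point: then \<open>d\<phi>\<close> is close there to \<open>d\<psi> - d\<tau> \<mu>\<close>, which is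
  injective because \<open>f\<close> is spacelike.

  \<^emph>\<open>Null second fundamental form.\<close> If all second derivatives of \<open>f\<close> are orthogonal to \<open>(\<mu>, 1)\<close>,
  then \<open>d\<mu> = - d\<tau> \<psi>\<close>. Taking the exterior derivative, \<open>d\<tau> \<and> d\<psi> = 0\<close>, which in
  dimension at least two forces \<open>d\<tau> = 0\<close>, and \<open>f\<close> is totally geodesic
  (\<open>totally_geodesic_if_null\<close>).

  The computations are done in open subsets of the model space; only conditions that do not depend on the
  chart (tangent and normal spaces, principal curvatures, the trace above) are carried from one chart to
  another.
\<close>

abbreviation fder :: "('a::real_normed_vector \<Rightarrow> 'b::real_normed_vector) \<Rightarrow> 'a \<Rightarrow> 'a \<Rightarrow> 'b" where
  "fder f x \<equiv> frechet_derivative f (at x)"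

section \<open>Calculus of finitely often differentiable maps\<close>

lemma fder_eqI: "(f has_derivative f') (at x) \<Longrightarrow> fder f x v = f' v"
  using frechet_derivative_at by metis

lemma derivative_of_constant:
  assumes "open S" "u \<in> S" "(f has_derivative f') (at u)" "\<And>w. w \<in> S \<Longrightarrow> f w = c"
  shows "f' X = 0"
proof -
  have "(f has_derivative (\<lambda>X. 0)) (at u)"
    by (rule has_derivative_transform_within_open[OF has_derivative_const assms(1,2)]) (simp add: assms(4))
  from has_derivative_unique[OF assms(3) this] show ?thesis by simp
qed

lemma linear_expansion:
  fixes f :: "'a::euclidean_space \<Rightarrow> 'b::real_vector"
  assumes "linear f"
  shows "f x = (\<Sum>b\<in>Basis. (x \<bullet> b) *\<^sub>R f b)"
  using linear_sum[OF assms, of "\<lambda>b. (x \<bullet> b) *\<^sub>R b" Basis] linear_scale[OF assms]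
  by (simp add: euclidean_representation)

lemma Ck_on_cong:
  assumes "open S" "\<And>x. x \<in> S \<Longrightarrow> f x = g x" "Ck_on k S f"
  shows "Ck_on k S g"
  using assms(2,3)
proof (induction k arbitrary: f g)
  case 0
  then show ?case by (metis Ck_on.simps(1) continuous_on_cong)
next
  case (Suc k)
  have d: "(f has_derivative fder f x) (at x)" if "x \<in> S" for x
    using Suc.prems(2) that frechet_derivative_works by auto
  have d': "(g has_derivative fder f x) (at x)" if "x \<in> S" for x
    using has_derivative_transform_within_open[OF d[OF that] assms(1) that] Suc.prems(1) by auto
  have e: "fder g x = fder f x" if "x \<in> S" for x
    using frechet_derivative_at[OF d'[OF that]] by simp
  have "Ck_on k S (\<lambda>x. fder g x v)" for v
    by (rule Suc.IH[of "\<lambda>x. fder f x v"]) (use Suc.prems(2) e in auto)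
  then show ?case using d' by (auto simp: differentiable_def)
qed

lemma Ck_on_SucI:
  assumes "open S" "\<And>x. x \<in> S \<Longrightarrow> (f has_derivative f' x) (at x)"
    "\<And>v. Ck_on k S (\<lambda>x. f' x v)"
  shows "Ck_on (Suc k) S f"
proof -
  have "Ck_on k S (\<lambda>x. fder f x v)" for v
    by (rule Ck_on_cong[OF assms(1) _ assms(3)[of v]]) (simp add: frechet_derivative_at[OF assms(2), symmetric])
  then show ?thesis using assms(2) by (auto simp: differentiable_def)
qed

lemma Ck_on_has_derivative:
  assumes "Ck_on (Suc k) S f" "x \<in> S"
  shows "(f has_derivative fder f x) (at x)"
  using assms frechet_derivative_works by auto

lemma Ck_on_fder: "Ck_on (Suc k) S f \<Longrightarrow> Ck_on k S (\<lambda>x. fder f x v)"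
  by simp

lemma Ck_on_pred: "Ck_on (Suc k) S f \<Longrightarrow> Ck_on k S f"
proof (induction k arbitrary: f)
  case 0
  then show ?case
    by (auto intro!: continuous_at_imp_continuous_on differentiable_imp_continuous_within)
next
  case (Suc k)
  then show ?case by simp
qed

lemma Ck_on_mono: "j \<le> k \<Longrightarrow> Ck_on k S f \<Longrightarrow> Ck_on j S f"
  by (induction k rule: nat_induct) (use Ck_on_pred le_Suc_eq in \<open>auto simp del: Ck_on.simps(2)\<close>)

lemma Ck_on_subset: "T \<subseteq> S \<Longrightarrow> Ck_on k S f \<Longrightarrow> Ck_on k T f"
  by (induction k arbitrary: f) (auto intro: continuous_on_subset)

lemma Ck_on_continuous: "Ck_on k S f \<Longrightarrow> continuous_on S f"
  using Ck_on_mono[of 0 k S f] by simp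

lemma Ck_on_const: "Ck_on k S (\<lambda>x. c)"
  by (induction k arbitrary: c) auto

lemma Ck_on_ident: "open S \<Longrightarrow> Ck_on k S (\<lambda>x. x)"
proof (cases k)
  case (Suc j)
  assume "open S"
  then show ?thesis unfolding Suc
    by (rule Ck_on_SucI[where f'="\<lambda>x v. v"]) (auto intro: Ck_on_const)
qed auto

lemma Ck_on_linear:
  assumes S: "open S" and L: "bounded_linear L" and f: "Ck_on k S f"
  shows "Ck_on k S (\<lambda>x. L (f x))"
  using f
proof (induction k arbitrary: f)
  case 0
  then show ?case using L by (simp add: bounded_linear.continuous_on)
next
  case (Suc k)
  show ?case
    by (rule Ck_on_SucI[OF S bounded_linear.has_derivative[OF L Ck_on_has_derivative[OF Suc.prems]]])
      (auto intro: Suc.IH Ck_on_fder[OF Suc.prems])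
qed

lemma Ck_on_add:
  assumes S: "open S" and "Ck_on k S f" "Ck_on k S g"
  shows "Ck_on k S (\<lambda>x. f x + g x)"
  using assms(2,3)
proof (induction k arbitrary: f g)
  case 0
  then show ?case by (auto intro: continuous_on_add)
next
  case (Suc k)
  show ?case
    by (rule Ck_on_SucI[OF S has_derivative_add[OF Ck_on_has_derivative[OF Suc.prems(1)]
            Ck_on_has_derivative[OF Suc.prems(2)]]])
      (auto intro: Suc.IH Ck_on_fder[OF Suc.prems(1)] Ck_on_fder[OF Suc.prems(2)])
qed

lemma Ck_on_bilinear:
  assumes S: "open S" and p: "bounded_bilinear p" and "Ck_on k S f" "Ck_on k S g"
  shows "Ck_on k S (\<lambda>x. p (f x) (g x))"
  using assms(3,4)
proof (induction k arbitrary: f g)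
  case 0
  then show ?case using p by (auto intro: bounded_bilinear.continuous_on)
next
  case (Suc k)
  show ?case
    by (rule Ck_on_SucI[OF S bounded_bilinear.FDERIV[OF p Ck_on_has_derivative[OF Suc.prems(1)]
            Ck_on_has_derivative[OF Suc.prems(2)]]])
      (auto intro!: Ck_on_add[OF S] Suc.IH Ck_on_fder[OF Suc.prems(1)] Ck_on_fder[OF Suc.prems(2)]
        Ck_on_pred[OF Suc.prems(1)] Ck_on_pred[OF Suc.prems(2)])
qed

lemmas Ck_on_scaleR = Ck_on_bilinear[OF _ bounded_bilinear_scaleR]
lemmas Ck_on_inner = Ck_on_bilinear[OF _ bounded_bilinear_inner]
lemmas Ck_on_mult = Ck_on_bilinear[OF _ bounded_bilinear_mult]
lemmas Ck_on_minus = Ck_on_linear[OF _ bounded_linear_minus[OF bounded_linear_ident]]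
lemmas Ck_on_fst = Ck_on_linear[OF _ bounded_linear_fst]
lemmas Ck_on_snd = Ck_on_linear[OF _ bounded_linear_snd]

lemma Ck_on_diff:
  "open S \<Longrightarrow> Ck_on k S f \<Longrightarrow> Ck_on k S g \<Longrightarrow> Ck_on k S (\<lambda>x. f x - g x)"
  using Ck_on_add[of S k f "\<lambda>x. - g x"] Ck_on_minus[of S k g] by simp

lemma Ck_on_sum:
  assumes S: "open S" and "\<And>i. i \<in> I \<Longrightarrow> Ck_on k S (f i)"
  shows "Ck_on k S (\<lambda>x. \<Sum>i\<in>I. f i x)"
  using assms(2)
  by (induction I rule: infinite_finite_induct) (auto intro: Ck_on_const Ck_on_add[OF S])

lemma Ck_on_Pair:
  assumes S: "open S" and "Ck_on k S f" "Ck_on k S g"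
  shows "Ck_on k S (\<lambda>x. (f x, g x))"
proof -
  have "Ck_on k S (\<lambda>x. (f x, 0) + (0, g x))"
    by (intro Ck_on_add[OF S] Ck_on_linear[OF S _ assms(2)] Ck_on_linear[OF S _ assms(3)])
      (auto intro!: bounded_linear_intros)
  then show ?thesis by simp
qed

text \<open>Expanding the inner derivative in the standard basis of the intermediate space turns the chain rule
  into a finite sum of products of maps to which the induction hypothesis applies.\<close>

lemma Ck_on_compose:
  fixes f :: "'a::real_normed_vector \<Rightarrow> 'c::euclidean_space"
  assumes S: "open S" and "Ck_on k S f" "Ck_on k T g" and sub: "\<And>x. x \<in> S \<Longrightarrow> f x \<in> T"
  shows "Ck_on k S (\<lambda>x. g (f x))"
  using assms(2,3) sub
proof (induction k arbitrary: f g)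
  case 0
  then show ?case by (auto intro: continuous_on_compose2)
next
  case (Suc k)
  note f = Suc.prems(1) and g = Suc.prems(2)
  have *: "((\<lambda>x. g (f x)) has_derivative (\<lambda>v. \<Sum>b\<in>Basis. (fder f x v \<bullet> b) *\<^sub>R fder g (f x) b)) (at x)"
    if "x \<in> S" for x
  proof -
    have "((\<lambda>x. g (f x)) has_derivative (\<lambda>v. fder g (f x) (fder f x v))) (at x)"
      using diff_chain_at[OF Ck_on_has_derivative[OF f that] Ck_on_has_derivative[OF g]] Suc.prems(3)[OF that]
      by (simp add: o_def)
    moreover have "fder g (f x) w = (\<Sum>b\<in>Basis. (w \<bullet> b) *\<^sub>R fder g (f x) b)" for w
      using Ck_on_has_derivative[OF g Suc.prems(3)[OF that]] has_derivative_linear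
      by (intro linear_expansion) blast
    ultimately show ?thesis by (metis (no_types, lifting) ext)
  qed
  show ?case
    by (rule Ck_on_SucI[OF S *])
      (auto intro!: Ck_on_sum[OF S] Ck_on_scaleR[OF S] Ck_on_inner[OF S] Ck_on_fder[OF f] Ck_on_const
        Suc.IH Ck_on_pred[OF f] Ck_on_fder[OF g] Suc.prems(3) simp del: Ck_on.simps)
qed

lemma Ck_on_sin_cos:
  "Ck_on k (UNIV::real set) sin \<and> Ck_on k (UNIV::real set) cos"
proof (induction k)
  case 0
  then show ?case by (auto intro!: continuous_intros)
next
  case (Suc k)
  have "Ck_on k (UNIV::real set) (\<lambda>x. v * cos x)" "Ck_on k (UNIV::real set) (\<lambda>x. v * - sin x)" for v
    using Suc by (auto intro!: Ck_on_mult Ck_on_const Ck_on_minus)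
  then show ?case
    by (intro conjI Ck_on_SucI[where f'="\<lambda>x v. v * cos x"] Ck_on_SucI[where f'="\<lambda>x v. v * - sin x"])
      (auto intro!: derivative_eq_intros)
qed

lemma Ck_on_sin: "open S \<Longrightarrow> Ck_on k S f \<Longrightarrow> Ck_on k S (\<lambda>x. sin (f x :: real))"
  and Ck_on_cos: "open S \<Longrightarrow> Ck_on k S f \<Longrightarrow> Ck_on k S (\<lambda>x. cos (f x :: real))"
  by (rule Ck_on_compose[where T=UNIV]; use Ck_on_sin_cos in auto)+

lemma Ck_on_inverse_real:
  "Ck_on k (- {0::real}) inverse"
proof (induction k)
  case 0
  then show ?case by (auto intro!: continuous_intros)
next
  case (Suc k)
  have *: "(inverse has_derivative (\<lambda>v. - (inverse x * v * inverse x))) (at x)" if "x \<noteq> 0" for x :: real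
    using has_derivative_inverse'[OF that] .
  show ?case
    by (rule Ck_on_SucI[OF _ *]) (auto intro!: Ck_on_minus Ck_on_mult Ck_on_const Suc)
qed

lemma Ck_on_inverse:
  fixes f :: "'a::real_normed_vector \<Rightarrow> real"
  shows "open S \<Longrightarrow> Ck_on k S f \<Longrightarrow> (\<And>x. x \<in> S \<Longrightarrow> f x \<noteq> 0) \<Longrightarrow> Ck_on k S (\<lambda>x. inverse (f x))"
  by (rule Ck_on_compose[where T="- {0}"]) (use Ck_on_inverse_real in auto)

lemma Ck_on_arctan:
  fixes f :: "'a::real_normed_vector \<Rightarrow> real"
  assumes "open S" "Ck_on k S f"
  shows "Ck_on k S (\<lambda>x. arctan (f x))"
proof -
  have "Ck_on k (UNIV::real set) arctan"
  proof (cases k)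
    case 0
    then show ?thesis by (auto intro!: continuous_intros)
  next
    case (Suc j)
    have *: "1 + x * x \<noteq> 0" for x :: real by (smt (verit) zero_le_square)
    show ?thesis unfolding Suc
      by (rule Ck_on_SucI[where f'="\<lambda>x v. v * inverse (1 + x * x)"])
        (use * in \<open>auto intro!: derivative_eq_intros Ck_on_mult Ck_on_inverse Ck_on_add Ck_on_const Ck_on_ident
          simp: power2_eq_square\<close>)
  qed
  then show ?thesis using assms Ck_on_compose[of S k f UNIV arctan] by auto
qed

lemma smooth_on_translation: "smooth_on UNIV (\<lambda>p::'a::real_normed_vector. p + c)"
  by (simp add: smooth_on_def Ck_on_add Ck_on_ident Ck_on_const)

section \<open>Symmetry of second derivatives\<close>

text \<open>Two applications of the mean value theorem, first along \<open>X\<close> and then along \<open>Y\<close>. The left side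
  does not change when \<open>X\<close> and \<open>Y\<close> are exchanged, which is what makes second derivatives symmetric.\<close>

lemma second_difference_mean_value:
  fixes f :: "'a::real_normed_vector \<Rightarrow> real"
  assumes S: "open S" and f: "Ck_on 2 S f" and h: "0 < h"
    and sub: "\<And>s t. 0 \<le> s \<Longrightarrow> s \<le> h \<Longrightarrow> 0 \<le> t \<Longrightarrow> t \<le> h \<Longrightarrow> u + s *\<^sub>R X + t *\<^sub>R Y \<in> S"
  obtains s t where "0 < s" "s < h" "0 < t" "t < h"
    "f (u + h *\<^sub>R X + h *\<^sub>R Y) - f (u + h *\<^sub>R X) - f (u + h *\<^sub>R Y) + f u
      = h * (h * fder (\<lambda>w. fder f w X) (u + s *\<^sub>R X + t *\<^sub>R Y) Y)"
proof -
  have f2: "Ck_on (Suc (Suc 0)) S f" using f by (simp add: numeral_2_eq_2)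
  have d: "(f has_derivative fder f w) (at w)" if "w \<in> S" for w
    by (rule Ck_on_has_derivative[OF f2 that])
  have dd: "((\<lambda>w. fder f w X) has_derivative fder (\<lambda>w. fder f w X) w) (at w)" if "w \<in> S" for w
    by (rule Ck_on_has_derivative[OF Ck_on_fder[OF f2] that])
  have der: "DERIV (\<lambda>s. g (c + s *\<^sub>R Z)) s :> g' Z"
    if "(g has_derivative g') (at (c + s *\<^sub>R Z))" for g g' c s and Z :: 'a
  proof -
    have "((\<lambda>s. c + s *\<^sub>R Z) has_derivative (\<lambda>v. v *\<^sub>R Z)) (at s)"
      by (auto intro!: derivative_eq_intros)
    from diff_chain_at[OF this that] have "((\<lambda>s. g (c + s *\<^sub>R Z)) has_derivative (\<lambda>v. g' (v *\<^sub>R Z))) (at s)"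
      by (simp add: o_def)
    moreover have "g' (v *\<^sub>R Z) = v * g' Z" for v
      using linear_scale[OF has_derivative_linear[OF that]] by simp
    moreover have "(*) (g' Z) = (\<lambda>v. v * g' Z)" by (simp add: fun_eq_iff)
    ultimately show ?thesis by (simp only: has_field_derivative_def)
  qed
  define k where "k s = f ((u + h *\<^sub>R Y) + s *\<^sub>R X) - f (u + s *\<^sub>R X)" for s
  have "\<exists>s. 0 < s \<and> s < h \<and> k h - k 0 = (h - 0) *
      (fder f ((u + h *\<^sub>R Y) + s *\<^sub>R X) X - fder f (u + s *\<^sub>R X) X)"
  proof (rule MVT2[OF h])
    fix s assume s: "0 \<le> s" "s \<le> h"
    have "u + h *\<^sub>R Y + s *\<^sub>R X \<in> S" using sub[OF s, of h] h by (simp add: add_ac)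
    moreover have "u + s *\<^sub>R X \<in> S" using sub[OF s, of 0] h by simp
    ultimately show "DERIV k s :> fder f ((u + h *\<^sub>R Y) + s *\<^sub>R X) X - fder f (u + s *\<^sub>R X) X"
      unfolding k_def by (intro DERIV_diff der d)
  qed
  then obtain s where s: "0 < s" "s < h" and k: "k h - k 0 = h *
      (fder f ((u + s *\<^sub>R X) + h *\<^sub>R Y) X - fder f ((u + s *\<^sub>R X) + 0 *\<^sub>R Y) X)"
    by (auto simp: add.assoc add.commute[of "h *\<^sub>R Y"])
  have "\<exists>t. 0 < t \<and> t < h \<and> fder f ((u + s *\<^sub>R X) + h *\<^sub>R Y) X - fder f ((u + s *\<^sub>R X) + 0 *\<^sub>R Y) X
     = (h - 0) * fder (\<lambda>w. fder f w X) ((u + s *\<^sub>R X) + t *\<^sub>R Y) Y"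
    by (rule MVT2[OF h der[OF dd[OF sub]]]) (use s in auto)
  then obtain t where "0 < t" "t < h" "fder f ((u + s *\<^sub>R X) + h *\<^sub>R Y) X - fder f ((u + s *\<^sub>R X) + 0 *\<^sub>R Y) X
     = h * fder (\<lambda>w. fder f w X) ((u + s *\<^sub>R X) + t *\<^sub>R Y) Y" by auto
  with s k show thesis
    by (intro that[of s t]) (simp_all add: k_def add.assoc add.commute[of "h *\<^sub>R Y"])
qed

lemma second_derivative_symmetric_real:
  fixes f :: "'a::real_normed_vector \<Rightarrow> real"
  assumes S: "open S" and f: "Ck_on 2 S f" and u: "u \<in> S"
  shows "fder (\<lambda>w. fder f w X) u Y = fder (\<lambda>w. fder f w Y) u X"
proof (rule ccontr)
  define a where "a = (\<lambda>w. fder (\<lambda>w. fder f w X) w Y)"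
  define b where "b = (\<lambda>w. fder (\<lambda>w. fder f w Y) w X)"
  assume "\<not> ?thesis"
  then have e: "\<bar>a u - b u\<bar> > 0" by (simp add: a_def b_def)
  define e where "e = \<bar>a u - b u\<bar> / 2"
  have "continuous_on S a" "continuous_on S b"
    using f by (auto simp: a_def b_def numeral_2_eq_2)
  then have "isCont a u" "isCont b u"
    using S u continuous_on_eq_continuous_at by blast+
  moreover have "e > 0" using e by (simp add: e_def)
  ultimately obtain d1 d2 where d1: "d1 > 0" "\<And>w. dist w u < d1 \<Longrightarrow> dist (a w) (a u) < e"
    and d2: "d2 > 0" "\<And>w. dist w u < d2 \<Longrightarrow> dist (b w) (b u) < e"
    unfolding continuous_at_eps_delta by metis
  obtain d3 where d3: "d3 > 0" "ball u d3 \<subseteq> S" using S u open_contains_ball by blast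
  define d where "d = min d1 (min d2 d3)"
  have d: "d > 0" using d1 d2 d3 by (simp add: d_def)
  \<comment> \<open>\<open>h\<close> is so small that the parallelogram with sides \<open>h X\<close>, \<open>h Y\<close> stays in the ball of radius \<open>d\<close>\<close>
  define N where "N = norm X + norm Y + 1"
  define h where "h = d / (2 * N)"
  have np: "N > 0" unfolding N_def by (smt (verit) norm_ge_zero)
  have h: "h > 0" using d np by (simp add: h_def)
  have near: "dist (u + s *\<^sub>R X + t *\<^sub>R Y) u < d" if "0 \<le> s" "s \<le> h" "0 \<le> t" "t \<le> h" for s t
  proof -
    have "norm (s *\<^sub>R X + t *\<^sub>R Y) \<le> s * norm X + t * norm Y"
      using that norm_triangle_ineq[of "s *\<^sub>R X" "t *\<^sub>R Y"] by simp
    also have "\<dots> \<le> h * norm X + h * norm Y" using that by (intro add_mono mult_right_mono) auto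
    also have "\<dots> < h * N" using h by (simp add: algebra_simps N_def)
    also have "\<dots> = d / 2" using np by (simp add: h_def)
    also have "\<dots> < d" using d by simp
    finally show ?thesis by (simp add: dist_norm add.assoc)
  qed
  have inS: "u + s *\<^sub>R X + t *\<^sub>R Y \<in> S" if "0 \<le> s" "s \<le> h" "0 \<le> t" "t \<le> h" for s t
    using near[OF that] d3 by (auto simp: d_def dist_commute)
  obtain s t where st: "0 < s" "s < h" "0 < t" "t < h" and
    1: "f (u + h *\<^sub>R X + h *\<^sub>R Y) - f (u + h *\<^sub>R X) - f (u + h *\<^sub>R Y) + f u
      = h * (h * a (u + s *\<^sub>R X + t *\<^sub>R Y))"
    unfolding a_def by (rule second_difference_mean_value[OF S f h inS])
  have "u + s *\<^sub>R Y + t *\<^sub>R X \<in> S" if "0 \<le> s" "s \<le> h" "0 \<le> t" "t \<le> h" for s t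
    using inS[of t s] that by (simp add: add_ac)
  then obtain s' t' where st': "0 < s'" "s' < h" "0 < t'" "t' < h" and
    2: "f (u + h *\<^sub>R Y + h *\<^sub>R X) - f (u + h *\<^sub>R Y) - f (u + h *\<^sub>R X) + f u
      = h * (h * b (u + s' *\<^sub>R Y + t' *\<^sub>R X))"
    unfolding b_def by (rule second_difference_mean_value[OF S f h, of u Y X]) auto
  have "h * (h * a (u + s *\<^sub>R X + t *\<^sub>R Y)) = h * (h * b (u + t' *\<^sub>R X + s' *\<^sub>R Y))"
    using 1 2 unfolding add.assoc add.commute[of "h *\<^sub>R Y"] add.commute[of "s' *\<^sub>R Y"] by linarith
  then have "a (u + s *\<^sub>R X + t *\<^sub>R Y) = b (u + t' *\<^sub>R X + s' *\<^sub>R Y)" using h by simp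
  moreover have "dist (a (u + s *\<^sub>R X + t *\<^sub>R Y)) (a u) < e" "dist (b (u + t' *\<^sub>R X + s' *\<^sub>R Y)) (b u) < e"
    using near st st' d1 d2 unfolding d_def by (smt (verit))+
  ultimately have "dist (a u) (b u) < e + e"
    by (metis dist_commute dist_triangle_less_add)
  then show False by (simp add: e_def dist_real_def)
qed

lemma second_derivative_symmetric:
  fixes f :: "'a::real_normed_vector \<Rightarrow> 'b::euclidean_space"
  assumes S: "open S" and f: "Ck_on 2 S f" and u: "u \<in> S"
  shows "fder (\<lambda>w. fder f w X) u Y = fder (\<lambda>w. fder f w Y) u X"
proof (rule euclidean_eqI)
  fix b :: 'b assume "b \<in> Basis"
  have f2: "Ck_on (Suc (Suc 0)) S f" using f by (simp add: numeral_2_eq_2)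
  have bl: "bounded_linear (\<lambda>x. x \<bullet> b)" by (rule bounded_linear_inner_left)
  have fb: "Ck_on 2 S (\<lambda>x. f x \<bullet> b)" by (rule Ck_on_linear[OF S bl f])
  have 1: "fder (\<lambda>x. f x \<bullet> b) w X = fder f w X \<bullet> b" if "w \<in> S" for w X
    using frechet_derivative_at[OF bounded_linear.has_derivative[OF bl Ck_on_has_derivative[OF f2 that]]] by metis
  have 2: "fder (\<lambda>w. fder (\<lambda>x. f x \<bullet> b) w X) u Y = fder (\<lambda>w. fder f w X) u Y \<bullet> b" for X Y
  proof -
    have "((\<lambda>w. fder f w X \<bullet> b) has_derivative (\<lambda>Y. fder (\<lambda>w. fder f w X) u Y \<bullet> b)) (at u)"
      by (rule bounded_linear.has_derivative[OF bl Ck_on_has_derivative[OF Ck_on_fder[OF f2] u]])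
    then have "((\<lambda>w. fder (\<lambda>x. f x \<bullet> b) w X) has_derivative (\<lambda>Y. fder (\<lambda>w. fder f w X) u Y \<bullet> b)) (at u)"
      by (rule has_derivative_transform_within_open[OF _ S u]) (simp add: 1)
    from frechet_derivative_at[OF this] show ?thesis by metis
  qed
  show "fder (\<lambda>w. fder f w X) u Y \<bullet> b = fder (\<lambda>w. fder f w Y) u X \<bullet> b"
    using second_derivative_symmetric_real[OF S fb u, of X Y] by (simp add: 2)
qed

section \<open>Implicitly defined maps\<close>

text \<open>An injective linear map is bounded below, and in finite dimension pointwise continuity of the family
  is continuity in operator norm; so the lower bound survives, with half the constant, in a neighbourhood.\<close>

lemma linear_family_injective_near:
  fixes G :: "'a::metric_space \<Rightarrow> 'b::euclidean_space \<Rightarrow> 'c::euclidean_space"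
  assumes S: "open S" and lin: "\<And>u. u \<in> S \<Longrightarrow> linear (G u)"
    and cont: "\<And>z. continuous_on S (\<lambda>u. G u z)" and u: "u \<in> S" and inj: "inj (G u)"
  obtains c where "c > 0" "\<forall>\<^sub>F w in nhds u. w \<in> S \<and> (\<forall>z. c * norm z \<le> norm (G w z))"
proof -
  obtain B where B: "B > 0" "\<And>z. B * norm z \<le> norm (G u z)"
    using linear_inj_bounded_below_pos[OF lin[OF u] inj] by blast
  have "continuous_on S (\<lambda>w. \<Sum>b\<in>Basis. norm (G w b - G u b))"
    by (intro continuous_intros cont)
  then have "isCont (\<lambda>w. \<Sum>b\<in>Basis. norm (G w b - G u b)) u"
    using S u continuous_on_eq_continuous_at by blast
  then have "((\<lambda>w. \<Sum>b\<in>Basis. norm (G w b - G u b)) \<longlongrightarrow> (\<Sum>b\<in>Basis. norm (G u b - G u b))) (nhds u)"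
    using tendsto_at_iff_tendsto_nhds[of "\<lambda>w. \<Sum>b\<in>Basis. norm (G w b - G u b)" u] unfolding isCont_def by simp
  then have "((\<lambda>w. \<Sum>b\<in>Basis. norm (G w b - G u b)) \<longlongrightarrow> 0) (nhds u)" by simp
  then have "\<forall>\<^sub>F w in nhds u. (\<Sum>b\<in>Basis. norm (G w b - G u b)) < B / 2"
    using B(1) by (intro order_tendstoD) auto
  moreover have "\<forall>\<^sub>F w in nhds u. w \<in> S" using S u eventually_nhds_in_open by blast
  ultimately have "\<forall>\<^sub>F w in nhds u. w \<in> S \<and> (\<forall>z. B / 2 * norm z \<le> norm (G w z))"
  proof eventually_elim
    case (elim w)
    have "B / 2 * norm z \<le> norm (G w z)" for z
    proof -
      have ld: "linear (\<lambda>z. G w z - G u z)"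
        using lin[OF u] lin elim by (intro linear_compose_sub) auto
      have "G w z - G u z = (\<Sum>b\<in>Basis. (z \<bullet> b) *\<^sub>R (G w b - G u b))"
        by (rule linear_expansion[OF ld])
      also have "norm \<dots> \<le> (\<Sum>b\<in>Basis. norm ((z \<bullet> b) *\<^sub>R (G w b - G u b)))" by (rule norm_sum)
      also have "\<dots> \<le> (\<Sum>b\<in>Basis. norm z * norm (G w b - G u b))"
        by (intro sum_mono) (auto intro!: mult_right_mono Basis_le_norm)
      also have "\<dots> = norm z * (\<Sum>b\<in>Basis. norm (G w b - G u b))" by (simp add: sum_distrib_left)
      also have "\<dots> \<le> norm z * (B / 2)" using elim by (intro mult_left_mono) auto
      finally show ?thesis using B(2)[of z] norm_triangle_ineq2[of "G u z" "G w z"]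
        by (simp add: norm_minus_commute field_simps)
    qed
    then show ?case using elim by blast
  qed
  then show thesis using that[of "B/2"] B(1) by auto
qed

lemma open_linear_family_inj:
  fixes G :: "'a::metric_space \<Rightarrow> 'b::euclidean_space \<Rightarrow> 'c::euclidean_space"
  assumes S: "open S" and lin: "\<And>u. u \<in> S \<Longrightarrow> linear (G u)"
    and cont: "\<And>z. continuous_on S (\<lambda>u. G u z)"
  shows "open {u \<in> S. inj (G u)}"
proof (subst open_subopen, safe)
  fix u assume u: "u \<in> S" "inj (G u)"
  obtain c where c: "c > 0" "\<forall>\<^sub>F w in nhds u. w \<in> S \<and> (\<forall>z. c * norm z \<le> norm (G w z))"
    by (rule linear_family_injective_near[OF assms u])
  then obtain T where T: "open T" "u \<in> T" "\<And>w. w \<in> T \<Longrightarrow> w \<in> S \<and> (\<forall>z. c * norm z \<le> norm (G w z))"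
    unfolding eventually_nhds by blast
  have "inj (G w)" if "w \<in> T" for w
  proof -
    have "z = 0" if "G w z = 0" for z
      using T(3)[OF \<open>w \<in> T\<close>] c(1) that by (smt (verit, best) mult_pos_pos norm_eq_zero zero_less_norm_iff)
    then show ?thesis using lin T(3)[OF that] linear_injective_0 by blast
  qed
  then show "\<exists>T. open T \<and> u \<in> T \<and> T \<subseteq> {u \<in> S. inj (G u)}" using T by blast
qed

lemma linear_system_continuous:
  fixes G :: "'a::metric_space \<Rightarrow> 'b::euclidean_space \<Rightarrow> 'c::euclidean_space"
  assumes S: "open S" and lin: "\<And>u. u \<in> S \<Longrightarrow> linear (G u)"
    and cont: "\<And>z. continuous_on S (\<lambda>u. G u z)" and inj: "\<And>u. u \<in> S \<Longrightarrow> inj (G u)"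
    and r: "continuous_on S r" and eq: "\<And>u. u \<in> S \<Longrightarrow> G u (y u) = r u"
  shows "continuous_on S y"
  unfolding continuous_on_eq_continuous_at[OF S]
proof
  fix u assume u: "u \<in> S"
  obtain c where c: "c > 0" "\<forall>\<^sub>F w in nhds u. w \<in> S \<and> (\<forall>z. c * norm z \<le> norm (G w z))"
    by (rule linear_family_injective_near[OF S lin cont u inj[OF u]])
  have "continuous_on S (\<lambda>w. norm (r w - G w (y u)) / c)"
    using c by (intro continuous_intros cont r) auto
  then have "isCont (\<lambda>w. norm (r w - G w (y u)) / c) u"
    using S u continuous_on_eq_continuous_at by blast
  then have lim: "((\<lambda>w. norm (r w - G w (y u)) / c) \<longlongrightarrow> 0) (at u)"
    using eq[OF u] by (simp add: isCont_def)
  have "\<forall>\<^sub>F w in nhds u. dist (y w) (y u) \<le> norm (r w - G w (y u)) / c"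
    using c(2)
  proof eventually_elim
    case (elim w)
    then have "c * norm (y w - y u) \<le> norm (G w (y w - y u))" by blast
    also have "G w (y w - y u) = r w - G w (y u)" using elim by (simp add: linear_diff[OF lin] eq)
    finally show ?case using c(1) by (simp add: dist_norm field_simps)
  qed
  then have "\<forall>\<^sub>F w in at u. dist (y w) (y u) \<le> norm (r w - G w (y u)) / c"
    by (meson eventually_mono eventually_nhds_conv_at)
  then have "((\<lambda>w. dist (y w) (y u)) \<longlongrightarrow> 0) (at u)"
    by (intro tendsto_sandwich[OF _ _ tendsto_const lim]) auto
  then show "isCont y u" unfolding isCont_def by (rule Lim_transform_eventually[OF tendsto_dist_iff[THEN iffD2]]) auto
qed

text \<open>The half of the implicit function theorem in which a continuous solution is given. The solution first
  turns out to be Lipschitz at the point, and this makes the remainder of \<open>\<Phi>\<close> small of first order.\<close>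

lemma implicit_has_derivative:
  fixes y :: "'a::real_normed_vector \<Rightarrow> 'b::euclidean_space"
    and \<Phi> :: "'a \<times> 'b \<Rightarrow> 'c::euclidean_space"
  assumes d: "(\<Phi> has_derivative L) (at (u, y u))" and cont: "isCont y u"
    and zero: "\<forall>\<^sub>F w in nhds u. \<Phi> (w, y w) = 0" and inj: "inj (\<lambda>z. L (0, z))"
  shows "y differentiable at u"
proof -
  have blL: "bounded_linear L" using d has_derivative_bounded_linear by blast
  then have L: "linear L" using bounded_linear.linear by blast
  have L2: "linear (\<lambda>z. L (0, z))"
    using bounded_linear.linear[OF bounded_linear_compose[OF blL bounded_linear_Pair[OF bounded_linear_zero bounded_linear_ident]]] .
  obtain K where K: "linear K" "K \<circ> (\<lambda>z. L (0, z)) = id"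
    using linear_injective_left_inverse[OF L2 inj] by blast
  have KL: "K (L (0, z)) = z" for z using K(2) by (metis comp_apply id_apply)
  have blK: "bounded_linear K" using K(1) linear_conv_bounded_linear by blast
  obtain k where k: "k > 0" "\<And>z. norm (K z) \<le> norm z * k" using bounded_linear.pos_bounded[OF blK] by blast
  define y' where "y' v = - K (L (v, 0))" for v
  have bly: "bounded_linear y'" unfolding y'_def
    by (intro bounded_linear_minus bounded_linear_compose[OF blK] bounded_linear_compose[OF blL]
      bounded_linear_Pair bounded_linear_ident bounded_linear_zero)
  obtain m where m: "m > 0" "\<And>z. norm (y' z) \<le> norm z * m" using bounded_linear.pos_bounded[OF bly] by blast
  have z0: "\<Phi> (u, y u) = 0" using zero eventually_nhds_x_imp_x by blast
  have "(y has_derivative y') (at u)"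
    unfolding has_derivative_at_alt
  proof (intro conjI bly allI impI)
    fix e :: real assume e: "e > 0"
    \<comment> \<open>the first bound allows absorbing \<open>norm (y w - y u)\<close>; the second gives the required error\<close>
    define e1 where "e1 = min (1 / (2 * k)) (e / (k * (2 + 2 * m)))"
    have e1: "e1 > 0" using k m e by (simp add: e1_def)
    have ke: "k * e1 \<le> 1 / 2"
    proof -
      have "k * e1 \<le> k * (1 / (2 * k))" using k(1) by (intro mult_left_mono) (auto simp: e1_def)
      then show ?thesis using k(1) by simp
    qed
    have ke': "k * e1 * (2 + 2 * m) \<le> e"
    proof -
      have "k * (2 + 2 * m) * e1 \<le> k * (2 + 2 * m) * (e / (k * (2 + 2 * m)))"
        using k(1) m(1) by (intro mult_left_mono) (auto simp: e1_def)
      also have "\<dots> = e"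
      proof -
        have "k * (2 + 2 * m) \<noteq> 0" using k(1) m(1) by simp
        then show ?thesis unfolding times_divide_eq_right by (rule nonzero_mult_div_cancel_left)
      qed
      finally show ?thesis by (simp add: algebra_simps)
    qed
    obtain d1 where d1: "d1 > 0" "\<And>p. norm (p - (u, y u)) < d1 \<Longrightarrow>
        norm (\<Phi> p - \<Phi> (u, y u) - L (p - (u, y u))) \<le> e1 * norm (p - (u, y u))"
      using d e1 unfolding has_derivative_at_alt by blast
    obtain d2 where d2: "d2 > 0" "\<And>w. dist w u < d2 \<Longrightarrow> dist (y w) (y u) < d1 / 2"
      using cont d1(1) unfolding continuous_at_eps_delta by (meson half_gt_zero)
    obtain d3 where d3: "d3 > 0" "\<And>w. dist w u < d3 \<Longrightarrow> \<Phi> (w, y w) = 0"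
      using zero unfolding eventually_nhds_metric by blast
    define dd where "dd = min (d1 / 2) (min d2 d3)"
    show "\<exists>dd>0. \<forall>w. norm (w - u) < dd \<longrightarrow> norm (y w - y u - y' (w - u)) \<le> e * norm (w - u)"
    proof (intro exI[of _ dd] conjI allI impI)
      show "dd > 0" using d1 d2 d3 by (simp add: dd_def)
      fix w assume w: "norm (w - u) < dd"
      define p where "p = (w, y w) - (u, y u)"
      have np: "norm p \<le> norm (w - u) + norm (y w - y u)"
        unfolding p_def by (simp add: norm_Pair sqrt_sum_squares_le_sum)
      have "norm (y w - y u) < d1 / 2" using d2(2)[of w] w by (simp add: dd_def dist_norm)
      then have "norm p < d1" using np w by (simp add: dd_def)
      then have "norm (\<Phi> (w, y w) - \<Phi> (u, y u) - L p) \<le> e1 * norm p" using d1(2)[of "(w, y w)"] unfolding p_def by blast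
      moreover have "\<Phi> (w, y w) = 0" using d3(2)[of w] w by (simp add: dd_def dist_norm)
      ultimately have Lp: "norm (L p) \<le> e1 * norm p" using z0 by simp
      have "L p = L (w - u, 0) + L (0, y w - y u)"
        unfolding p_def using linear_add[OF L, of "(w - u, 0)" "(0, y w - y u)"] by simp
      then have "K (L p) = y w - y u - y' (w - u)"
        by (simp add: linear_add[OF K(1)] KL y'_def)
      then have rem: "norm (y w - y u - y' (w - u)) \<le> k * e1 * norm p"
        using order_trans[OF k(2)[of "L p"] mult_right_mono[OF Lp less_imp_le[OF k(1)]]] by (simp add: mult_ac)
      have "k * e1 * norm p \<le> 1 / 2 * norm p" using ke by (rule mult_right_mono) simp
      also have "\<dots> \<le> 1 / 2 * (norm (w - u) + norm (y w - y u))" using np by simp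
      finally have "norm (y w - y u - y' (w - u)) \<le> 1 / 2 * (norm (w - u) + norm (y w - y u))"
        using rem by (rule order_trans[rotated])
      from norm_triangle_le[OF add_mono[OF this m(2)[of "w - u"]]]
      have "norm (y w - y u) \<le> 1 / 2 * (norm (w - u) + norm (y w - y u)) + norm (w - u) * m" by simp
      then have "norm (y w - y u) \<le> (2 * m + 1) * norm (w - u)" by (simp add: algebra_simps)
      then have "norm p \<le> (2 + 2 * m) * norm (w - u)" using np by (simp add: algebra_simps)
      then have "k * e1 * norm p \<le> k * e1 * ((2 + 2 * m) * norm (w - u))"
        using k(1) e1 by (intro mult_left_mono) auto
      also have "\<dots> \<le> e * norm (w - u)"
        using mult_right_mono[OF ke', of "norm (w - u)"] by (simp add: mult.assoc)
      finally show "norm (y w - y u - y' (w - u)) \<le> e * norm (w - u)" using rem by simp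
    qed
  qed
  then show ?thesis by (auto simp: differentiable_def)
qed

text \<open>The derivative of a solution solves a linear system with the same family \<open>G\<close>, whose right side
  contains the solution itself but no derivative of it; so regularity can be raised one step at a time.\<close>

lemma linear_system_Ck:
  fixes G :: "'a::euclidean_space \<Rightarrow> 'b::euclidean_space \<Rightarrow> 'c::euclidean_space"
  assumes S: "open S" and lin: "\<And>u. u \<in> S \<Longrightarrow> linear (G u)"
    and G: "\<And>z. Ck_on k S (\<lambda>u. G u z)" and inj: "\<And>u. u \<in> S \<Longrightarrow> inj (G u)"
    and r: "Ck_on k S r" and eq: "\<And>u. u \<in> S \<Longrightarrow> G u (y u) = r u"
  shows "Ck_on k S y"
  using G r eq
proof (induction k arbitrary: r y)
  case 0
  have "continuous_on S y"
    by (rule linear_system_continuous[where G=G and r=r and y=y, OF S lin _ inj _ 0(3)]) (use 0(1,2) in auto)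
  then show ?case by simp
next
  case (Suc k)
  note G = Suc.prems(1) and r = Suc.prems(2) and eq = Suc.prems(3)
  have y: "Ck_on k S y" by (rule Suc.IH[OF Ck_on_pred[OF G] Ck_on_pred[OF r] eq])
  have rep: "G u z = (\<Sum>b\<in>Basis. (z \<bullet> b) *\<^sub>R G u b)" if "u \<in> S" for u z
    by (rule linear_expansion[OF lin[OF that]])
  have diff: "y differentiable at u" if u: "u \<in> S" for u
  proof (rule implicit_has_derivative)
    have G': "((\<lambda>p. G (fst p) b) has_derivative (\<lambda>v. fder (\<lambda>u. G u b) u (fst v))) (at (u, y u))" for b
      using diff_chain_at[of fst fst "(u, y u)" "\<lambda>u. G u b" "fder (\<lambda>u. G u b) u",
          OF bounded_linear_imp_has_derivative[OF bounded_linear_fst]]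
        Ck_on_has_derivative[OF G u] by (simp add: o_def)
    have r': "((\<lambda>p. r (fst p)) has_derivative (\<lambda>v. fder r u (fst v))) (at (u, y u))"
      using diff_chain_at[of fst fst "(u, y u)" r "fder r u",
          OF bounded_linear_imp_has_derivative[OF bounded_linear_fst]]
        Ck_on_has_derivative[OF r u] by (simp add: o_def)
    let ?L = "\<lambda>v. (\<Sum>b\<in>Basis. (y u \<bullet> b) *\<^sub>R fder (\<lambda>u. G u b) u (fst v)
        + (snd v \<bullet> b) *\<^sub>R G u b) - fder r u (fst v)"
    show "((\<lambda>p. (\<Sum>b\<in>Basis. (snd p \<bullet> b) *\<^sub>R G (fst p) b) - r (fst p)) has_derivative ?L) (at (u, y u))"
      by (auto intro!: derivative_eq_intros G' r' simp: fun_eq_iff)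
    show "isCont y u" using Ck_on_continuous[OF y] S u continuous_on_eq_continuous_at by blast
    show "\<forall>\<^sub>F w in nhds u. (\<Sum>b\<in>Basis. (snd (w, y w) \<bullet> b) *\<^sub>R G (fst (w, y w)) b) - r (fst (w, y w)) = 0"
      using eventually_nhds_in_open[OF S u] by eventually_elim (simp add: rep[symmetric] eq)
    have "fder (\<lambda>u. G u b) u 0 = 0" "fder r u 0 = 0" for b
      using Ck_on_has_derivative[OF G u, of b] Ck_on_has_derivative[OF r u]
      by (auto dest!: has_derivative_linear linear_0)
    then have "?L (0, z) = G u z" for z using rep[OF u, of z] by simp
    then show "inj (\<lambda>z. ?L (0, z))" using inj[OF u] by simp
  qed
  have *: "G u (fder y u v) = fder r u v - (\<Sum>b\<in>Basis. (y u \<bullet> b) *\<^sub>R fder (\<lambda>u. G u b) u v)"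
    if u: "u \<in> S" for u v
  proof -
    have y': "(y has_derivative fder y u) (at u)" using diff[OF u] frechet_derivative_works by blast
    have "((\<lambda>w. \<Sum>b\<in>Basis. (y w \<bullet> b) *\<^sub>R G w b) has_derivative
        (\<lambda>v. \<Sum>b\<in>Basis. (y u \<bullet> b) *\<^sub>R fder (\<lambda>u. G u b) u v + (fder y u v \<bullet> b) *\<^sub>R G u b)) (at u)"
      by (auto intro!: derivative_eq_intros y' Ck_on_has_derivative[OF G u] simp: fun_eq_iff)
    moreover have "((\<lambda>w. \<Sum>b\<in>Basis. (y w \<bullet> b) *\<^sub>R G w b) has_derivative fder r u) (at u)"
      by (rule has_derivative_transform_within_open[OF Ck_on_has_derivative[OF r u] S u])
        (simp add: rep[symmetric] eq)
    ultimately have "fder r u = (\<lambda>v. \<Sum>b\<in>Basis. (y u \<bullet> b) *\<^sub>R fder (\<lambda>u. G u b) u v + (fder y u v \<bullet> b) *\<^sub>R G u b)"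
      by (rule has_derivative_unique[symmetric])
    from fun_cong[OF this, of v] show ?thesis by (simp add: rep[OF u, of "fder y u v"] sum.distrib)
  qed
  have "Ck_on k S (\<lambda>u. fder y u v)" for v
  proof (rule Suc.IH[OF Ck_on_pred[OF G] _ *])
    show "Ck_on k S (\<lambda>u. fder r u v - (\<Sum>b\<in>Basis. (y u \<bullet> b) *\<^sub>R fder (\<lambda>u. G u b) u v))"
      by (intro Ck_on_diff[OF S] Ck_on_sum[OF S] Ck_on_scaleR[OF S] Ck_on_inner[OF S] y Ck_on_const
        Ck_on_fder[OF r] Ck_on_fder[OF G])
  qed
  then show ?case using diff by simp
qed

lemma implicit_function_Ck:
  fixes y :: "'a::euclidean_space \<Rightarrow> 'b::euclidean_space"
    and \<Phi> :: "'a \<times> 'b \<Rightarrow> 'c::euclidean_space"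
  assumes S: "open S" and T: "open T" and cont: "continuous_on S y"
    and \<Phi>: "Ck_on (Suc k) T \<Phi>" and sub: "\<And>u. u \<in> S \<Longrightarrow> (u, y u) \<in> T"
    and zero: "\<And>u. u \<in> S \<Longrightarrow> \<Phi> (u, y u) = 0"
    and inj: "\<And>u z. u \<in> S \<Longrightarrow> fder \<Phi> (u, y u) (0, z) = 0 \<Longrightarrow> z = 0"
  shows "Ck_on (Suc k) S y"
proof -
  have \<Phi>': "(\<Phi> has_derivative fder \<Phi> (u, y u)) (at (u, y u))" if "u \<in> S" for u
    by (rule Ck_on_has_derivative[OF \<Phi> sub[OF that]])
  have lin: "linear (\<lambda>z. fder \<Phi> (u, y u) (0, z))" if "u \<in> S" for u
    using bounded_linear.linear[OF bounded_linear_compose[OF has_derivative_bounded_linear[OF \<Phi>'[OF that]]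
          bounded_linear_Pair[OF bounded_linear_zero bounded_linear_ident]]] .
  have inj': "inj (\<lambda>z. fder \<Phi> (u, y u) (0, z))" if "u \<in> S" for u
    using inj that lin linear_injective_0 by blast
  have diff: "y differentiable at u" if u: "u \<in> S" for u
  proof (rule implicit_has_derivative[where \<Phi>=\<Phi> and y=y, OF \<Phi>'[OF u] _ _ inj'[OF u]])
    show "isCont y u" using cont S u continuous_on_eq_continuous_at by blast
    show "\<forall>\<^sub>F w in nhds u. \<Phi> (w, y w) = 0"
      using eventually_nhds_in_open[OF S u] by eventually_elim (rule zero)
  qed
  have *: "fder \<Phi> (u, y u) (0, fder y u v) = - fder \<Phi> (u, y u) (v, 0)" if u: "u \<in> S" for u v
  proof -
    have y': "(y has_derivative fder y u) (at u)" using diff[OF u] frechet_derivative_works by blast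
    have "((\<lambda>w. \<Phi> (w, y w)) has_derivative (\<lambda>v. fder \<Phi> (u, y u) (v, fder y u v))) (at u)"
      using diff_chain_at[OF has_derivative_Pair[OF has_derivative_ident y'] \<Phi>'[OF u]] by (simp add: o_def)
    moreover have "((\<lambda>w. \<Phi> (w, y w)) has_derivative (\<lambda>v. 0)) (at u)"
      by (rule has_derivative_transform_within_open[OF has_derivative_const S u]) (simp add: zero)
    ultimately have "(\<lambda>v. fder \<Phi> (u, y u) (v, fder y u v)) = (\<lambda>v. 0)" by (rule has_derivative_unique)
    from fun_cong[OF this, of v] have "fder \<Phi> (u, y u) (v, fder y u v) = 0" .
    moreover have "fder \<Phi> (u, y u) (v, fder y u v)
        = fder \<Phi> (u, y u) (v, 0) + fder \<Phi> (u, y u) (0, fder y u v)"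
      using linear_add[OF has_derivative_linear[OF \<Phi>'[OF u]], of "(v, 0)" "(0, fder y u v)"] by simp
    ultimately show ?thesis by (simp add: eq_neg_iff_add_eq_0 add.commute)
  qed
  have step: "Ck_on (Suc j) S y" if j: "j \<le> k" and y: "Ck_on j S y" for j
  proof -
    have p: "Ck_on j S (\<lambda>u. (u, y u))" by (intro Ck_on_Pair S Ck_on_ident y)
    have c: "Ck_on j S (\<lambda>u. fder \<Phi> (u, y u) w)" for w
      by (rule Ck_on_compose[OF S p Ck_on_mono[OF j Ck_on_fder[OF \<Phi>]] sub])
    have "Ck_on j S (\<lambda>u. fder y u v)" for v
      by (rule linear_system_Ck[OF S lin c inj' Ck_on_minus[OF S c] *])
    then show ?thesis using diff by simp
  qed
  have "j \<le> Suc k \<Longrightarrow> Ck_on j S y" for j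
  proof (induction j)
    case 0
    then show ?case using cont by simp
  next
    case (Suc j)
    then show ?case using step[of j] by (simp del: Ck_on.simps)
  qed
  then show ?thesis by blast
qed

section \<open>Self-adjoint operators and traces\<close>

definition pos_metric :: "('e::euclidean_space \<Rightarrow> 'e \<Rightarrow> real) \<Rightarrow> bool" where
  "pos_metric g \<longleftrightarrow> bilinear g \<and> (\<forall>X Y. g X Y = g Y X) \<and> (\<forall>X. X \<noteq> 0 \<longrightarrow> 0 < g X X)"

definition orthonormal_basis :: "('e::euclidean_space \<Rightarrow> 'e \<Rightarrow> real) \<Rightarrow> 'e set \<Rightarrow> bool" where
  "orthonormal_basis g E \<longleftrightarrow> finite E \<and> span E = UNIV \<and>
     (\<forall>e\<in>E. \<forall>e'\<in>E. g e e' = (if e = e' then 1 else 0))"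

lemma linear_bilinear_left: "bilinear g \<Longrightarrow> linear (\<lambda>X. g X Y)"
  and linear_bilinear_right: "bilinear g \<Longrightarrow> linear (g X)"
  by (auto simp: bilinear_def)

lemma bilinear_continuous_on_diagonal:
  fixes g :: "'e::euclidean_space \<Rightarrow> 'e \<Rightarrow> real"
  assumes "bilinear g" "linear A"
  shows "continuous_on S (\<lambda>X. g (A X) X)"
proof -
  have "bounded_bilinear g" using assms bilinear_conv_bounded_bilinear by blast
  moreover have "continuous_on S A" using assms(2) linear_continuous_on linear_conv_bounded_linear by blast
  ultimately show ?thesis by (rule bounded_bilinear.continuous_on) (rule continuous_on_id)
qed

text \<open>A maximum point \<open>m\<close> of the Rayleigh quotient, with maximum \<open>l\<close>, is an eigenvector: the form
  \<open>q = l g - g (A _) _\<close> is positive semidefinite on \<open>S\<close> and vanishes at \<open>(m, m)\<close>, hence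
  \<open>q m Y = 0\<close> for all \<open>Y\<close> in \<open>S\<close>. The quotient is maximised over the Euclidean unit sphere of
  \<open>S\<close>, whose compactness is at hand.\<close>

lemma selfadjoint_eigenvector_in_subspace:
  fixes g :: "'e::euclidean_space \<Rightarrow> 'e \<Rightarrow> real"
  assumes g: "pos_metric g" and A: "linear A" and sa: "\<And>X Y. g (A X) Y = g X (A Y)"
    and S: "subspace S" and inv: "\<And>X. X \<in> S \<Longrightarrow> A X \<in> S" and ne: "X0 \<in> S" "X0 \<noteq> 0"
  obtains e l where "e \<in> S" "g e e = 1" "A e = l *\<^sub>R e"
proof -
  have b: "bilinear g" and sym: "g X Y = g Y X" and pos: "X \<noteq> 0 \<Longrightarrow> 0 < g X X" for X Y
    using g by (auto simp: pos_metric_def)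
  note bl = bilinear_ladd[OF b] bilinear_radd[OF b] bilinear_lmul[OF b] bilinear_rmul[OF b]
    bilinear_lsub[OF b] bilinear_rsub[OF b]
  have "compact (S \<inter> sphere 0 1)" using closed_subspace[OF S] by (simp add: closed_Int_compact)
  moreover have "(1 / norm X0) *\<^sub>R X0 \<in> S \<inter> sphere 0 1" using ne S by (simp add: subspace_scale)
  moreover have "continuous_on (S \<inter> sphere 0 1) (\<lambda>X. g (A X) X / g (id X) X)"
    by (intro continuous_on_divide bilinear_continuous_on_diagonal b A linear_id)
      (use pos in \<open>metis Int_iff id_apply less_irrefl mem_sphere_0 norm_zero zero_neq_one\<close>)
  ultimately have "\<exists>m\<in>S \<inter> sphere 0 1. \<forall>X\<in>S \<inter> sphere 0 1.
      g (A X) X / g (id X) X \<le> g (A m) m / g (id m) m"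
    by (intro continuous_attains_sup) blast+
  then obtain m where m: "m \<in> S" "norm m = 1"
    and max: "\<And>X. X \<in> S \<Longrightarrow> norm X = 1 \<Longrightarrow> g (A X) X / g X X \<le> g (A m) m / g m m"
    by auto
  define l where "l = g (A m) m / g m m"
  define q where "q X Y = l * g X Y - g (A X) Y" for X Y
  have m0: "m \<noteq> 0" using m(2) by auto
  have qm: "q m m = 0" using pos[OF m0] by (simp add: q_def l_def)
  have qpos: "q X X \<ge> 0" if "X \<in> S" for X
  proof (cases "X = 0")
    case True
    then show ?thesis by (simp add: q_def bilinear_lzero[OF b] bilinear_rzero[OF b])
  next
    case False
    let ?Y = "(1 / norm X) *\<^sub>R X"
    have "g (A ?Y) ?Y / g ?Y ?Y \<le> l" unfolding l_def using that S False by (intro max) (auto simp: subspace_scale)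
    moreover have "g (A ?Y) ?Y / g ?Y ?Y = g (A X) X / g X X"
      using False by (simp add: linear_scale[OF A] bl)
    ultimately show ?thesis using pos[OF False] by (simp add: q_def pos_divide_le_eq)
  qed
  have q0: "q m Y = 0" if Y: "Y \<in> S" for Y
  proof (rule ccontr)
    assume ne: "q m Y \<noteq> 0"
    have sq: "q (m + t *\<^sub>R Y) (m + t *\<^sub>R Y) = 2 * t * q m Y + t\<^sup>2 * q Y Y" for t
      using qm sym[of Y m] sym[of "A Y" m] sa[of m Y]
      by (simp add: q_def linear_add[OF A] linear_scale[OF A] bl power2_eq_square algebra_simps)
    have "2 * t * q m Y + t\<^sup>2 * q Y Y \<ge> 0" for t
      unfolding sq[symmetric] using qpos S m Y by (simp add: subspace_add subspace_scale)
    note nonneg = this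
    define r where "r = 1 / (q Y Y + 1)"
    have r: "r > 0" "r * q Y Y < 1" using qpos[OF Y] by (auto simp: r_def)
    have "2 * (- q m Y * r) * q m Y + (- q m Y * r)\<^sup>2 * q Y Y = (q m Y)\<^sup>2 * (r * (r * q Y Y - 2))"
      by (simp add: power2_eq_square algebra_simps)
    then have "(q m Y)\<^sup>2 * (r * (r * q Y Y - 2)) \<ge> 0" using nonneg by metis
    moreover have "(q m Y)\<^sup>2 * (r * (r * q Y Y - 2)) < 0"
      using ne r by (intro mult_pos_neg) (auto simp: zero_less_power2)
    ultimately show False by simp
  qed
  have "l *\<^sub>R m - A m \<in> S" using S m inv by (simp add: subspace_diff subspace_scale)
  then have "g (l *\<^sub>R m - A m) (l *\<^sub>R m - A m) = 0"
    using q0[of "l *\<^sub>R m - A m"] unfolding q_def by (simp only: bilinear_lsub[OF b] bilinear_lmul[OF b] real_scaleR_def)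
  then have eig: "A m = l *\<^sub>R m" using pos[of "l *\<^sub>R m - A m"] by force
  define e where "e = (1 / sqrt (g m m)) *\<^sub>R m"
  have "g e e = 1" using pos[OF m0] by (simp add: e_def bl)
  moreover have "A e = l *\<^sub>R e" "e \<in> S" using eig m S by (auto simp: e_def linear_scale[OF A] subspace_scale)
  ultimately show thesis by (rule that[rotated 1]) 
qed

lemma selfadjoint_eigenbasis_of_subspace:
  fixes g :: "'e::euclidean_space \<Rightarrow> 'e \<Rightarrow> real"
  assumes g: "pos_metric g" and A: "linear A" and sa: "\<And>X Y. g (A X) Y = g X (A Y)"
    and S: "subspace S" and inv: "\<And>X. X \<in> S \<Longrightarrow> A X \<in> S"
  shows "\<exists>E. finite E \<and> span E = S \<and> (\<forall>e\<in>E. \<forall>e'\<in>E. g e e' = (if e = e' then 1 else 0)) \<and>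
    (\<forall>e\<in>E. \<exists>l. A e = l *\<^sub>R e)"
  using S inv
proof (induction "dim S" arbitrary: S rule: less_induct)
  case less
  have b: "bilinear g" and sym: "g X Y = g Y X" for X Y
    using g by (auto simp: pos_metric_def)
  note bl = bilinear_ladd[OF b] bilinear_radd[OF b] bilinear_lmul[OF b] bilinear_rmul[OF b]
    bilinear_lsub[OF b] bilinear_rsub[OF b] bilinear_lzero[OF b] bilinear_rzero[OF b]
  show ?case
  proof (cases "S \<subseteq> {0}")
    case True
    then have "span {} = S" using less.prems(1) subspace_0 by auto
    then show ?thesis by (intro exI[of _ "{}"]) auto
  next
    case False
    then obtain X0 where "X0 \<in> S" "X0 \<noteq> 0" by blast
    then obtain e l where e: "e \<in> S" "g e e = 1" "A e = l *\<^sub>R e"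
      using selfadjoint_eigenvector_in_subspace[OF g A sa less.prems] by metis
    define S' where "S' = {X \<in> S. g X e = 0}"
    have S': "subspace S'" using less.prems(1) by (auto simp: S'_def subspace_def bl)
    have inv': "A X \<in> S'" if "X \<in> S'" for X
      using that less.prems(2) e(3) by (auto simp: S'_def sa bl)
    have "e \<notin> S'" using e by (simp add: S'_def)
    moreover have "S' \<subseteq> S" by (auto simp: S'_def)
    ultimately have "S' \<subset> S" using e(1) by blast
    then have "dim S' < dim S" using less.prems(1) S' by (metis dim_psubset span_eq_iff)
    from less.hyps[OF this S' inv'] obtain E where E: "finite E" "span E = S'"
      "\<forall>e\<in>E. \<forall>e'\<in>E. g e e' = (if e = e' then 1 else 0)" "\<forall>e\<in>E. \<exists>l. A e = l *\<^sub>R e" by blast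
    have ES: "E \<subseteq> S'" using E(2) span_superset by blast
    have "span (insert e E) = S"
    proof
      show "span (insert e E) \<subseteq> S"
        using ES e(1) less.prems(1) by (intro span_minimal) (auto simp: S'_def)
      show "S \<subseteq> span (insert e E)"
      proof
        fix X assume X: "X \<in> S"
        then have "X - g X e *\<^sub>R e \<in> S'" using e less.prems(1) by (simp add: S'_def subspace_diff subspace_scale bl)
        then have "X - g X e *\<^sub>R e \<in> span (insert e E)" using E(2) span_mono[of E "insert e E"] by blast
        then have "(X - g X e *\<^sub>R e) + g X e *\<^sub>R e \<in> span (insert e E)"
          by (rule span_add[OF _ span_scale[OF span_base]]) auto
        then show "X \<in> span (insert e E)" by simp
      qed
    qed
    moreover have "\<forall>x\<in>insert e E. \<forall>y\<in>insert e E. g x y = (if x = y then 1 else 0)"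
    proof -
      have "g x e = 0" "g e x = 0" "x \<noteq> e" if "x \<in> E" for x
        using that ES \<open>e \<notin> S'\<close> sym[of e x] by (auto simp: S'_def)
      then show ?thesis using E(3) e(2) by auto
    qed
    ultimately show ?thesis using E e(3) by (intro exI[of _ "insert e E"]) auto
  qed
qed

lemma selfadjoint_eigenbasis:
  fixes g :: "'e::euclidean_space \<Rightarrow> 'e \<Rightarrow> real"
  assumes "pos_metric g" and "linear A" and "\<And>X Y. g (A X) Y = g X (A Y)"
  obtains E l where "orthonormal_basis g E" "\<And>e. e \<in> E \<Longrightarrow> A e = l e *\<^sub>R e"
proof -
  obtain E where "orthonormal_basis g E" "\<forall>e\<in>E. \<exists>l. A e = l *\<^sub>R e"
    using selfadjoint_eigenbasis_of_subspace[OF assms subspace_UNIV] by (auto simp: orthonormal_basis_def)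
  then show thesis using that by metis
qed

lemma orthonormal_basis_exists:
  assumes "pos_metric g" obtains E where "orthonormal_basis g E"
  using selfadjoint_eigenbasis[OF assms linear_id] by auto

context
  fixes g :: "'e::euclidean_space \<Rightarrow> 'e \<Rightarrow> real" and E
  assumes g: "pos_metric g" and E: "orthonormal_basis g E"
begin

lemma pos_metric_bilinear: "bilinear g" and pos_metric_sym: "g X Y = g Y X" and pos_metric_pos: "X \<noteq> 0 \<Longrightarrow> 0 < g X X"
  using g by (auto simp: pos_metric_def)

lemma finite_orthonormal: "finite E" and span_orthonormal: "span E = UNIV"
  and orthonormal_pairing: "e \<in> E \<Longrightarrow> e' \<in> E \<Longrightarrow> g e e' = (if e = e' then 1 else 0)"
  using E by (auto simp: orthonormal_basis_def)

lemma orthonormal_coordinate: "e \<in> E \<Longrightarrow> g (\<Sum>a\<in>E. c a *\<^sub>R a) e = c e"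
proof -
  assume e: "e \<in> E"
  have "g (\<Sum>a\<in>E. c a *\<^sub>R a) e = (\<Sum>a\<in>E. c a * g a e)"
    by (simp add: linear_sum[OF linear_bilinear_left[OF pos_metric_bilinear]] bilinear_lmul[OF pos_metric_bilinear])
  also have "\<dots> = (\<Sum>a\<in>E. if a = e then c a else 0)" by (intro sum.cong) (auto simp: orthonormal_pairing e)
  also have "\<dots> = c e" using e finite_orthonormal by simp
  finally show ?thesis .
qed

lemma orthonormal_expansion: "(\<Sum>e\<in>E. g X e *\<^sub>R e) = X"
proof -
  have "X \<in> range (\<lambda>u. \<Sum>v\<in>E. u v *\<^sub>R v)" using span_orthonormal span_finite[OF finite_orthonormal] by auto
  then obtain c where c: "X = (\<Sum>e\<in>E. c e *\<^sub>R e)" by blast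
  then have "g X e = c e" if "e \<in> E" for e using orthonormal_coordinate[OF that, of c] by simp
  then show ?thesis using c by simp
qed

lemma independent_orthonormal: "independent E"
proof (rule independent_if_scalars_zero[OF finite_orthonormal])
  fix c x assume "(\<Sum>x\<in>E. c x *\<^sub>R x) = 0" "x \<in> E"
  then show "c x = 0" using orthonormal_coordinate[of x c] bilinear_lzero[OF pos_metric_bilinear] by simp
qed

lemma card_orthonormal: "card E = DIM('e)"
  using dim_span_eq_card_independent[OF independent_orthonormal] span_orthonormal by simp

lemma metric_sharp_eq: "metric_sharp g b = (\<Sum>e\<in>E. (b \<bullet> e) *\<^sub>R e)"
  unfolding metric_sharp_def
proof (rule the_equality)
  have "g (\<Sum>e\<in>E. (b \<bullet> e) *\<^sub>R e) w = b \<bullet> w" for w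
  proof -
    have "g (\<Sum>e\<in>E. (b \<bullet> e) *\<^sub>R e) w = (\<Sum>e\<in>E. (b \<bullet> e) * g w e)"
      by (simp add: linear_sum[OF linear_bilinear_left[OF pos_metric_bilinear]] bilinear_lmul[OF pos_metric_bilinear] pos_metric_sym[of w])
    also have "\<dots> = b \<bullet> (\<Sum>e\<in>E. g w e *\<^sub>R e)" by (simp add: inner_sum_right mult.commute)
    finally show ?thesis by (simp add: orthonormal_expansion)
  qed
  then show *: "\<forall>w. g (\<Sum>e\<in>E. (b \<bullet> e) *\<^sub>R e) w = b \<bullet> w" by blast
  fix v assume "\<forall>w. g v w = b \<bullet> w"
  then have "g (v - (\<Sum>e\<in>E. (b \<bullet> e) *\<^sub>R e)) w = 0" for w using * by (simp add: bilinear_lsub[OF pos_metric_bilinear])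
  then show "v = (\<Sum>e\<in>E. (b \<bullet> e) *\<^sub>R e)" using pos_metric_pos by (metis less_irrefl right_minus_eq)
qed

lemma metric_sharp_works: "g (metric_sharp g b) w = b \<bullet> w"
proof -
  have "g (\<Sum>e\<in>E. (b \<bullet> e) *\<^sub>R e) w = (\<Sum>e\<in>E. (b \<bullet> e) * g w e)"
    by (simp add: linear_sum[OF linear_bilinear_left[OF pos_metric_bilinear]] bilinear_lmul[OF pos_metric_bilinear] pos_metric_sym[of w])
  also have "\<dots> = b \<bullet> (\<Sum>e\<in>E. g w e *\<^sub>R e)" by (simp add: inner_sum_right mult.commute)
  finally show ?thesis by (simp add: orthonormal_expansion metric_sharp_eq)
qed

text \<open>The trace of the standard basis against its metric dual, computed in any orthonormal basis of the
  metric.\<close>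

lemma metric_trace_eq:
  fixes q :: "'e \<Rightarrow> 'e \<Rightarrow> real"
  assumes q: "bilinear q"
  shows "metric_trace g q = (\<Sum>e\<in>E. q e e)"
proof -
  have "metric_trace g q = (\<Sum>b\<in>Basis. \<Sum>e\<in>E. (b \<bullet> e) * q b e)"
    by (simp add: metric_trace_def metric_sharp_eq linear_sum[OF linear_bilinear_right[OF q]] bilinear_rmul[OF q])
  also have "\<dots> = (\<Sum>e\<in>E. \<Sum>b\<in>Basis. (e \<bullet> b) * q b e)"
    by (subst sum.swap) (simp add: inner_commute)
  also have "\<dots> = (\<Sum>e\<in>E. q (\<Sum>b\<in>Basis. (e \<bullet> b) *\<^sub>R b) e)"
    by (simp add: linear_sum[OF linear_bilinear_left[OF q]] bilinear_lmul[OF q])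
  finally show ?thesis by (simp add: euclidean_representation)
qed

text \<open>The trace of an endomorphism is the same in the Euclidean metric and in \<open>g\<close>. It is taken later of
  operators that are diagonal in a \<open>g\<close>-orthonormal basis.\<close>

lemma trace_endomorphism:
  assumes T: "linear T"
  shows "(\<Sum>b\<in>Basis. b \<bullet> T b) = (\<Sum>e\<in>E. g (T e) e)"
proof -
  have "bilinear (\<lambda>X Y. g (T X) Y)"
    unfolding bilinear_def using linear_bilinear_right[OF pos_metric_bilinear]
      linear_compose[OF T linear_bilinear_left[OF pos_metric_bilinear]] by (auto simp: o_def)
  from metric_trace_eq[OF this] show ?thesis
    by (simp add: metric_trace_def pos_metric_sym[of "T _" "metric_sharp g _"] metric_sharp_works)
qed

context
  fixes A :: "'e \<Rightarrow> 'e" and l :: "'e \<Rightarrow> real"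
  assumes A: "linear A" and eig: "\<And>e. e \<in> E \<Longrightarrow> A e = l e *\<^sub>R e"
begin

lemma eigen_expansion: "A X = (\<Sum>e\<in>E. (l e * g X e) *\<^sub>R e)"
proof -
  have "A (\<Sum>e\<in>E. g X e *\<^sub>R e) = (\<Sum>e\<in>E. (l e * g X e) *\<^sub>R e)"
    by (simp add: linear_sum[OF A] linear_scale[OF A] eig mult.commute)
  then show ?thesis by (simp add: orthonormal_expansion)
qed

lemma eigen_coordinate: "e \<in> E \<Longrightarrow> g (A X) e = l e * g X e"
  unfolding eigen_expansion[of X] by (rule orthonormal_coordinate)

lemma eigenspace_eq_span: "{X. A X = k *\<^sub>R X} = span {e \<in> E. l e = k}"
proof
  have "subspace {X. A X = k *\<^sub>R X}"
    by (auto simp: subspace_def linear_0[OF A] linear_add[OF A] linear_scale[OF A] scaleR_add_right)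
  then show "span {e \<in> E. l e = k} \<subseteq> {X. A X = k *\<^sub>R X}"
    by (intro span_minimal) (auto simp: eig)
  show "{X. A X = k *\<^sub>R X} \<subseteq> span {e \<in> E. l e = k}"
  proof safe
    fix X assume X: "A X = k *\<^sub>R X"
    have "g X e = 0" if "e \<in> E" "l e \<noteq> k" for e
      using eigen_coordinate[OF that(1), of X] X that(2) by (simp add: bilinear_lmul[OF pos_metric_bilinear])
    then have "(\<Sum>e\<in>E. g X e *\<^sub>R e) = (\<Sum>e\<in>{e \<in> E. l e = k}. g X e *\<^sub>R e)"
      using finite_orthonormal by (intro sum.mono_neutral_right) auto
    also have "\<dots> \<in> span {e \<in> E. l e = k}" by (intro span_sum span_scale span_base)
    finally show "X \<in> span {e \<in> E. l e = k}" by (simp add: orthonormal_expansion)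
  qed
qed

lemma dim_eigenspace: "dim {X. A X = k *\<^sub>R X} = card {e \<in> E. l e = k}"
  unfolding eigenspace_eq_span
  by (rule dim_span_eq_card_independent[OF independent_mono[OF independent_orthonormal]]) auto

lemma eigenvalues_eq: "{k. \<exists>X. X \<noteq> 0 \<and> A X = k *\<^sub>R X} = l ` E"
proof safe
  fix k X assume X: "X \<noteq> 0" "A X = k *\<^sub>R X"
  have "{e \<in> E. l e = k} \<noteq> {}"
  proof
    assume "{e \<in> E. l e = k} = {}"
    then have "{X. A X = k *\<^sub>R X} = {0}" using eigenspace_eq_span[of k] by (simp only: span_empty)
    then show False using X by blast
  qed
  then show "k \<in> l ` E" by auto
next
  fix e assume e: "e \<in> E"
  then have "e \<noteq> 0" using orthonormal_pairing[OF e e] bilinear_lzero[OF pos_metric_bilinear] by fastforce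
  then show "\<exists>X. X \<noteq> 0 \<and> A X = l e *\<^sub>R X" using eig[OF e] by blast
qed

lemma sum_over_eigenvalues:
  "(\<Sum>k\<in>l ` E. real (dim {X. A X = k *\<^sub>R X}) * F k) = (\<Sum>e\<in>E. F (l e))"
proof -
  have "(\<Sum>e\<in>E. F (l e)) = (\<Sum>k\<in>l ` E. \<Sum>e\<in>{e \<in> E. l e = k}. F (l e))"
    by (rule sum.image_gen[OF finite_orthonormal])
  also have "\<dots> = (\<Sum>k\<in>l ` E. real (dim {X. A X = k *\<^sub>R X}) * F k)"
    by (intro sum.cong refl) (simp add: dim_eigenspace)
  finally show ?thesis by simp
qed

lemma inj_scale_minus: "inj (\<lambda>X. s *\<^sub>R X - A X) \<longleftrightarrow> s \<notin> l ` E"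
proof -
  have "linear (\<lambda>X. s *\<^sub>R X - A X)" by (intro linear_compose_sub linear_scale_self A)
  then have "inj (\<lambda>X. s *\<^sub>R X - A X) \<longleftrightarrow> (\<forall>X. s *\<^sub>R X - A X = 0 \<longrightarrow> X = 0)"
    by (rule linear_injective_0)
  also have "\<dots> \<longleftrightarrow> s \<notin> {k. \<exists>X. X \<noteq> 0 \<and> A X = k *\<^sub>R X}" by auto
  finally show ?thesis by (simp only: eigenvalues_eq)
qed

end

end

text \<open>An isomorphism carries orthonormal bases to orthonormal bases. This serves both for changes of
  charts and for the metric \<open>g(B X, B Y)\<close> induced on the immersions into the cylinder.\<close>

lemma metric_trace_pullback:
  assumes g: "pos_metric g" and q: "bilinear q" and L: "linear L" "bij L"
  shows "pos_metric (\<lambda>X Y. g (L X) (L Y))"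
    and "metric_trace (\<lambda>X Y. g (L X) (L Y)) (\<lambda>X Y. q (L X) (L Y)) = (metric_trace g q :: real)"
proof -
  have b: "bilinear (\<lambda>X Y. h (L X) (L Y))" if "bilinear h" for h :: "'a \<Rightarrow> 'a \<Rightarrow> real"
    using linear_compose[OF L(1) linear_bilinear_left[OF that]] linear_compose[OF L(1) linear_bilinear_right[OF that]]
    by (simp add: bilinear_def o_def)
  have L0: "L X = 0 \<longleftrightarrow> X = 0" for X
    using L bij_is_inj linear_injective_0 linear_0 by metis
  show p: "pos_metric (\<lambda>X Y. g (L X) (L Y))"
    using g b L0 by (auto simp: pos_metric_def)
  obtain E where E: "orthonormal_basis (\<lambda>X Y. g (L X) (L Y)) E" by (rule orthonormal_basis_exists[OF p])
  have "orthonormal_basis g (L ` E)"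
    using E L by (auto simp: orthonormal_basis_def linear_span_image bij_is_surj inj_eq[OF bij_is_inj])
  from metric_trace_eq[OF g this q] metric_trace_eq[OF p E b[OF q]]
  show "metric_trace (\<lambda>X Y. g (L X) (L Y)) (\<lambda>X Y. q (L X) (L Y)) = metric_trace g q"
    by (simp add: sum.reindex[OF inj_on_subset[OF bij_is_inj[OF L(2)]]])
qed

text \<open>By the dimension count, an injective image of the model space and two further independent directions span
  the ambient space.\<close>

lemma frame_orthogonal_zero:
  fixes L :: "'e::euclidean_space \<Rightarrow> 'v::euclidean_space"
  assumes L: "linear L" and dim: "DIM('v) = DIM('e) + 2"
    and indep: "\<And>X \<alpha> \<beta>. L X + \<alpha> *\<^sub>R a + \<beta> *\<^sub>R b = 0 \<Longrightarrow> X = 0 \<and> \<alpha> = 0 \<and> \<beta> = 0"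
    and v: "\<And>X. v \<bullet> L X = 0" "v \<bullet> a = 0" "v \<bullet> b = 0"
  shows "v = 0"
proof -
  define K where "K p = L (fst p) + fst (snd p) *\<^sub>R a + snd (snd p) *\<^sub>R b" for p :: "'e \<times> real \<times> real"
  have K: "linear K" unfolding K_def
    by (rule linearI) (auto simp: linear_add[OF L] linear_scale[OF L] algebra_simps)
  have "p = 0" if "K p = 0" for p
    using indep[of "fst p" "fst (snd p)" "snd (snd p)"] that by (auto simp: K_def prod_eq_iff add.assoc)
  then have "inj K" using linear_injective_0[OF K] by blast
  then have "dim (K ` UNIV) = dim (UNIV :: ('e \<times> real \<times> real) set)"
    by (intro dim_image_eq K) auto
  then have "span (range K) = UNIV" using dim by (subst dim_eq_full[symmetric]) simp
  moreover have "span (range K) = range K" using K by (simp add: linear_span_image)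
  ultimately obtain p where "v = K p" by (metis UNIV_I image_iff)
  then have "v \<bullet> v = v \<bullet> K p" by simp
  also have "\<dots> = 0" using v by (simp add: K_def inner_add_right)
  finally show ?thesis by simp
qed

section \<open>The polynomial of the principal curvatures\<close>

definition weighted_poly :: "real set \<Rightarrow> (real \<Rightarrow> real) \<Rightarrow> real poly" where
  "weighted_poly K m = (\<Sum>k\<in>K. smult (m k) ([:1, k:] * (\<Prod>k'\<in>K - {k}. [:- k', 1:])))"

text \<open>For \<open>k = cot \<alpha>\<close> and \<open>s = cot t\<close> the summand of \<open>k\<close> is
  \<open>m k * cot (\<alpha> - t)\<close>.\<close>

definition cot_sum :: "real set \<Rightarrow> (real \<Rightarrow> real) \<Rightarrow> real \<Rightarrow> real" where
  "cot_sum K m s = (\<Sum>k\<in>K. m k * ((k * s + 1) / (s - k)))"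

context
  fixes K :: "real set" and m :: "real \<Rightarrow> real"
  assumes K: "finite K" and m: "\<And>k. k \<in> K \<Longrightarrow> m k > 0"
begin

lemma poly_weighted_poly:
  "poly (weighted_poly K m) s = (\<Sum>k\<in>K. m k * ((k * s + 1) * (\<Prod>k'\<in>K - {k}. s - k')))"
  by (simp add: weighted_poly_def poly_sum poly_prod algebra_simps)

lemma poly_weighted_poly_off:
  assumes "s \<notin> K"
  shows "poly (weighted_poly K m) s = cot_sum K m s * (\<Prod>k\<in>K. s - k)"
proof -
  have "m k * ((k * s + 1) * (\<Prod>k'\<in>K - {k}. s - k')) = m k * ((k * s + 1) / (s - k)) * (\<Prod>k\<in>K. s - k)"
    if k: "k \<in> K" for k
    using assms k by (subst prod.remove[OF K k]) auto
  then show ?thesis by (simp add: poly_weighted_poly cot_sum_def sum_distrib_right cong: sum.cong)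
qed

lemma poly_weighted_poly_at:
  assumes k: "k \<in> K"
  shows "poly (weighted_poly K m) k = m k * ((k\<^sup>2 + 1) * (\<Prod>k'\<in>K - {k}. k - k'))"
proof -
  have "(\<Sum>j\<in>K - {k}. m j * ((j * k + 1) * (\<Prod>k'\<in>K - {j}. k - k'))) = 0"
  proof (intro sum.neutral ballI)
    fix j assume "j \<in> K - {k}"
    then have "(\<Prod>k'\<in>K - {j}. k - k') = 0" using K k by (intro prod_zero) auto
    then show "m j * ((j * k + 1) * (\<Prod>k'\<in>K - {j}. k - k')) = 0" by simp
  qed
  then show ?thesis by (simp add: poly_weighted_poly sum.remove[OF K k] power2_eq_square)
qed

text \<open>No point of \<open>K\<close> is a root, since only one summand is left there and \<open>k\<^sup>2 + 1\<close> has no real zero.\<close>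

lemma weighted_poly_root_iff:
  "poly (weighted_poly K m) s = 0 \<longleftrightarrow> s \<notin> K \<and> cot_sum K m s = 0"
proof (cases "s \<in> K")
  case True
  have "s\<^sup>2 + 1 \<noteq> 0" by (smt (verit) zero_le_power2)
  then show ?thesis using True K m[OF True] by (simp add: poly_weighted_poly_at)
next
  case False
  then show ?thesis using K by (auto simp: poly_weighted_poly_off)
qed

lemma cot_sum_alt:
  assumes "s \<notin> K"
  shows "cot_sum K m s = (\<Sum>k\<in>K. m k * k) + (\<Sum>k\<in>K. m k * (k\<^sup>2 + 1) / (s - k))"
proof -
  have "m k * ((k * s + 1) / (s - k)) = m k * k + m k * (k\<^sup>2 + 1) / (s - k)" if "k \<in> K" for k
  proof -
    have "s - k \<noteq> 0" using assms that by auto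
    then show ?thesis by (simp add: field_simps power2_eq_square)
  qed
  then show ?thesis by (simp add: cot_sum_def sum.distrib cong: sum.cong)
qed

text \<open>Obtained from \<open>k s + 1 = k (s - k) + (k\<^sup>2 + 1)\<close>. It shows at once the coefficient of
  \<open>s ^ card K\<close>, which is the mean curvature in the application.\<close>

lemma weighted_poly_alt:
  "weighted_poly K m = smult (\<Sum>k\<in>K. m k * k) (\<Prod>k\<in>K. [:- k, 1:]) +
     (\<Sum>k\<in>K. smult (m k * (k\<^sup>2 + 1)) (\<Prod>k'\<in>K - {k}. [:- k', 1:]))"
proof -
  have "smult (m k) ([:1, k:] * (\<Prod>k'\<in>K - {k}. [:- k', 1:])) =
     smult (m k * k) (\<Prod>k\<in>K. [:- k, 1:]) + smult (m k * (k\<^sup>2 + 1)) (\<Prod>k'\<in>K - {k}. [:- k', 1:])"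
    if k: "k \<in> K" for k
  proof -
    have "[:1, k:] = smult k [:- k, 1:] + [:k\<^sup>2 + 1:]" by (simp add: power2_eq_square)
    then have "smult (m k) ([:1, k:] * (\<Prod>k'\<in>K - {k}. [:- k', 1:])) =
      smult (m k) ((smult k [:- k, 1:] + [:k\<^sup>2 + 1:]) * (\<Prod>k'\<in>K - {k}. [:- k', 1:]))" by simp
    also have "\<dots> = smult (m k * k) ([:- k, 1:] * (\<Prod>k'\<in>K - {k}. [:- k', 1:]))
        + smult (m k * (k\<^sup>2 + 1)) (\<Prod>k'\<in>K - {k}. [:- k', 1:])"
      by (simp only: distrib_right smult_add_right mult_smult_left smult_smult) simp
    also have "[:- k, 1:] * (\<Prod>k'\<in>K - {k}. [:- k', 1:]) = (\<Prod>k\<in>K. [:- k, 1:])"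
      by (simp add: prod.remove[OF K k])
    finally show ?thesis .
  qed
  then show ?thesis
    by (simp add: weighted_poly_def sum.distrib smult_sum cong: sum.cong)
qed

lemma degree_weighted_poly:
  shows "degree (weighted_poly K m) \<le> card K"
    and "(\<Sum>k\<in>K. m k * k) = 0 \<Longrightarrow> degree (weighted_poly K m) \<le> card K - 1"
proof -
  have p: "degree (\<Prod>k\<in>A. [:- k, 1::real:]) \<le> card A" if "finite A" for A
    using degree_prod_sum_le[OF that, of "\<lambda>k. [:- k, 1:]"] by (simp add: o_def)
  have "degree (\<Sum>k\<in>K. smult (m k * (k\<^sup>2 + 1)) (\<Prod>k'\<in>K - {k}. [:- k', 1:])) \<le> card K - 1"
  proof (intro degree_sum_le K)
    fix k assume "k \<in> K"
    then show "degree (smult (m k * (k\<^sup>2 + 1)) (\<Prod>k'\<in>K - {k}. [:- k', 1:])) \<le> card K - 1"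
      using p[of "K - {k}"] K by (intro order_trans[OF degree_smult_le]) simp
  qed
  moreover have "degree (smult (\<Sum>k\<in>K. m k * k) (\<Prod>k\<in>K. [:- k, 1:])) \<le> card K"
    using order_trans[OF degree_smult_le p[OF K]] .
  ultimately show "degree (weighted_poly K m) \<le> card K"
    and "(\<Sum>k\<in>K. m k * k) = 0 \<Longrightarrow> degree (weighted_poly K m) \<le> card K - 1"
    unfolding weighted_poly_alt by (auto intro: degree_add_le)
qed

text \<open>The values at two consecutive points of \<open>K\<close> have opposite signs: their products over \<open>K\<close> differ by the
  factor \<open>k - k'\<close> against \<open>k' - k\<close> and by factors that have the same sign at both points.\<close>

lemma weighted_poly_gap:
  assumes k: "k \<in> K" "k' \<in> K" "k < k'" and gap: "\<And>j. j \<in> K \<Longrightarrow> j \<le> k \<or> k' \<le> j"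
  shows "\<exists>s>k. s < k' \<and> poly (weighted_poly K m) s = 0"
proof (rule poly_IVT[OF k(3)])
  let ?p = "poly (weighted_poly K m)"
  have 1: "(\<Prod>j\<in>K - {k}. k - j) = (k - k') * (\<Prod>j\<in>K - {k} - {k'}. k - j)"
    and 2: "(\<Prod>j\<in>K - {k'}. k' - j) = (k' - k) * (\<Prod>j\<in>K - {k} - {k'}. k' - j)"
    using k K by (subst prod.remove[of _ k'] prod.remove[of _ k]; auto simp: Diff_insert2[symmetric] insert_commute)+
  have "(\<Prod>j\<in>K - {k} - {k'}. (k - j) * (k' - j)) > 0"
  proof (rule prod_pos)
    fix j assume "j \<in> K - {k} - {k'}"
    then show "(k - j) * (k' - j) > 0"
      using gap[of j] k(3) by (auto simp: zero_less_mult_iff)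
  qed
  then have 3: "(\<Prod>j\<in>K - {k} - {k'}. k - j) * (\<Prod>j\<in>K - {k} - {k'}. k' - j) > 0"
    by (simp add: prod.distrib)
  have c: "c\<^sup>2 + 1 > 0" for c :: real by (smt (verit) zero_le_power2)
  have "?p k * ?p k' = - (m k * (k\<^sup>2 + 1) * (m k' * (k'\<^sup>2 + 1)) * ((k' - k) * (k' - k)) *
     ((\<Prod>j\<in>K - {k} - {k'}. k - j) * (\<Prod>j\<in>K - {k} - {k'}. k' - j)))"
    unfolding poly_weighted_poly_at[OF k(1)] poly_weighted_poly_at[OF k(2)] 1 2 by (simp add: algebra_simps)
  moreover have "m k * (k\<^sup>2 + 1) * (m k' * (k'\<^sup>2 + 1)) * ((k' - k) * (k' - k)) *
     ((\<Prod>j\<in>K - {k} - {k'}. k - j) * (\<Prod>j\<in>K - {k} - {k'}. k' - j)) > 0"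
    using m k c by (intro mult_pos_pos[OF _ 3] mult_pos_pos) auto
  ultimately show "?p k * ?p k' < 0" by linarith
qed

lemma cot_sum_continuous: "S \<inter> K = {} \<Longrightarrow> continuous_on S (cot_sum K m)"
  unfolding cot_sum_def by (intro continuous_intros) auto

text \<open>Left of \<open>K\<close> the rational function tends to the positive number \<open>H = (\<Sum>k\<in>K. m k * k)\<close> at minus
  infinity and is at most \<open>0\<close> close to \<open>Min K\<close>.\<close>

lemma weighted_poly_outer_root_below:
  assumes ne: "K \<noteq> {}" and H: "(\<Sum>k\<in>K. m k * k) > 0"
  shows "\<exists>s<Min K. poly (weighted_poly K m) s = 0"
proof -
  define H where "H = (\<Sum>k\<in>K. m k * k)"
  define a where "a = Min K"
  have aK: "a \<in> K" "\<And>k. k \<in> K \<Longrightarrow> a \<le> k" using K ne by (auto simp: a_def)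
  have off: "s \<notin> K" if "s < a" for s using aK(2) that by force
  have c: "m k * (k\<^sup>2 + 1) > 0" if "k \<in> K" for k
    using m[OF that] by (intro mult_pos_pos) (auto intro: add_nonneg_pos)
  \<comment> \<open>at \<open>a - d\<close> the summand of the pole \<open>a\<close> alone equals \<open>- H\<close>, and the others are negative\<close>
  define d where "d = m a * (a\<^sup>2 + 1) / H"
  have d: "d > 0" using c[OF aK(1)] H by (simp add: d_def H_def)
  define t where "t = a - d"
  have "t < a" using d by (simp add: t_def)
  have neg: "cot_sum K m t \<le> 0"
  proof -
    have "m k * (k\<^sup>2 + 1) / (t - k) \<le> 0" if "k \<in> K" for k
      using c[OF that] aK(2)[OF that] \<open>t < a\<close> by (simp add: divide_nonneg_neg)
    then have "(\<Sum>k\<in>K - {a}. m k * (k\<^sup>2 + 1) / (t - k)) \<le> 0" by (intro sum_nonpos) auto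
    moreover have "m a * (a\<^sup>2 + 1) / (t - a) = - H"
    proof -
      define w where "w = m a * (a\<^sup>2 + 1)"
      have "w > 0" "H > 0" using c[OF aK(1)] H by (simp_all add: w_def H_def)
      then show ?thesis by (simp add: t_def d_def w_def[symmetric])
    qed
    ultimately show ?thesis
      unfolding cot_sum_alt[OF off[OF \<open>t < a\<close>]] sum.remove[OF K aK(1), of "\<lambda>k. _ k / _ k"] H_def[symmetric]
      by simp
  qed
  have "((\<lambda>s. H + (\<Sum>k\<in>K. m k * (k\<^sup>2 + 1) / (s - k))) \<longlongrightarrow> H + (\<Sum>k\<in>K. 0)) at_bot"
  proof (intro tendsto_intros)
    fix k
    have "filterlim (\<lambda>s. s - k :: real) at_infinity at_bot"
      using filterlim_tendsto_add_at_bot_iff[OF tendsto_const[of "- k"], of "\<lambda>s. s" at_bot] filterlim_ident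
      by (intro filterlim_at_bot_imp_at_infinity) simp
    then show "((\<lambda>s. m k * (k\<^sup>2 + 1) / (s - k)) \<longlongrightarrow> 0) at_bot"
      by (intro tendsto_divide_0[OF tendsto_const])
  qed
  then have "\<forall>\<^sub>F s in at_bot. H + (\<Sum>k\<in>K. m k * (k\<^sup>2 + 1) / (s - k)) > 0"
    using H by (intro order_tendstoD(1)) (auto simp: H_def)
  moreover have "\<forall>\<^sub>F s in at_bot. s < t" by (rule eventually_gt_at_bot)
  ultimately have "\<forall>\<^sub>F s in at_bot. H + (\<Sum>k\<in>K. m k * (k\<^sup>2 + 1) / (s - k)) > 0 \<and> s < t"
    by (rule eventually_conj)
  from eventually_happens[OF this]
  obtain s where s: "H + (\<Sum>k\<in>K. m k * (k\<^sup>2 + 1) / (s - k)) > 0" "s < t" by auto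
  then have "s < a" using \<open>t < a\<close> by simp
  then have "cot_sum K m s \<ge> 0" using s unfolding cot_sum_alt[OF off[OF \<open>s < a\<close>]] H_def by simp
  moreover have "continuous_on {s..t} (cot_sum K m)"
    by (rule cot_sum_continuous) (use off \<open>t < a\<close> in fastforce)
  ultimately obtain r where r: "s \<le> r" "r \<le> t" "cot_sum K m r = 0"
    using IVT2'[of "cot_sum K m" t 0 s] neg s(2) by auto
  then show ?thesis using \<open>t < a\<close> off[of r] by (intro exI[of _ r]) (auto simp: weighted_poly_root_iff a_def)
qed

end

text \<open>The reflection \<open>k \<mapsto> - k\<close>, \<open>s \<mapsto> - s\<close> changes the sign of the rational function. It reduces
  a root above \<open>K\<close> to a root below \<open>K\<close>.\<close>

lemma weighted_poly_reflect:
  assumes "finite K" "\<And>k. k \<in> K \<Longrightarrow> m k > 0"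
  shows "poly (weighted_poly (uminus ` K) (\<lambda>k. m (- k))) (- s) = 0 \<longleftrightarrow> poly (weighted_poly K m) s = 0"
proof -
  have "cot_sum (uminus ` K) (\<lambda>k. m (- k)) (- s) = (\<Sum>k\<in>K. m k * ((k * s + 1) / (k - s)))"
    by (simp add: cot_sum_def sum.reindex mult.commute add.commute)
  also have "\<dots> = - cot_sum K m s"
    unfolding cot_sum_def sum_negf[symmetric] by (intro sum.cong refl) (metis minus_diff_eq minus_divide_right mult_minus_right)
  finally have c: "cot_sum (uminus ` K) (\<lambda>k. m (- k)) (- s) = - cot_sum K m s" .
  have "poly (weighted_poly (uminus ` K) (\<lambda>k. m (- k))) (- s) = 0 \<longleftrightarrow>
      - s \<notin> uminus ` K \<and> cot_sum (uminus ` K) (\<lambda>k. m (- k)) (- s) = 0"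
    by (rule weighted_poly_root_iff) (use assms in auto)
  also have "\<dots> \<longleftrightarrow> s \<notin> K \<and> cot_sum K m s = 0" by (simp add: c inj_image_mem_iff)
  also have "\<dots> \<longleftrightarrow> poly (weighted_poly K m) s = 0" by (rule weighted_poly_root_iff[symmetric, OF assms])
  finally show ?thesis .
qed

text \<open>The degree bounds the number of roots from above; the gaps, and for nonzero leading coefficient the
  outer root, give as many roots from below.\<close>

lemma card_weighted_poly_roots:
  assumes K: "finite K" "K \<noteq> {}" and m: "\<And>k. k \<in> K \<Longrightarrow> m k > 0"
  shows "finite {s. poly (weighted_poly K m) s = 0}"
    and "card {s. poly (weighted_poly K m) s = 0} = (if (\<Sum>k\<in>K. m k * k) = 0 then card K - 1 else card K)"
proof -
  note km = K(1) m
  let ?p = "weighted_poly K m" and ?R = "{s. poly (weighted_poly K m) s = 0}"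
  have "poly ?p (Max K) \<noteq> 0" using weighted_poly_root_iff[of K m "Max K"] km K by simp
  then have p0: "?p \<noteq> 0" by auto
  show fin: "finite ?R" by (rule poly_roots_finite[OF p0])
  have ub: "card ?R \<le> degree ?p" by (rule card_poly_roots_bound[OF p0])
  \<comment> \<open>\<open>nxt k\<close> is the successor of \<open>k\<close> in \<open>K\<close>, and \<open>r k\<close> below is a root between \<open>k\<close> and its successor\<close>
  define nxt where "nxt k = Min {j \<in> K. k < j}" for k
  define a where "a = Max K"
  have aK: "a \<in> K" and amax: "\<And>k. k \<in> K \<Longrightarrow> k \<le> a" using K by (auto simp: a_def)
  have nxt: "nxt k \<in> K" "k < nxt k" "\<And>j. j \<in> K \<Longrightarrow> j \<le> k \<or> nxt k \<le> j" if "k \<in> K - {a}" for k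
  proof -
    have f: "finite {j \<in> K. k < j}" using K by simp
    moreover have ne: "{j \<in> K. k < j} \<noteq> {}" using that aK amax[of k] by force
    ultimately have "nxt k \<in> {j \<in> K. k < j}" unfolding nxt_def by (rule Min_in)
    then show "nxt k \<in> K" "k < nxt k" by auto
    show "j \<le> k \<or> nxt k \<le> j" if "j \<in> K" for j
    proof (cases "j \<le> k")
      case False
      then have "Min {j \<in> K. k < j} \<le> j" using that f by (intro Min_le) auto
      then show ?thesis by (simp add: nxt_def)
    qed simp
  qed
  have "\<exists>s>k. s < nxt k \<and> poly ?p s = 0" if k: "k \<in> K - {a}" for k
    by (rule weighted_poly_gap[OF km _ nxt(1,2)[OF k] nxt(3)[OF k]]) (use k in auto)
  then have "\<forall>k\<in>K - {a}. \<exists>s. k < s \<and> s < nxt k \<and> poly ?p s = 0" by blast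
  then obtain r where r: "\<And>k. k \<in> K - {a} \<Longrightarrow> k < r k \<and> r k < nxt k \<and> poly ?p (r k) = 0" by metis
  have less: "r k < r j" if "k \<in> K - {a}" "j \<in> K - {a}" "k < j" for k j
    using r[OF that(1)] r[OF that(2)] nxt(3)[OF that(1), of j] that by force
  have inj: "inj_on r (K - {a})" by (rule inj_onI) (metis less less_irrefl neq_iff)
  have sub: "r ` (K - {a}) \<subseteq> ?R" using r by auto
  have cr: "card (r ` (K - {a})) = card K - 1" using card_image[OF inj] aK K by simp
  have lb: "card K - 1 \<le> card ?R" using card_mono[OF fin sub] cr by simp
  show "card ?R = (if (\<Sum>k\<in>K. m k * k) = 0 then card K - 1 else card K)"
  proof (cases "(\<Sum>k\<in>K. m k * k) = 0")
    case True
    then show ?thesis using lb ub degree_weighted_poly(2)[of K m, OF km True] by simp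
  next
    case False
    have "\<exists>s. poly ?p s = 0 \<and> (s < Min K \<or> a < s)"
    proof (cases "(\<Sum>k\<in>K. m k * k) > 0")
      case True
      then show ?thesis using weighted_poly_outer_root_below[of K m, OF km K(2)] by blast
    next
      case f: False
      let ?K = "uminus ` K" and ?m = "\<lambda>k. m (- k)"
      have "(\<Sum>k\<in>?K. ?m k * k) > 0" using f False by (simp add: sum.reindex sum_negf)
      then have "\<exists>s<Min ?K. poly (weighted_poly ?K ?m) s = 0"
        by (intro weighted_poly_outer_root_below) (use km K(2) in auto)
      then obtain s where s: "s < Min ?K" "poly (weighted_poly ?K ?m) s = 0" by blast
      then have "poly ?p (- s) = 0" using weighted_poly_reflect[of K m "- s", OF km] by simp
      moreover have "Min ?K \<le> - a" using aK K by (intro Min_le) auto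
      ultimately show ?thesis using s by (intro exI[of _ "- s"]) auto
    qed
    then obtain s where s: "poly ?p s = 0" "s < Min K \<or> a < s" by blast
    have "s \<notin> r ` (K - {a})"
    proof
      assume "s \<in> r ` (K - {a})"
      then obtain k where k: "k \<in> K - {a}" "s = r k" by blast
      then have "Min K \<le> k" "k < s" "s < nxt k" "nxt k \<le> a" using K r nxt(1) amax by auto
      then show False using s(2) by linarith
    qed
    then have "card (insert s (r ` (K - {a}))) = Suc (card K - 1)" using K cr by simp
    moreover have "insert s (r ` (K - {a})) \<subseteq> ?R" using s sub by simp
    ultimately have "Suc (card K - 1) \<le> card ?R" using card_mono[OF fin] by metis
    then show ?thesis using False ub degree_weighted_poly(1)[of K m, OF km] K by simp
  qed
qed

section \<open>Second fundamental form and mean curvature by duality\<close>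

text \<open>The two properties of the bilinear form and of the tangent space at one point that make the tangential
  part well defined. They hold for the sphere and for the Lorentzian cylinder, so that both second fundamental
  forms are treated at once.\<close>

definition ambient_form :: "('b::real_normed_vector \<Rightarrow> 'b \<Rightarrow> real) \<Rightarrow> ('b \<Rightarrow> 'b set) \<Rightarrow> 'b \<Rightarrow> bool" where
  "ambient_form B T p \<longleftrightarrow> bilinear B \<and> (\<forall>v w. B v w = B w v) \<and> subspace (T p) \<and>
     (\<forall>w. \<exists>z\<in>T p. \<forall>t\<in>T p. B (w - z) t = 0) \<and> (\<forall>z\<in>T p. (\<forall>t\<in>T p. B z t = 0) \<longrightarrow> z = 0)"

lemma bilinear_inner: "bilinear ((\<bullet>) :: 'a::euclidean_space \<Rightarrow> 'a \<Rightarrow> real)"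
  by (rule bilinear_conv_bounded_bilinear[THEN iffD2]) (rule bounded_bilinear_inner)

lemma bounded_bilinear_lor: "bounded_bilinear (lor :: 'v::euclidean_space \<times> real \<Rightarrow> _)"
proof -
  have "bilinear (lor :: 'v \<times> real \<Rightarrow> _)"
    by (auto simp: bilinear_def lor_def algebra_simps inner_add intro!: linearI)
  then show ?thesis using bilinear_conv_bounded_bilinear by blast
qed

lemma bilinear_lor: "bilinear (lor :: 'v::euclidean_space \<times> real \<Rightarrow> _)"
  using bounded_bilinear_lor bilinear_conv_bounded_bilinear by blast

lemma ambient_form_sphere:
  assumes "p \<in> unit_sphere"
  shows "ambient_form (\<bullet>) sphere_tangent (p::'v::euclidean_space)"
proof -
  have p: "p \<bullet> p = 1" using assms by (simp add: unit_sphere_def)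
  have "\<exists>z\<in>sphere_tangent p. \<forall>t\<in>sphere_tangent p. (w - z) \<bullet> t = 0" for w
    by (rule bexI[of _ "w - (w \<bullet> p) *\<^sub>R p"])
      (auto simp: sphere_tangent_def algebra_simps p inner_commute)
  moreover have "subspace (sphere_tangent p)"
    by (auto simp: subspace_def sphere_tangent_def inner_add_left)
  ultimately show ?thesis
    by (auto simp: ambient_form_def bilinear_inner inner_commute)
qed

lemma ambient_form_cylinder:
  assumes "p \<in> cylinder"
  shows "ambient_form lor cylinder_tangent (p::'v::euclidean_space \<times> real)"
proof -
  obtain a b where pab: "p = (a, b)" by (cases p)
  have a: "a \<bullet> a = 1" using assms by (simp add: cylinder_def unit_sphere_def pab)
  have "\<exists>z\<in>cylinder_tangent p. \<forall>t\<in>cylinder_tangent p. lor (w - z) t = 0" for w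
    by (rule bexI[of _ "(fst w - (fst w \<bullet> a) *\<^sub>R a, snd w)"])
      (auto simp: cylinder_tangent_def sphere_tangent_def lor_def algebra_simps a pab inner_commute)
  moreover have "subspace (cylinder_tangent p)"
    by (auto simp: subspace_def cylinder_tangent_def sphere_tangent_def inner_add_left mem_Times_iff)
  moreover have "z = 0" if "z \<in> cylinder_tangent p" "\<forall>t\<in>cylinder_tangent p. lor z t = 0" for z
  proof -
    have "(fst z, - snd z) \<in> cylinder_tangent p" using that(1) by (auto simp: cylinder_tangent_def)
    then have "lor z (fst z, - snd z) = 0" using that(2) by blast
    then have "fst z \<bullet> fst z + snd z * snd z = 0" by (simp add: lor_def)
    then show ?thesis by (simp add: prod_eq_iff add_nonneg_eq_0_iff)
  qed
  moreover have "lor v w = lor w v" for v w :: "'v \<times> real" by (simp add: lor_def inner_commute mult.commute)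
  ultimately show ?thesis by (auto simp: ambient_form_def bilinear_lor)
qed

lemma ambient_tangent_part:
  assumes a: "ambient_form B T p"
  shows "ambient_tangent_part B T p w \<in> T p"
    and "t \<in> T p \<Longrightarrow> B (ambient_tangent_part B T p w) t = B w t"
proof -
  have b: "bilinear B" and s: "subspace (T p)" using a by (auto simp: ambient_form_def)
  obtain z where z: "z \<in> T p" "\<forall>t\<in>T p. B (w - z) t = 0" using a unfolding ambient_form_def by blast
  have "ambient_tangent_part B T p w = z"
    unfolding ambient_tangent_part_def
  proof (rule the_equality)
    fix z' assume z': "z' \<in> T p \<and> (\<forall>t\<in>T p. B (w - z') t = 0)"
    have "z' - z \<in> T p" using z z' s by (simp add: subspace_diff)
    moreover have "B (z' - z) t = 0" if "t \<in> T p" for t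
      using z z' that by (simp add: bilinear_lsub[OF b])
    ultimately show "z' = z" using a by (auto simp: ambient_form_def)
  qed (use z in blast)
  then show "ambient_tangent_part B T p w \<in> T p"
    and "t \<in> T p \<Longrightarrow> B (ambient_tangent_part B T p w) t = B w t"
    using z by (auto simp: bilinear_lsub[OF b])
qed

lemma riesz_representation:
  assumes g: "pos_metric g" and q: "linear (q :: 'e::euclidean_space \<Rightarrow> real)"
  obtains Z where "\<And>Y. g Z Y = q Y"
proof -
  obtain E where E: "orthonormal_basis g E" by (rule orthonormal_basis_exists[OF g])
  have "g (metric_sharp g (\<Sum>b\<in>Basis. q b *\<^sub>R b)) Y = q Y" for Y
  proof -
    have "g (metric_sharp g (\<Sum>b\<in>Basis. q b *\<^sub>R b)) Y = (\<Sum>b\<in>Basis. (Y \<bullet> b) * q b)"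
      unfolding metric_sharp_works[OF g E] inner_sum_left by (simp add: mult.commute inner_commute)
    also have "\<dots> = q (\<Sum>b\<in>Basis. (Y \<bullet> b) *\<^sub>R b)" by (simp add: linear_sum[OF q] linear_scale[OF q])
    finally show ?thesis by (simp add: euclidean_representation)
  qed
  then show thesis by (rule that)
qed

context
  fixes B :: "'b::real_normed_vector \<Rightarrow> 'b \<Rightarrow> real" and T and M :: "('m, 'e::euclidean_space) charts" and f x
  assumes a: "ambient_form B T (f x)" and D: "linear (diff1 M f x)" and tan: "range (diff1 M f x) \<subseteq> T (f x)"
    and g: "pos_metric (induced_metric B M f x)"
begin

lemma subspace_normal_space: "subspace (normal_space B T M f x)"
proof -
  have "bilinear B" "subspace (T (f x))" using a by (auto simp: ambient_form_def)
  then show ?thesis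
    by (auto simp: subspace_def normal_space_def bilinear_lzero bilinear_ladd bilinear_lmul)
qed

text \<open>The normal part is \<open>w - df Z\<close> for the vector \<open>Z\<close> that represents \<open>B w (df _)\<close> in the induced
  metric. Products with normal vectors do not see \<open>df Z\<close>.\<close>

lemma normal_part:
  assumes w: "w \<in> T (f x)"
  shows "normal_part B T M f x w \<in> normal_space B T M f x"
    and "\<xi> \<in> normal_space B T M f x \<Longrightarrow> B (normal_part B T M f x w) \<xi> = B w \<xi>"
proof -
  let ?D = "diff1 M f x"
  have b: "bilinear B" and sym: "B v u = B u v" and s: "subspace (T (f x))" for u v
    using a by (auto simp: ambient_form_def)
  have "linear (\<lambda>Y. B w (?D Y))"
    using linear_compose[OF D linear_bilinear_right[OF b]] by (simp add: o_def)
  from riesz_representation[OF g this]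
  obtain Z where Z: "\<And>Y. induced_metric B M f x Z Y = B w (?D Y)" by blast
  have z: "w - ?D Z \<in> normal_space B T M f x"
    using subspace_diff[OF s w, of "?D Z"] tan Z
    by (auto simp: normal_space_def bilinear_lsub[OF b] induced_metric_def)
  have "normal_part B T M f x w = w - ?D Z"
    unfolding normal_part_def
  proof (rule the_equality)
    show "w - ?D Z \<in> normal_space B T M f x \<and> w - (w - ?D Z) \<in> range ?D" using z by simp
    fix z' assume z': "z' \<in> normal_space B T M f x \<and> w - z' \<in> range ?D"
    then obtain Z' where Z': "w - z' = ?D Z'" by blast
    have "induced_metric B M f x (Z' - Z) (Z' - Z) = B ((w - ?D Z) - z') (?D (Z' - Z))"
      using Z' by (simp add: induced_metric_def linear_diff[OF D] algebra_simps)
    also have "\<dots> = 0" using z z' by (simp add: bilinear_lsub[OF b] normal_space_def)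
    finally have "Z' - Z = 0" using g by (metis less_irrefl pos_metric_def)
    then show "z' = w - ?D Z" using Z' by (metis diff_diff_eq2 add_diff_cancel_left' eq_iff_diff_eq_0)
  qed
  then show "normal_part B T M f x w \<in> normal_space B T M f x"
    and "\<xi> \<in> normal_space B T M f x \<Longrightarrow> B (normal_part B T M f x w) \<xi> = B w \<xi>"
    using z by (auto simp: bilinear_lsub[OF b] normal_space_def sym[of "?D Z"])
qed

lemma second_ff_normal: "second_ff B T M f x X Y \<in> normal_space B T M f x"
  unfolding second_ff_def cov_deriv_def by (intro normal_part(1) ambient_tangent_part(1) a)

lemma second_ff_pairing:
  assumes "\<xi> \<in> normal_space B T M f x"
  shows "B (second_ff B T M f x X Y) \<xi> = B (diff2 M f x X Y) \<xi>"
proof -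
  have "\<xi> \<in> T (f x)" using assms by (simp add: normal_space_def)
  then show ?thesis unfolding second_ff_def cov_deriv_def
    using assms by (simp add: normal_part(2) ambient_tangent_part[OF a])
qed

lemma mean_curvature_normal: "mean_curvature B T M f x \<in> normal_space B T M f x"
  unfolding mean_curvature_def metric_trace_def
  by (intro subspace_sum subspace_normal_space second_ff_normal)

text \<open>Products of the mean curvature vector with normal vectors are traces of second derivatives in the ambient
  vector space, without any projection. Only such products are ever computed.\<close>

lemma mean_curvature_pairing:
  assumes "\<xi> \<in> normal_space B T M f x"
  shows "B (mean_curvature B T M f x) \<xi> = metric_trace (induced_metric B M f x) (\<lambda>X Y. B (diff2 M f x X Y) \<xi>)"
proof -
  have b: "bilinear B" using a by (auto simp: ambient_form_def)
  show ?thesis unfolding mean_curvature_def metric_trace_def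
    by (simp add: linear_sum[OF linear_bilinear_left[OF b]] second_ff_pairing[OF assms])
qed

end

section \<open>Change of charts\<close>

text \<open>The atlas with one chart, by means of which a map on an open subset of the model space is a map on a
  manifold. All pointwise notions can then be reused for coordinate representations.\<close>

definition flat :: "('e::euclidean_space, 'e) charts" where
  "flat = (\<lambda>_. (UNIV, \<lambda>x. x))"

lemma coord_rep_flat [simp]: "coord_rep flat x f = f"
  using inv_id by (simp add: coord_rep_def flat_def id_def o_def)

lemma chart_flat [simp]: "chart flat x = (\<lambda>x. x)" "chart_dom flat x = UNIV"
  by (simp_all add: flat_def)

lemma diff1_flat: "diff1 flat f u X = fder f u X"
  and diff2_flat: "diff2 flat f u X Y = fder (\<lambda>w. fder f w Y) u X"
  by (simp_all add: diff1_def diff2_def)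

text \<open>The product rule for a derivative whose base point and argument both vary; it is what a change of
  charts does to second derivatives.\<close>

lemma has_derivative_fder_apply:
  fixes g :: "'c::euclidean_space \<Rightarrow> 'b::real_normed_vector"
  assumes S: "open S" and g: "Ck_on 2 S g" and t0: "t u \<in> S"
    and t: "(t has_derivative t') (at u)" and z: "(z has_derivative z') (at u)"
  shows "((\<lambda>w. fder g (t w) (z w)) has_derivative
     (\<lambda>X. fder (\<lambda>v. fder g v (z u)) (t u) (t' X) + fder g (t u) (z' X))) (at u)"
proof -
  have g2: "Ck_on (Suc (Suc 0)) S g" using g by (simp add: numeral_2_eq_2)
  have g1: "Ck_on (Suc 0) S (\<lambda>w. fder g w b)" for b by (rule Ck_on_fder[OF g2])
  have lin: "linear (fder g w)" if "w \<in> S" for w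
    using Ck_on_has_derivative[OF g2 that] has_derivative_linear by blast
  have rep: "fder g w y = (\<Sum>b\<in>Basis. (y \<bullet> b) *\<^sub>R fder g w b)" if "w \<in> S" for w y
    by (rule linear_expansion[OF lin[OF that]])
  have rep2: "fder (\<lambda>v. fder g v y) w x = (\<Sum>b\<in>Basis. (y \<bullet> b) *\<^sub>R fder (\<lambda>v. fder g v b) w x)" if w: "w \<in> S" for w x y
  proof -
    have "((\<lambda>v. \<Sum>b\<in>Basis. (y \<bullet> b) *\<^sub>R fder g v b) has_derivative
        (\<lambda>x. \<Sum>b\<in>Basis. (y \<bullet> b) *\<^sub>R fder (\<lambda>v. fder g v b) w x)) (at w)"
      by (intro has_derivative_sum has_derivative_scaleR_right Ck_on_has_derivative[OF g1 w])
    then have "((\<lambda>v. fder g v y) has_derivative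
        (\<lambda>x. \<Sum>b\<in>Basis. (y \<bullet> b) *\<^sub>R fder (\<lambda>v. fder g v b) w x)) (at w)"
      by (rule has_derivative_transform_within_open[OF _ S w]) (simp add: rep[symmetric])
    then show ?thesis by (rule fder_eqI)
  qed
  have gt: "((\<lambda>w. fder g (t w) b) has_derivative (\<lambda>X. fder (\<lambda>v. fder g v b) (t u) (t' X))) (at u)" for b
    using diff_chain_at[OF t Ck_on_has_derivative[OF g1 t0]] by (simp add: o_def)
  have d: "((\<lambda>w. \<Sum>b\<in>Basis. (z w \<bullet> b) *\<^sub>R fder g (t w) b) has_derivative
     (\<lambda>X. \<Sum>b\<in>Basis. (z u \<bullet> b) *\<^sub>R fder (\<lambda>v. fder g v b) (t u) (t' X) + (z' X \<bullet> b) *\<^sub>R fder g (t u) b)) (at u)"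
    by (intro has_derivative_sum has_derivative_scaleR gt has_derivative_inner_left z)
  have cont: "isCont t u" using t has_derivative_continuous by blast
  then obtain W where W: "open W" "u \<in> W" "\<And>w. w \<in> W \<Longrightarrow> t w \<in> S"
    using S t0 by (metis continuous_at_open)
  have "((\<lambda>w. fder g (t w) (z w)) has_derivative
     (\<lambda>X. \<Sum>b\<in>Basis. (z u \<bullet> b) *\<^sub>R fder (\<lambda>v. fder g v b) (t u) (t' X) + (z' X \<bullet> b) *\<^sub>R fder g (t u) b)) (at u)"
    by (rule has_derivative_transform_within_open[OF d W(1,2)]) (simp add: W(3) rep[symmetric])
  then show ?thesis by (simp add: sum.distrib rep[OF t0, of "z' _", symmetric] rep2[OF t0, of "z u", symmetric])
qed

context
  fixes M :: "('m::{t2_space,second_countable_topology}, 'e::euclidean_space) charts"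
  assumes M: "smooth_manifold M"
begin

lemma chart_dom: "open (chart_dom M x)" "x \<in> chart_dom M x"
  and chart_homeo: "homeomorphism (chart_dom M x) (chart M x ` chart_dom M x) (chart M x)
            (inv_into (chart_dom M x) (chart M x))"
  and chart_range_open: "open (chart M x ` chart_dom M x)"
  and chart_smooth: "smooth_on (chart M x ` (chart_dom M x \<inter> chart_dom M y)) (coord_rep M x (chart M y))"
  using M unfolding smooth_manifold_def by blast+

lemma inv_chart: "y \<in> chart_dom M x \<Longrightarrow> inv_into (chart_dom M x) (chart M x) (chart M x y) = y"
  using chart_homeo[of x] by (simp add: homeomorphism_def)

lemma coord_rep_chart: "y \<in> chart_dom M x \<Longrightarrow> coord_rep M x f (chart M x y) = f y"
  by (simp add: coord_rep_def inv_chart)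

lemma coord_rep_chart_self: "coord_rep M x f (chart M x x) = f x"
  by (rule coord_rep_chart[OF chart_dom(2)])

lemma open_chart_image: "open W \<Longrightarrow> open (chart M x ` (chart_dom M x \<inter> W))"
proof -
  assume W: "open W"
  let ?h = "inv_into (chart_dom M x) (chart M x)"
  have "continuous_on (chart M x ` chart_dom M x) ?h" using chart_homeo[of x] by (simp add: homeomorphism_def)
  then have "open (chart M x ` chart_dom M x \<inter> ?h -` W)"
    by (rule continuous_open_preimage[OF _ chart_range_open W])
  moreover have "chart M x ` chart_dom M x \<inter> ?h -` W = chart M x ` (chart_dom M x \<inter> W)"
    by (auto simp: inv_chart)
  ultimately show ?thesis by simp
qed

lemma open_chart_preimage: "open U \<Longrightarrow> open {y \<in> chart_dom M x. chart M x y \<in> U}"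
proof -
  assume U: "open U"
  have "continuous_on (chart_dom M x) (chart M x)" using chart_homeo[of x] by (simp add: homeomorphism_def)
  from continuous_open_preimage[OF this chart_dom(1) U] show ?thesis by (simp add: vimage_def Int_def)
qed

lemma continuous_on_coord_rep:
  assumes "continuous_on W f"
  shows "continuous_on (chart M x ` (chart_dom M x \<inter> W)) (coord_rep M x f)"
proof -
  have h: "continuous_on (chart M x ` (chart_dom M x \<inter> W)) (inv_into (chart_dom M x) (chart M x))"
    using chart_homeo[of x] by (auto simp: homeomorphism_def intro: continuous_on_subset)
  show ?thesis unfolding coord_rep_def
    by (rule continuous_on_compose[OF h]) (rule continuous_on_subset[OF assms], auto simp: inv_chart)
qed

lemma continuous_on_from_charts:
  assumes W: "open W" and c: "\<And>x. x \<in> W \<Longrightarrow> continuous_on (chart M x ` (chart_dom M x \<inter> W)) (coord_rep M x f)"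
  shows "continuous_on W f"
  unfolding continuous_on_eq_continuous_at[OF W]
proof
  fix x assume x: "x \<in> W"
  have 1: "continuous_on (chart_dom M x \<inter> W) (chart M x)"
    using chart_homeo[of x] by (auto simp: homeomorphism_def intro: continuous_on_subset)
  have "continuous_on (chart_dom M x \<inter> W) (coord_rep M x f \<circ> chart M x)"
    by (rule continuous_on_compose[OF 1 c[OF x]])
  then have "continuous_on (chart_dom M x \<inter> W) f"
    by (rule continuous_on_cong[THEN iffD1, rotated -1]) (auto simp: coord_rep_chart)
  then show "isCont f x" using W chart_dom x continuous_on_eq_continuous_at[of "chart_dom M x \<inter> W"] by auto
qed

lemma Ck_map_Ck_on: "Ck_map M k W f \<Longrightarrow> Ck_on k (chart M x ` (chart_dom M x \<inter> W)) (coord_rep M x f)"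
  by (simp add: Ck_map_def)

text \<open>The tangent space at a point is by definition read in the chart at that point, so that nothing has to be
  transformed here.\<close>

lemma diff_at_point:
  "diff1 M f x = diff1 flat (coord_rep M x f) (chart M x x)"
  "diff2 M f x = diff2 flat (coord_rep M x f) (chart M x x)"
  by (auto simp: diff1_def diff2_def fun_eq_iff)

lemma geometry_at_point:
  "induced_metric B M f x = induced_metric B flat (coord_rep M x f) (chart M x x)"
  "normal_space B T M f x = normal_space B T flat (coord_rep M x f) (chart M x x)"
  "second_ff B T M f x = second_ff B T flat (coord_rep M x f) (chart M x x)"
  "mean_curvature B T M f x = mean_curvature B T flat (coord_rep M x f) (chart M x x)"
proof -
  show i: "induced_metric B M f x = induced_metric B flat (coord_rep M x f) (chart M x x)"
    by (auto simp: induced_metric_def fun_eq_iff diff_at_point)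
  show n: "normal_space B T M f x = normal_space B T flat (coord_rep M x f) (chart M x x)"
    by (auto simp: normal_space_def coord_rep_chart_self diff_at_point)
  show s: "second_ff B T M f x = second_ff B T flat (coord_rep M x f) (chart M x x)"
    by (simp add: second_ff_def normal_part_def cov_deriv_def n coord_rep_chart_self diff_at_point fun_eq_iff)
  show "mean_curvature B T M f x = mean_curvature B T flat (coord_rep M x f) (chart M x x)"
    by (simp add: mean_curvature_def i s)
qed

lemma curvatures_at_point:
  "shape_operator M \<phi> \<nu> x = shape_operator flat (coord_rep M x \<phi>) (coord_rep M x \<nu>) (chart M x x)"
  "principal_curvatures M \<phi> \<nu> x = principal_curvatures flat (coord_rep M x \<phi>) (coord_rep M x \<nu>) (chart M x x)"
  "curvature_roots M \<phi> \<nu> x = curvature_roots flat (coord_rep M x \<phi>) (coord_rep M x \<nu>) (chart M x x)"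
  by (auto simp: shape_operator_def principal_curvatures_def curvature_roots_def curvature_poly_def
    curvature_mult_def diff_at_point fun_eq_iff)

text \<open>First and second derivative, at \<open>y\<close>, of the transition from the chart at \<open>y\<close> to the chart at
  \<open>x\<close>.\<close>

definition trans_D :: "'m \<Rightarrow> 'm \<Rightarrow> 'e \<Rightarrow> 'e" where
  "trans_D x y = fder (coord_rep M y (chart M x)) (chart M y y)"

definition trans_D2 :: "'m \<Rightarrow> 'm \<Rightarrow> 'e \<Rightarrow> 'e \<Rightarrow> 'e" where
  "trans_D2 x y X Y = fder (\<lambda>w. fder (coord_rep M y (chart M x)) w Y) (chart M y y) X"

lemma trans_open: "open (chart M y ` (chart_dom M y \<inter> chart_dom M x))"
  by (intro open_chart_image chart_dom)

lemma trans_point: "y \<in> chart_dom M x \<Longrightarrow> chart M y y \<in> chart M y ` (chart_dom M y \<inter> chart_dom M x)"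
  using chart_dom(2) by blast

lemma trans_Ck: "Ck_on k (chart M y ` (chart_dom M y \<inter> chart_dom M x)) (coord_rep M y (chart M x))"
  using chart_smooth[of y x] by (simp add: smooth_on_def)

lemma coord_rep_trans:
  assumes "u \<in> chart M y ` (chart_dom M y \<inter> chart_dom M x)"
  shows "coord_rep M y f u = coord_rep M x f (coord_rep M y (chart M x) u)"
  using assms by (auto simp: coord_rep_chart)

lemma trans_has_derivative:
  assumes "y \<in> chart_dom M x"
  shows "(coord_rep M y (chart M x) has_derivative trans_D x y) (at (chart M y y))"
  unfolding trans_D_def by (rule Ck_on_has_derivative[OF trans_Ck trans_point[OF assms]])

lemma trans_D_bij:
  assumes y: "y \<in> chart_dom M x"
  shows "linear (trans_D x y)" "bij (trans_D x y)"
proof -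
  show l: "linear (trans_D x y)" using trans_has_derivative[OF y] has_derivative_linear by blast
  let ?t = "coord_rep M y (chart M x)" and ?t' = "coord_rep M x (chart M y)"
  have p: "?t (chart M y y) = chart M x y" by (rule coord_rep_chart_self)
  have "chart M x y \<in> chart M x ` (chart_dom M x \<inter> chart_dom M y)" using y chart_dom(2) by blast
  then have "(?t' has_derivative fder ?t' (chart M x y)) (at (?t (chart M y y)))"
    unfolding p by (rule Ck_on_has_derivative[OF trans_Ck])
  from diff_chain_at[OF trans_has_derivative[OF y] this]
  have 1: "((?t' \<circ> ?t) has_derivative (fder ?t' (chart M x y) \<circ> trans_D x y)) (at (chart M y y))" .
  have "((?t' \<circ> ?t) has_derivative (\<lambda>v. v)) (at (chart M y y))"
    by (rule has_derivative_transform_within_open[OF has_derivative_ident trans_open[of y x] trans_point[OF y]])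
      (auto simp: coord_rep_chart)
  from has_derivative_unique[OF 1 this] have "fder ?t' (chart M x y) (trans_D x y v) = v" for v
    by (simp add: fun_eq_iff)
  then have "inj (trans_D x y)" by (rule inj_on_inverseI)
  then show "bij (trans_D x y)" using l linear_inj_imp_surj by (auto simp: bij_def)
qed

lemma diff1_change_chart:
  assumes y: "y \<in> chart_dom M x" and f: "coord_rep M x f differentiable at (chart M x y)"
  shows "diff1 M f y X = fder (coord_rep M x f) (chart M x y) (trans_D x y X)"
proof -
  let ?t = "coord_rep M y (chart M x)"
  have "(coord_rep M x f has_derivative fder (coord_rep M x f) (chart M x y)) (at (?t (chart M y y)))"
    using f by (simp add: coord_rep_chart_self frechet_derivative_works)
  from diff_chain_at[OF trans_has_derivative[OF y] this]
  have "((coord_rep M x f \<circ> ?t) has_derivative (fder (coord_rep M x f) (chart M x y) \<circ> trans_D x y)) (at (chart M y y))" .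
  then have "(coord_rep M y f has_derivative (fder (coord_rep M x f) (chart M x y) \<circ> trans_D x y)) (at (chart M y y))"
    by (rule has_derivative_transform_within_open[OF _ trans_open[of y x] trans_point[OF y]])
      (simp only: o_def coord_rep_trans[where f=f, symmetric])
  from fder_eqI[OF this] show ?thesis by (simp add: diff1_def)
qed

text \<open>The second derivative is not tensorial, but the additional term is tangent and so it is invisible to
  normal vectors.\<close>

lemma diff2_change_chart:
  fixes f :: "'m \<Rightarrow> 'b::real_normed_vector"
  assumes y: "y \<in> chart_dom M x" and S: "open S" "chart M x y \<in> S" and f: "Ck_on 2 S (coord_rep M x f)"
  shows "diff2 M f y X Y = fder (\<lambda>w. fder (coord_rep M x f) w (trans_D x y Y)) (chart M x y) (trans_D x y X)
     + fder (coord_rep M x f) (chart M x y) (trans_D2 x y X Y)"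
proof -
  let ?t = "coord_rep M y (chart M x)" and ?u = "chart M y y" and ?f = "coord_rep M x f"
  let ?O = "chart M y ` (chart_dom M y \<inter> chart_dom M x)"
  have f2: "Ck_on (Suc (Suc 0)) S ?f" using f by (simp add: numeral_2_eq_2)
  have p: "?t ?u = chart M x y" by (rule coord_rep_chart_self)
  have "continuous_on ?O ?t" using Ck_on_continuous[OF trans_Ck] .
  then have oW: "open (?O \<inter> ?t -` S)" by (rule continuous_open_preimage[OF _ trans_open S(1)])
  have uW: "?u \<in> ?O \<inter> ?t -` S" using trans_point[OF y] p S by auto
  have 1: "fder (coord_rep M y f) w Y = fder ?f (?t w) (fder ?t w Y)" if w: "w \<in> ?O \<inter> ?t -` S" for w
  proof -
    have "((?f \<circ> ?t) has_derivative (fder ?f (?t w) \<circ> fder ?t w)) (at w)"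
      by (rule diff_chain_at[OF Ck_on_has_derivative[OF trans_Ck] Ck_on_has_derivative[OF f2]]) (use w in auto)
    then have "(coord_rep M y f has_derivative (fder ?f (?t w) \<circ> fder ?t w)) (at w)"
      by (rule has_derivative_transform_within_open[OF _ trans_open[of y x]]) (use w in \<open>simp_all add: coord_rep_trans[where f=f, symmetric]\<close>)
    from fder_eqI[OF this] show ?thesis by simp
  qed
  have "((\<lambda>w. fder ?t w Y) has_derivative fder (\<lambda>w. fder ?t w Y) ?u) (at ?u)"
    by (rule Ck_on_has_derivative[OF Ck_on_fder[OF trans_Ck] trans_point[OF y]])
  from has_derivative_fder_apply[where t="?t", OF S(1) f _ trans_has_derivative[OF y] this]
  have "((\<lambda>w. fder ?f (?t w) (fder ?t w Y)) has_derivative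
    (\<lambda>X. fder (\<lambda>v. fder ?f v (trans_D x y Y)) (chart M x y) (trans_D x y X)
       + fder ?f (chart M x y) (trans_D2 x y X Y))) (at ?u)"
    using S(2) unfolding p trans_D2_def trans_D_def by simp
  then have "((\<lambda>w. fder (coord_rep M y f) w Y) has_derivative
    (\<lambda>X. fder (\<lambda>v. fder ?f v (trans_D x y Y)) (chart M x y) (trans_D x y X)
       + fder ?f (chart M x y) (trans_D2 x y X Y))) (at ?u)"
    by (rule has_derivative_transform_within_open[OF _ oW uW]) (simp add: 1)
  from fder_eqI[OF this] show ?thesis by (simp add: diff2_def)
qed

end

section \<open>Null normals\<close>

text \<open>Position, tangent space of the projection to the sphere, and \<open>m\<close> span the ambient space: a relation
  between them would yield a tangent vector whose image is a multiple of the null vector \<open>(m, 1)\<close>.\<close>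

lemma null_frame_orthogonal_zero:
  fixes D :: "'e::euclidean_space \<Rightarrow> 'v::euclidean_space \<times> real"
  assumes D: "linear D" and dim: "DIM('v) = DIM('e) + 2"
    and pos: "\<And>X. X \<noteq> 0 \<Longrightarrow> lor (D X) (D X) > 0"
    and p: "p \<bullet> p = 1" "\<And>X. fst (D X) \<bullet> p = 0"
    and m: "m \<bullet> m = 1" "m \<bullet> p = 0" "\<And>X. m \<bullet> fst (D X) = snd (D X)"
    and v: "v \<bullet> p = 0" "v \<bullet> m = 0" "\<And>X. v \<bullet> fst (D X) = 0"
  shows "v = 0"
proof (rule frame_orthogonal_zero[OF _ dim _ v(3,1,2)])
  show "linear (\<lambda>X. fst (D X))" using linear_compose[OF D linear_fst] by (simp add: o_def)
  fix X \<alpha> \<beta> assume z: "fst (D X) + \<alpha> *\<^sub>R p + \<beta> *\<^sub>R m = 0"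
  have "(fst (D X) + \<alpha> *\<^sub>R p + \<beta> *\<^sub>R m) \<bullet> p = 0" using z by simp
  then have a: "\<alpha> = 0" using p m by (simp add: inner_add_left)
  have "m \<bullet> (fst (D X) + \<alpha> *\<^sub>R p + \<beta> *\<^sub>R m) = 0" using z by simp
  then have b: "snd (D X) = - \<beta>" using m by (simp add: inner_add_right)
  have "fst (D X) = - \<beta> *\<^sub>R m" using z a by (simp add: eq_neg_iff_add_eq_0)
  then have "lor (D X) (D X) = 0" using b m(1) by (simp add: lor_def)
  then have "X = 0" using pos by force
  then show "X = 0 \<and> \<alpha> = 0 \<and> \<beta> = 0" using a b linear_0[OF D] by simp
qed

lemma has_derivative_partial_right:
  assumes "(\<Phi> has_derivative L) (at (u, y))"
  shows "((\<lambda>w. \<Phi> (u, w)) has_derivative (\<lambda>z. L (0, z))) (at y)"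
  using diff_chain_at[OF has_derivative_Pair[OF has_derivative_const has_derivative_ident] assms]
  by (simp add: o_def)

lemma cylinder_tangent_derivative:
  fixes f :: "'e::euclidean_space \<Rightarrow> 'v::euclidean_space \<times> real"
  assumes U: "open U" "u \<in> U" and f: "(f has_derivative f') (at u)"
    and cyl: "\<And>w. w \<in> U \<Longrightarrow> fst (f w) \<bullet> fst (f w) = 1"
  shows "fst (f' X) \<bullet> fst (f u) = 0"
proof -
  have "((\<lambda>w. fst (f w) \<bullet> fst (f w)) has_derivative (\<lambda>X. fst (f u) \<bullet> fst (f' X) + fst (f' X) \<bullet> fst (f u))) (at u)"
    by (intro has_derivative_inner has_derivative_fst f)
  then have "fst (f u) \<bullet> fst (f' X) + fst (f' X) \<bullet> fst (f u) = 0"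
    by (rule derivative_of_constant[OF U, where c="1::real"]) (simp add: cyl)
  then show ?thesis by (simp add: inner_commute)
qed

text \<open>The conditions on \<open>m\<close> are linear equations and one quadratic equation, with coefficients one
  derivative worse than \<open>f\<close>. Their linearisation at \<open>m\<close> is injective because the frame spans.\<close>

lemma null_normal_Ck:
  fixes f :: "'e::euclidean_space \<Rightarrow> 'v::euclidean_space \<times> real"
  assumes U: "open U" and dim: "DIM('v) = DIM('e) + 2" and f: "Ck_on (Suc k) U f"
    and cyl: "\<And>u. u \<in> U \<Longrightarrow> fst (f u) \<bullet> fst (f u) = 1"
    and pos: "\<And>u X. u \<in> U \<Longrightarrow> X \<noteq> 0 \<Longrightarrow> lor (fder f u X) (fder f u X) > 0"
    and cont: "continuous_on U m"
    and m: "\<And>u. u \<in> U \<Longrightarrow> m u \<bullet> m u = 1" "\<And>u. u \<in> U \<Longrightarrow> m u \<bullet> fst (f u) = 0"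
      "\<And>u X. u \<in> U \<Longrightarrow> m u \<bullet> fst (fder f u X) = snd (fder f u X)"
  shows "Ck_on k U m"
proof (cases k)
  case 0
  then show ?thesis using cont by simp
next
  case (Suc j)
  define \<Phi> :: "'e \<times> 'v \<Rightarrow> 'e \<times> real \<times> real" where
    "\<Phi> p = ((\<Sum>b\<in>Basis. (snd p \<bullet> fst (fder f (fst p) b) - snd (fder f (fst p) b)) *\<^sub>R b),
       snd p \<bullet> fst (f (fst p)), snd p \<bullet> snd p - 1)" for p
  have oT: "open (U \<times> (UNIV :: 'v set))" using U by (simp add: open_Times)
  have c1: "Ck_on k (U \<times> (UNIV :: 'v set)) (\<lambda>p. fder f (fst p) b)" for b
    by (rule Ck_on_compose[OF oT Ck_on_fst[OF oT Ck_on_ident[OF oT]] Ck_on_fder[OF f]]) auto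
  have c2: "Ck_on k (U \<times> (UNIV :: 'v set)) (\<lambda>p. f (fst p))"
    by (rule Ck_on_compose[OF oT Ck_on_fst[OF oT Ck_on_ident[OF oT]] Ck_on_pred[OF f]]) auto
  have \<Phi>: "Ck_on (Suc j) (U \<times> UNIV) \<Phi>"
    unfolding \<Phi>_def Suc[symmetric]
    by (intro Ck_on_Pair oT Ck_on_sum Ck_on_scaleR Ck_on_diff Ck_on_inner Ck_on_const
      Ck_on_fst[OF oT c1] Ck_on_snd[OF oT c1] Ck_on_fst[OF oT c2] Ck_on_snd[OF oT Ck_on_ident[OF oT]])
  have z0: "z = 0" if u: "u \<in> U" and z: "fder \<Phi> (u, m u) (0, z) = 0" for u z
  proof -
    have lin: "linear (fder f u)" using Ck_on_has_derivative[OF f u] has_derivative_linear by blast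
    have "((\<lambda>w. \<Phi> (u, w)) has_derivative (\<lambda>z. fder \<Phi> (u, m u) (0, z))) (at (m u))"
      by (rule has_derivative_partial_right[OF Ck_on_has_derivative[OF \<Phi>]]) (use u in auto)
    moreover have "((\<lambda>w. \<Phi> (u, w)) has_derivative (\<lambda>z. ((\<Sum>b\<in>Basis. (z \<bullet> fst (fder f u b)) *\<^sub>R b),
       z \<bullet> fst (f u), m u \<bullet> z + z \<bullet> m u))) (at (m u))"
      unfolding \<Phi>_def by (auto intro!: derivative_eq_intros)
    ultimately have "(\<lambda>z. fder \<Phi> (u, m u) (0, z)) = (\<lambda>z. ((\<Sum>b\<in>Basis. (z \<bullet> fst (fder f u b)) *\<^sub>R b),
       z \<bullet> fst (f u), m u \<bullet> z + z \<bullet> m u))" by (rule has_derivative_unique)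
    from fun_cong[OF this, of z] z
    have s: "(\<Sum>b\<in>Basis. (z \<bullet> fst (fder f u b)) *\<^sub>R b) = 0" and z1: "z \<bullet> fst (f u) = 0" "z \<bullet> m u = 0"
      by (auto simp: zero_prod_def inner_commute)
    have zb: "z \<bullet> fst (fder f u b) = 0" if "b \<in> Basis" for b
      using arg_cong[OF s, of "\<lambda>x. x \<bullet> b"] that by simp
    have z2: "z \<bullet> fst (fder f u X) = 0" for X
    proof -
      have l: "linear (\<lambda>X. z \<bullet> fst (fder f u X))"
        using linear_compose[OF linear_compose[OF lin linear_fst] linear_bilinear_right[OF bilinear_inner]]
        by (simp add: o_def)
      show ?thesis using zb by (subst linear_expansion[OF l]) simp
    qed
    show ?thesis
      by (rule null_frame_orthogonal_zero[OF lin dim pos[OF u] cyl[OF u] _ m(1,2,3)[OF u] z1 z2])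
        (use cylinder_tangent_derivative[OF U u Ck_on_has_derivative[OF f u] cyl] in auto)
  qed
  show ?thesis unfolding Suc
    by (rule implicit_function_Ck[OF U oT cont \<Phi> _ _ z0]) (auto simp: \<Phi>_def m zero_prod_def)
qed

section \<open>Hypersurfaces of the sphere\<close>

text \<open>A hypersurface of the sphere with a Gauss map, in one chart. The Gauss map is assumed to be continuous
  only; its differentiability is a consequence.\<close>

locale hypersurface =
  fixes U :: "'e::euclidean_space set" and \<phi> \<nu> :: "'e \<Rightarrow> 'v::euclidean_space"
  assumes dim: "DIM('v) = DIM('e) + 2" and U: "open U" and \<phi>_Ck: "Ck_on 4 U \<phi>"
    and \<phi>_unit: "\<And>u. u \<in> U \<Longrightarrow> \<phi> u \<bullet> \<phi> u = 1" and \<phi>_inj: "\<And>u. u \<in> U \<Longrightarrow> inj (fder \<phi> u)"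
    and \<nu>_cont: "continuous_on U \<nu>" and \<nu>_unit: "\<And>u. u \<in> U \<Longrightarrow> \<nu> u \<bullet> \<nu> u = 1"
    and \<nu>_\<phi>: "\<And>u. u \<in> U \<Longrightarrow> \<nu> u \<bullet> \<phi> u = 0"
    and \<nu>_d\<phi>: "\<And>u X. u \<in> U \<Longrightarrow> \<nu> u \<bullet> fder \<phi> u X = 0"
begin

lemma \<phi>_der: "u \<in> U \<Longrightarrow> (\<phi> has_derivative fder \<phi> u) (at u)"
  using Ck_on_has_derivative[of 3 U \<phi>] \<phi>_Ck by (simp add: numeral_eq_Suc del: Ck_on.simps)

lemma d\<phi>_linear: "u \<in> U \<Longrightarrow> linear (fder \<phi> u)"
  using \<phi>_der has_derivative_linear by blast

lemma d\<phi>_\<phi>: "u \<in> U \<Longrightarrow> fder \<phi> u X \<bullet> \<phi> u = 0"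
  using cylinder_tangent_derivative[OF U _ has_derivative_Pair[OF \<phi>_der has_derivative_const[of 0]], of u X] \<phi>_unit
  by simp

lemma d\<phi>_eq_0: "u \<in> U \<Longrightarrow> fder \<phi> u X = 0 \<longleftrightarrow> X = 0"
  using \<phi>_inj d\<phi>_linear linear_injective_0 linear_0 by metis

lemma frame_zero:
  assumes u: "u \<in> U" and v: "v \<bullet> \<phi> u = 0" "v \<bullet> \<nu> u = 0" "\<And>X. v \<bullet> fder \<phi> u X = 0"
  shows "v = 0"
proof (rule frame_orthogonal_zero[OF d\<phi>_linear[OF u] dim _ v(3,1,2)])
  fix X \<alpha> \<beta> assume z: "fder \<phi> u X + \<alpha> *\<^sub>R \<phi> u + \<beta> *\<^sub>R \<nu> u = 0"
  have "\<phi> u \<bullet> (fder \<phi> u X + \<alpha> *\<^sub>R \<phi> u + \<beta> *\<^sub>R \<nu> u) = 0" using z by simp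
  then have a: "\<alpha> = 0" using d\<phi>_\<phi>[OF u, of X] \<phi>_unit[OF u] \<nu>_\<phi>[OF u]
    by (simp add: inner_add_right inner_commute)
  have "\<nu> u \<bullet> (fder \<phi> u X + \<alpha> *\<^sub>R \<phi> u + \<beta> *\<^sub>R \<nu> u) = 0" using z by simp
  then have b: "\<beta> = 0" using a \<nu>_d\<phi>[OF u, of X] \<nu>_unit[OF u] by (simp add: inner_add_right)
  show "X = 0 \<and> \<alpha> = 0 \<and> \<beta> = 0" using z a b d\<phi>_eq_0[OF u] by simp
qed

text \<open>A Gauss map of \<open>\<phi>\<close> is a null normal of the immersion \<open>(\<phi>, 0)\<close> into the cylinder.\<close>

lemma \<nu>_Ck: "Ck_on 3 U \<nu>"
proof (rule null_normal_Ck[OF U dim, of 3 "\<lambda>u. (\<phi> u, 0)"])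
  have e: "fder (\<lambda>u. (\<phi> u, 0::real)) u X = (fder \<phi> u X, 0)" if "u \<in> U" for u X
    by (rule fder_eqI) (intro has_derivative_Pair \<phi>_der[OF that] has_derivative_const)
  show "Ck_on (Suc 3) U (\<lambda>u. (\<phi> u, 0::real))"
    using Ck_on_Pair[OF U \<phi>_Ck Ck_on_const, of "0::real"] by (simp del: Ck_on.simps)
  show "0 < lor (fder (\<lambda>u. (\<phi> u, 0::real)) u X) (fder (\<lambda>u. (\<phi> u, 0::real)) u X)" if "u \<in> U" "X \<noteq> 0" for u X
    using that d\<phi>_eq_0 by (simp add: e lor_def)
  show "\<nu> u \<bullet> fst (fder (\<lambda>u. (\<phi> u, 0::real)) u X) = snd (fder (\<lambda>u. (\<phi> u, 0::real)) u X)" if "u \<in> U" for u X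
    using that \<nu>_d\<phi> by (simp add: e)
qed (simp_all add: \<phi>_unit \<nu>_cont \<nu>_unit \<nu>_\<phi>)

lemma \<nu>_der: "u \<in> U \<Longrightarrow> (\<nu> has_derivative fder \<nu> u) (at u)"
  using Ck_on_has_derivative[of 2 U \<nu>] \<nu>_Ck by (simp add: numeral_eq_Suc del: Ck_on.simps)

lemma d\<nu>_linear: "u \<in> U \<Longrightarrow> linear (fder \<nu> u)"
  using \<nu>_der has_derivative_linear by blast

lemma d\<nu>_\<nu>: "u \<in> U \<Longrightarrow> fder \<nu> u X \<bullet> \<nu> u = 0"
  using cylinder_tangent_derivative[OF U _ has_derivative_Pair[OF \<nu>_der has_derivative_const[of 0]], of u X] \<nu>_unit
  by simp

lemma d\<nu>_\<phi>: assumes u: "u \<in> U" shows "fder \<nu> u X \<bullet> \<phi> u = 0"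
proof -
  have "((\<lambda>w. \<nu> w \<bullet> \<phi> w) has_derivative (\<lambda>X. \<nu> u \<bullet> fder \<phi> u X + fder \<nu> u X \<bullet> \<phi> u)) (at u)"
    by (intro has_derivative_inner \<phi>_der \<nu>_der u)
  then have "\<nu> u \<bullet> fder \<phi> u X + fder \<nu> u X \<bullet> \<phi> u = 0"
    by (rule derivative_of_constant[OF U u, where c="0::real"]) (simp add: \<nu>_\<phi>)
  then show ?thesis using \<nu>_d\<phi>[OF u, of X] by simp
qed

definition first_form :: "'e \<Rightarrow> 'e \<Rightarrow> 'e \<Rightarrow> real" where "first_form u X Y = fder \<phi> u X \<bullet> fder \<phi> u Y"

definition A :: "'e \<Rightarrow> 'e \<Rightarrow> 'e" where "A u = shape_operator flat \<phi> \<nu> u"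

lemma first_form_induced: "induced_metric (\<bullet>) flat \<phi> u = first_form u"
  by (simp add: induced_metric_def diff1_flat first_form_def fun_eq_iff)

lemma first_form_pos: "u \<in> U \<Longrightarrow> pos_metric (first_form u)"
  unfolding pos_metric_def first_form_def bilinear_def using d\<phi>_eq_0
  by (auto simp: inner_commute linear_add[OF d\<phi>_linear] linear_scale[OF d\<phi>_linear] inner_add_left inner_add_right
      intro!: linearI)

text \<open>The derivative of the Gauss map is orthogonal to \<open>\<phi>\<close> and to \<open>\<nu>\<close>, hence tangent, and this is
  what makes the shape operator well defined.\<close>

lemma d\<nu>_eq: assumes u: "u \<in> U" shows "fder \<phi> u (A u X) = - fder \<nu> u X"
proof -
  have "linear (\<lambda>Y. - (fder \<nu> u X \<bullet> fder \<phi> u Y))"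
    using d\<phi>_linear[OF u] by (auto simp: linear_add linear_scale inner_add_right intro!: linearI)
  from riesz_representation[OF first_form_pos[OF u] this] obtain Z
    where Z: "\<And>Y. first_form u Z Y = - (fder \<nu> u X \<bullet> fder \<phi> u Y)" by blast
  have "fder \<phi> u Z + fder \<nu> u X = 0"
    by (rule frame_zero[OF u])
      (use Z in \<open>auto simp: inner_add_left d\<phi>_\<phi>[OF u] d\<nu>_\<phi>[OF u] d\<nu>_\<nu>[OF u] \<nu>_d\<phi>[OF u] inner_commute[of "fder \<phi> u Z" "\<nu> u"] first_form_def\<close>)
  then have Z': "fder \<phi> u Z = - fder \<nu> u X" by (simp add: eq_neg_iff_add_eq_0)
  have "A u X = Z"
    unfolding A_def shape_operator_def diff1_flat
    by (rule the_equality) (use Z' \<phi>_inj[OF u] in \<open>auto simp: inj_def\<close>)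
  then show ?thesis using Z' by simp
qed

lemma A_linear: assumes u: "u \<in> U" shows "linear (A u)"
proof (rule linearI)
  note l = linear_add[OF d\<phi>_linear[OF u]] linear_scale[OF d\<phi>_linear[OF u]]
    linear_add[OF d\<nu>_linear[OF u]] linear_scale[OF d\<nu>_linear[OF u]]
  show "A u (X + Y) = A u X + A u Y" for X Y
    by (rule injD[OF \<phi>_inj[OF u]]) (simp add: l d\<nu>_eq[OF u])
  show "A u (c *\<^sub>R X) = c *\<^sub>R A u X" for X c
    by (rule injD[OF \<phi>_inj[OF u]]) (simp add: l d\<nu>_eq[OF u])
qed

text \<open>Differentiating \<open>\<nu> \<bullet> d\<phi> Y = 0\<close>. The right side is symmetric, so that the shape
  operator is self-adjoint.\<close>

lemma second_form: assumes u: "u \<in> U"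
  shows "first_form u (A u X) Y = \<nu> u \<bullet> fder (\<lambda>w. fder \<phi> w Y) u X"
proof -
  have "((\<lambda>w. fder \<phi> w Y) has_derivative fder (\<lambda>w. fder \<phi> w Y) u) (at u)"
    by (rule Ck_on_has_derivative[of 2, OF Ck_on_fder u]) (use \<phi>_Ck in \<open>simp add: numeral_eq_Suc\<close>)
  then have "((\<lambda>w. \<nu> w \<bullet> fder \<phi> w Y) has_derivative
      (\<lambda>X. \<nu> u \<bullet> fder (\<lambda>w. fder \<phi> w Y) u X + fder \<nu> u X \<bullet> fder \<phi> u Y)) (at u)"
    by (intro has_derivative_inner \<nu>_der u)
  then have "\<nu> u \<bullet> fder (\<lambda>w. fder \<phi> w Y) u X + fder \<nu> u X \<bullet> fder \<phi> u Y = 0"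
    by (rule derivative_of_constant[OF U u, where c="0::real"]) (simp add: \<nu>_d\<phi>)
  then show ?thesis by (simp add: first_form_def d\<nu>_eq[OF u])
qed

lemma A_selfadjoint: assumes u: "u \<in> U" shows "first_form u (A u X) Y = first_form u X (A u Y)"
proof -
  have "Ck_on 2 U \<phi>" by (rule Ck_on_mono[OF _ \<phi>_Ck]) simp
  then have "first_form u (A u X) Y = first_form u (A u Y) X"
    using second_derivative_symmetric[OF U _ u, of \<phi> X Y] by (simp add: second_form[OF u])
  then show ?thesis by (simp add: first_form_def inner_commute)
qed

text \<open>The vector \<open>A u X\<close> solves the linear system \<open>d\<phi> Y = - d\<nu> X\<close>, whose coefficients are first
  derivatives of maps of class 4 and 3.\<close>

lemma A_Ck: "Ck_on 2 U (\<lambda>u. A u X)"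
proof (rule linear_system_Ck[OF U d\<phi>_linear _ \<phi>_inj _ d\<nu>_eq])
  show "Ck_on 2 U (\<lambda>u. fder \<phi> u z)" for z
    by (rule Ck_on_fder) (rule Ck_on_mono[OF _ \<phi>_Ck], simp)
  show "Ck_on 2 U (\<lambda>u. - fder \<nu> u X)"
    by (rule Ck_on_minus[OF U Ck_on_fder]) (use \<nu>_Ck in \<open>simp only: eval_nat_numeral\<close>)
qed

lemma eigenbasis:
  assumes u: "u \<in> U"
  obtains E l where "orthonormal_basis (first_form u) E" "\<And>e. e \<in> E \<Longrightarrow> A u e = l e *\<^sub>R e"
proof (rule selfadjoint_eigenbasis[of "first_form u" "A u", OF first_form_pos[OF u] A_linear[OF u] A_selfadjoint[OF u]])
  fix E l assume "orthonormal_basis (first_form u) E" "\<And>e. e \<in> E \<Longrightarrow> A u e = l e *\<^sub>R e"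
  then show thesis by (rule that)
qed

context
  fixes u E l
  assumes u: "u \<in> U" and E: "orthonormal_basis (first_form u) E" and l: "\<And>e. e \<in> E \<Longrightarrow> A u e = l e *\<^sub>R e"
begin

lemma principal_curvatures_eq: "principal_curvatures flat \<phi> \<nu> u = l ` E"
  using eigenvalues_eq[OF first_form_pos[OF u] E A_linear[OF u] l] by (simp add: principal_curvatures_def A_def)

lemma curvature_mult_eq: "curvature_mult flat \<phi> \<nu> u k = dim {X. A u X = k *\<^sub>R X}"
  by (simp add: curvature_mult_def A_def)

lemma curvature_mult_pos: "k \<in> l ` E \<Longrightarrow> real (curvature_mult flat \<phi> \<nu> u k) > 0"
  using dim_eigenspace[OF first_form_pos[OF u] E A_linear[OF u] l, of k] finite_orthonormal[OF first_form_pos[OF u] E]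
  by (auto simp: curvature_mult_eq card_gt_0_iff)

lemma curvature_poly_eq:
  "curvature_poly flat \<phi> \<nu> u = weighted_poly (l ` E) (\<lambda>k. real (curvature_mult flat \<phi> \<nu> u k))"
  by (simp add: curvature_poly_def weighted_poly_def principal_curvatures_eq)

lemma sum_curvature_mult:
  "(\<Sum>k\<in>l ` E. real (curvature_mult flat \<phi> \<nu> u k) * F k) = (\<Sum>e\<in>E. F (l e))"
  using sum_over_eigenvalues[OF first_form_pos[OF u] E A_linear[OF u] l] by (simp add: curvature_mult_eq)

text \<open>Counting each principal curvature with its multiplicity is summing over an eigenbasis.\<close>

lemma curvature_roots_iff:
  "s \<in> curvature_roots flat \<phi> \<nu> u \<longleftrightarrow> s \<notin> l ` E \<and> (\<Sum>e\<in>E. (l e * s + 1) / (s - l e)) = 0"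
  using weighted_poly_root_iff[OF _ curvature_mult_pos, where s=s] finite_orthonormal[OF first_form_pos[OF u] E]
    sum_curvature_mult[of "\<lambda>k. (k * s + 1) / (s - k)"]
  by (simp add: curvature_roots_def curvature_poly_eq cot_sum_def)

lemma sphere_mean_curvature_eq: "sphere_mean_curvature flat \<phi> u = 0 \<longleftrightarrow> (\<Sum>e\<in>E. l e) = 0"
proof -
  have a: "ambient_form (\<bullet>) sphere_tangent (\<phi> u)"
    by (rule ambient_form_sphere) (simp add: unit_sphere_def \<phi>_unit[OF u])
  have D: "linear (diff1 flat \<phi> u)" "range (diff1 flat \<phi> u) \<subseteq> sphere_tangent (\<phi> u)"
    using d\<phi>_linear[OF u] d\<phi>_\<phi>[OF u] by (auto simp: diff1_flat[abs_def] sphere_tangent_def)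
  have g: "pos_metric (induced_metric (\<bullet>) flat \<phi> u)" using first_form_pos[OF u] by (simp add: first_form_induced)
  let ?H = "sphere_mean_curvature flat \<phi> u"
  have n: "\<nu> u \<in> normal_space (\<bullet>) sphere_tangent flat \<phi> u"
    using \<nu>_\<phi>[OF u] \<nu>_d\<phi>[OF u] by (simp add: normal_space_def sphere_tangent_def diff1_flat)
  have q: "bilinear (\<lambda>X Y. first_form u (A u X) Y)"
    using linear_bilinear_right[OF pos_metric_bilinear[OF first_form_pos[OF u] E]]
      linear_compose[OF A_linear[OF u] linear_bilinear_left[OF pos_metric_bilinear[OF first_form_pos[OF u] E]]]
    by (simp add: bilinear_def o_def)
  have "?H \<bullet> \<nu> u = metric_trace (first_form u) (\<lambda>X Y. fder (\<lambda>w. fder \<phi> w Y) u X \<bullet> \<nu> u)"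
    using mean_curvature_pairing[OF a D g n] by (simp add: first_form_induced diff2_flat)
  also have "\<dots> = metric_trace (first_form u) (\<lambda>X Y. first_form u (A u X) Y)"
    by (simp add: second_form[OF u] inner_commute)
  also have "\<dots> = (\<Sum>e\<in>E. first_form u (A u e) e)" by (rule metric_trace_eq[OF first_form_pos[OF u] E q])
  also have "\<dots> = (\<Sum>e\<in>E. l e)"
    using eigen_coordinate[OF first_form_pos[OF u] E A_linear[OF u] l] orthonormal_pairing[OF first_form_pos[OF u] E] by (intro sum.cong) auto
  finally have 1: "?H \<bullet> \<nu> u = (\<Sum>e\<in>E. l e)" .
  have Hn: "?H \<in> normal_space (\<bullet>) sphere_tangent flat \<phi> u" by (rule mean_curvature_normal[OF a D g])
  have "?H - (?H \<bullet> \<nu> u) *\<^sub>R \<nu> u = 0"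
    by (rule frame_zero[OF u])
      (use Hn in \<open>auto simp: normal_space_def sphere_tangent_def diff1_flat inner_diff_left \<nu>_\<phi>[OF u] \<nu>_unit[OF u] \<nu>_d\<phi>[OF u]\<close>)
  then show ?thesis using 1 by auto
qed

lemma eigenbasis_nonempty: "E \<noteq> {}"
  using card_orthonormal[OF first_form_pos[OF u] E] DIM_positive[where 'a='e] by auto

lemma finite_eigenbasis: "finite E"
  by (rule finite_orthonormal[OF first_form_pos[OF u] E])

end

lemma curvature_roots_count:
  assumes u: "u \<in> U"
  shows "finite (curvature_roots flat \<phi> \<nu> u)"
    and "card (curvature_roots flat \<phi> \<nu> u) = (if sphere_mean_curvature flat \<phi> u = 0
         then card (principal_curvatures flat \<phi> \<nu> u) - 1 else card (principal_curvatures flat \<phi> \<nu> u))"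
proof -
  obtain E l where E: "orthonormal_basis (first_form u) E" and l: "\<And>e. e \<in> E \<Longrightarrow> A u e = l e *\<^sub>R e"
    using eigenbasis[OF u] by blast
  note * = u E l
  have f: "finite (l ` E)" "l ` E \<noteq> {}" using finite_eigenbasis[OF *] eigenbasis_nonempty[OF *] by auto
  note c = card_weighted_poly_roots[OF f curvature_mult_pos[OF *]]
  show "finite (curvature_roots flat \<phi> \<nu> u)"
    using c(1) by (simp add: curvature_roots_def curvature_poly_eq[OF *])
  show "card (curvature_roots flat \<phi> \<nu> u) = (if sphere_mean_curvature flat \<phi> u = 0
         then card (principal_curvatures flat \<phi> \<nu> u) - 1 else card (principal_curvatures flat \<phi> \<nu> u))"
    using c(2) sum_curvature_mult[OF *, of "\<lambda>k. k"]
    by (simp add: curvature_roots_def curvature_poly_eq[OF *] sphere_mean_curvature_eq[OF *] principal_curvatures_eq[OF *])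
qed

end

section \<open>Roots of the polynomial as functions of the point\<close>

context hypersurface
begin

text \<open>The pairs for which \<open>s - A\<close> is invertible. They form an open set that contains the graph of every root.\<close>

definition regular_pairs :: "('e \<times> real) set" where
  "regular_pairs = {p \<in> U \<times> UNIV. inj (\<lambda>X. snd p *\<^sub>R X - A (fst p) X)}"

definition resolvent :: "'e \<Rightarrow> 'e \<times> real \<Rightarrow> 'e" where
  "resolvent b p = inv (\<lambda>X. snd p *\<^sub>R X - A (fst p) X) b"

text \<open>This is \<open>tr ((s A + 1) (s - A)\<^sup>-\<^sup>1)\<close>, by \<open>s A + 1 = (s\<^sup>2 + 1) - s (s - A)\<close>. The trace avoids the
  individual principal curvatures, which need not be differentiable.\<close>

definition root_equation :: "'e \<times> real \<Rightarrow> real" where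
  "root_equation p = - real DIM('e) * snd p + ((snd p)\<^sup>2 + 1) * (\<Sum>b\<in>Basis. b \<bullet> resolvent b p)"

lemma open_U_UNIV: "open (U \<times> (UNIV :: real set))"
  using U by (simp add: open_Times)

lemma pencil_linear: "p \<in> U \<times> UNIV \<Longrightarrow> linear (\<lambda>X. snd p *\<^sub>R X - A (fst p) X)"
  by (intro linear_compose_sub linear_scale_self A_linear) auto

lemma pencil_Ck: "Ck_on 2 (U \<times> UNIV) (\<lambda>p :: 'e \<times> real. snd p *\<^sub>R X - A (fst p) X)"
  by (intro Ck_on_diff Ck_on_scaleR Ck_on_const open_U_UNIV Ck_on_snd Ck_on_ident
      Ck_on_compose[OF open_U_UNIV Ck_on_fst[OF open_U_UNIV Ck_on_ident[OF open_U_UNIV]] A_Ck]) auto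

lemma open_regular_pairs: "open regular_pairs"
  unfolding regular_pairs_def
  by (rule open_linear_family_inj[OF open_U_UNIV pencil_linear Ck_on_continuous[OF pencil_Ck]])

lemma resolvent_eq:
  assumes "p \<in> regular_pairs"
  shows "snd p *\<^sub>R resolvent b p - A (fst p) (resolvent b p) = b"
proof -
  have "surj (\<lambda>X. snd p *\<^sub>R X - A (fst p) X)"
    using assms by (intro linear_inj_imp_surj pencil_linear) (auto simp: regular_pairs_def)
  from surj_f_inv_f[OF this, of b] show ?thesis by (simp add: resolvent_def)
qed

lemma resolvent_Ck: "Ck_on 2 regular_pairs (resolvent b)"
proof (rule linear_system_Ck[where G="\<lambda>p X. snd p *\<^sub>R X - A (fst p) X" and y="resolvent b",
      OF open_regular_pairs _ _ _ Ck_on_const resolvent_eq])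
  show "linear (\<lambda>X. snd p *\<^sub>R X - A (fst p) X)" if "p \<in> regular_pairs" for p
    using that by (intro pencil_linear) (simp add: regular_pairs_def)
  show "Ck_on 2 regular_pairs (\<lambda>p. snd p *\<^sub>R z - A (fst p) z)" for z
    by (rule Ck_on_subset[OF _ pencil_Ck]) (auto simp: regular_pairs_def)
qed (simp add: regular_pairs_def)

lemma root_equation_Ck: "Ck_on 2 regular_pairs root_equation"
  unfolding root_equation_def power2_eq_square
  by (intro Ck_on_add Ck_on_mult Ck_on_const Ck_on_sum Ck_on_inner open_regular_pairs resolvent_Ck
      Ck_on_snd Ck_on_ident)

context
  fixes u E l
  assumes u: "u \<in> U" and E: "orthonormal_basis (first_form u) E" and l: "\<And>e. e \<in> E \<Longrightarrow> A u e = l e *\<^sub>R e"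
begin

lemma regular_pair_iff: "(u, s) \<in> regular_pairs \<longleftrightarrow> s \<notin> l ` E"
  using inj_scale_minus[OF first_form_pos[OF u] E A_linear[OF u] l] u by (simp add: regular_pairs_def)

lemma root_equation_eq:
  assumes s: "(u, s) \<in> regular_pairs"
  shows "root_equation (u, s) = (\<Sum>e\<in>E. (l e * s + 1) / (s - l e))"
proof -
  note g = first_form_pos[OF u] and sl = s[unfolded regular_pair_iff]
  let ?f = "\<lambda>X. s *\<^sub>R X - A u X" and ?T = "\<lambda>b. resolvent b (u, s)"
  have f: "linear ?f" using pencil_linear[of "(u, s)"] u by simp
  have i: "inj ?f" using s by (simp add: regular_pairs_def)
  have fT: "?f (?T b) = b" for b using resolvent_eq[OF s] by simp
  have "linear ?T"
    by (rule linearI; rule injD[OF i]) (simp_all only: fT linear_add[OF f] linear_scale[OF f])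
  then have "(\<Sum>b\<in>Basis. b \<bullet> ?T b) = (\<Sum>e\<in>E. first_form u (?T e) e)" by (rule trace_endomorphism[OF g E])
  also have "\<dots> = (\<Sum>e\<in>E. 1 / (s - l e))"
  proof (rule sum.cong[OF refl])
    fix e assume e: "e \<in> E"
    then have ne: "s - l e \<noteq> 0" using sl by auto
    have "?f ((1 / (s - l e)) *\<^sub>R e) = (1 / (s - l e)) *\<^sub>R ?f e" by (rule linear_scale[OF f])
    also have "?f e = (s - l e) *\<^sub>R e" using l[OF e] by (simp add: scaleR_diff_left)
    also have "(1 / (s - l e)) *\<^sub>R \<dots> = e" using ne by simp
    finally have fe: "?f ((1 / (s - l e)) *\<^sub>R e) = e" .
    have "?T e = (1 / (s - l e)) *\<^sub>R e" by (rule injD[OF i]) (simp only: fT fe)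
    then show "first_form u (?T e) e = 1 / (s - l e)"
      using orthonormal_pairing[OF g E e e] by (simp add: bilinear_lmul[OF pos_metric_bilinear[OF g E]])
  qed
  finally have "root_equation (u, s) = (\<Sum>e\<in>E. - s + (s\<^sup>2 + 1) * (1 / (s - l e)))"
    by (simp add: root_equation_def sum_subtractf sum_distrib_left card_orthonormal[OF g E])
  also have "\<dots> = (\<Sum>e\<in>E. (l e * s + 1) / (s - l e))"
  proof (rule sum.cong[OF refl])
    fix e assume "e \<in> E"
    then have "s - l e \<noteq> 0" using sl by auto
    then show "- s + (s\<^sup>2 + 1) * (1 / (s - l e)) = (l e * s + 1) / (s - l e)"
      by (simp add: field_simps power2_eq_square)
  qed
  finally show ?thesis .
qed

lemma root_equation_deriv:
  assumes s: "(u, s) \<in> regular_pairs"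
  obtains c where "c < 0" "((\<lambda>t. root_equation (u, t)) has_real_derivative c) (at s)"
proof -
  define c where "c = (\<Sum>e\<in>E. - (((l e)\<^sup>2 + 1) / (s - l e)\<^sup>2))"
  have ne: "s - l e \<noteq> 0" if "e \<in> E" for e using s that unfolding regular_pair_iff by auto
  have "(\<Sum>e\<in>E. ((l e)\<^sup>2 + 1) / (s - l e)\<^sup>2) > 0"
  proof (rule sum_pos[OF finite_eigenbasis[OF u E l] eigenbasis_nonempty[OF u E l]])
    fix e assume "e \<in> E"
    moreover have "(l e)\<^sup>2 + 1 > 0" by (smt (verit) zero_le_power2)
    ultimately show "((l e)\<^sup>2 + 1) / (s - l e)\<^sup>2 > 0" using ne by simp
  qed
  then have "c < 0" by (simp add: c_def sum_negf)
  have d: "((\<lambda>t. (k * t + 1) / (t - k)) has_real_derivative - ((k\<^sup>2 + 1) / (s - k)\<^sup>2)) (at s)" if "s - k \<noteq> 0" for k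
  proof -
    have "((\<lambda>t. k * t + 1) has_real_derivative k) (at s)" "((\<lambda>t. t - k) has_real_derivative 1) (at s)"
      by (auto intro!: derivative_eq_intros)
    from DERIV_divide[OF this that]
    have "((\<lambda>t. (k * t + 1) / (t - k)) has_real_derivative
      (k * (s - k) - (k * s + 1) * 1) / ((s - k) * (s - k))) (at s)" .
    moreover have "k * (s - k) - (k * s + 1) * 1 = - (k\<^sup>2 + 1)" by (simp add: algebra_simps power2_eq_square)
    ultimately show ?thesis by (simp only: power2_eq_square[of "s - k"] minus_divide_left)
  qed
  have d': "((\<lambda>t. \<Sum>e\<in>E. (l e * t + 1) / (t - l e)) has_real_derivative c) (at s)"
    unfolding c_def by (intro DERIV_sum d ne)
  have o: "open {t. (u, t) \<in> regular_pairs}"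
    using open_vimage[OF open_regular_pairs, of "\<lambda>t. (u, t)"] by (simp add: vimage_def continuous_intros)
  have "((\<lambda>t. root_equation (u, t)) has_real_derivative c) (at s)"
    by (rule has_field_derivative_transform_within_open[OF d' o]) (use s in \<open>auto simp: root_equation_eq\<close>)
  then show thesis using that \<open>c < 0\<close> by blast
qed

end

lemma curvature_roots_iff_root_equation:
  assumes u: "u \<in> U"
  shows "s \<in> curvature_roots flat \<phi> \<nu> u \<longleftrightarrow> (u, s) \<in> regular_pairs \<and> root_equation (u, s) = 0"
proof -
  obtain E l where E: "orthonormal_basis (first_form u) E" and l: "\<And>e. e \<in> E \<Longrightarrow> A u e = l e *\<^sub>R e"
    using eigenbasis[OF u] by blast
  show ?thesis
    using curvature_roots_iff[OF u E l, of s] regular_pair_iff[OF u E l, of s] root_equation_eq[OF u E l, of s]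
    by auto
qed

lemma root_equation_decreasing:
  assumes "(u, s) \<in> regular_pairs"
  obtains c where "c < 0" "((\<lambda>t. root_equation (u, t)) has_real_derivative c) (at s)"
proof -
  have u: "u \<in> U" using assms by (simp add: regular_pairs_def)
  obtain E l where "orthonormal_basis (first_form u) E" "\<And>e. e \<in> E \<Longrightarrow> A u e = l e *\<^sub>R e"
    using eigenbasis[OF u] by blast
  from root_equation_deriv[OF u this assms] that show thesis by blast
qed

text \<open>The implicit function theorem for \<open>root_equation\<close>, whose derivative in \<open>s\<close> is negative.\<close>

lemma root_function_Ck:
  assumes s: "continuous_on U s" and root: "\<And>u. u \<in> U \<Longrightarrow> s u \<in> curvature_roots flat \<phi> \<nu> u"
  shows "Ck_on 2 U s"
proof -
  have r: "(u, s u) \<in> regular_pairs" "root_equation (u, s u) = 0" if "u \<in> U" for u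
    using root[OF that] curvature_roots_iff_root_equation[OF that] by auto
  have 2: "(2::nat) = Suc 1" by simp
  show ?thesis unfolding 2
  proof (rule implicit_function_Ck[OF U open_regular_pairs s root_equation_Ck[unfolded 2] r])
    fix u z assume u: "u \<in> U" and z: "fder root_equation (u, s u) (0, z) = 0"
    obtain c where c: "c < 0" "((\<lambda>t. root_equation (u, t)) has_real_derivative c) (at (s u))"
      using root_equation_decreasing[OF r(1)[OF u]] by blast
    have "((\<lambda>t. root_equation (u, t)) has_derivative (\<lambda>z. fder root_equation (u, s u) (0, z))) (at (s u))"
      by (rule has_derivative_partial_right[OF Ck_on_has_derivative[OF root_equation_Ck[unfolded 2] r(1)[OF u]]])
    from has_derivative_unique[OF this c(2)[unfolded has_field_derivative_def]]
    have "fder root_equation (u, s u) (0, z) = c * z" by metis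
    then show "z = 0" using z c(1) by simp
  qed
qed

text \<open>At a root the left side of the equation strictly decreases in \<open>s\<close>, so that it has a sign change in each
  small interval, and the sign change is stable under small changes of the point.\<close>

lemma curvature_root_persists:
  assumes u: "u \<in> U" and r: "r \<in> curvature_roots flat \<phi> \<nu> u" and \<epsilon>: "\<epsilon> > 0"
  shows "\<forall>\<^sub>F w in nhds u. \<exists>s\<in>curvature_roots flat \<phi> \<nu> w. \<bar>s - r\<bar> < \<epsilon>"
proof -
  have rp: "(u, r) \<in> regular_pairs" and r0: "root_equation (u, r) = 0"
    using r curvature_roots_iff_root_equation[OF u] by auto
  obtain d where d: "d > 0" "ball (u, r) d \<subseteq> regular_pairs"
    using open_regular_pairs rp open_contains_ball by blast
  obtain c where c: "c < 0" "((\<lambda>t. root_equation (u, t)) has_real_derivative c) (at r)"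
    using root_equation_decreasing[OF rp] by blast
  obtain d1 where d1: "d1 > 0" "\<And>h. 0 < h \<Longrightarrow> h < d1 \<Longrightarrow> root_equation (u, r + h) < 0"
    using DERIV_neg_dec_right[OF c(2,1)] r0 by auto
  obtain d2 where d2: "d2 > 0" "\<And>h. 0 < h \<Longrightarrow> h < d2 \<Longrightarrow> root_equation (u, r - h) > 0"
    using DERIV_neg_dec_left[OF c(2,1)] r0 by auto
  \<comment> \<open>so small that all pairs \<open>(w, t)\<close> with \<open>w\<close> near \<open>u\<close> and \<open>\<bar>t - r\<bar> \<le> h\<close> are regular\<close>
  define h where "h = min (min d1 d2) (min \<epsilon> (d / 2)) / 2"
  have h: "0 < h" "h < d1" "h < d2" "h < \<epsilon>" "h < d / 2" using d d1 d2 \<epsilon> by (auto simp: h_def)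
  have reg: "(w, t) \<in> regular_pairs" if "dist w u < d / 2" "\<bar>t - r\<bar> \<le> h" for w t
  proof -
    have "dist (w, t) (u, r) \<le> dist w u + dist t r"
      by (simp add: dist_Pair_Pair sqrt_sum_squares_le_sum)
    also have "\<dots> < d" using that h by (simp add: dist_real_def)
    finally show ?thesis using d by (auto simp: dist_commute)
  qed
  have c: "isCont (\<lambda>w. root_equation (w, t)) u" if "\<bar>t - r\<bar> \<le> h" for t
  proof -
    have "isCont root_equation (u, t)"
      using Ck_on_continuous[OF root_equation_Ck] reg[OF _ that, of u] d(1)
      by (simp add: continuous_on_eq_continuous_at[OF open_regular_pairs])
    moreover have "isCont (\<lambda>w. (w, t)) u" by (intro continuous_intros)
    ultimately show ?thesis by (intro isCont_o2[of u "\<lambda>w. (w, t)" root_equation])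
  qed
  have 1: "\<forall>\<^sub>F w in nhds u. root_equation (w, r + h) < 0"
    using c[of "r + h"] d1(2)[OF h(1,2)] h(1) unfolding isCont_def tendsto_at_iff_tendsto_nhds[of "\<lambda>w. root_equation (w, r + h)"]
    by (auto dest: order_tendstoD)
  have 2: "\<forall>\<^sub>F w in nhds u. root_equation (w, r - h) > 0"
    using c[of "r - h"] d2(2)[OF h(1,3)] h(1) unfolding isCont_def tendsto_at_iff_tendsto_nhds[of "\<lambda>w. root_equation (w, r - h)"]
    by (auto dest: order_tendstoD)
  have 3: "\<forall>\<^sub>F w in nhds u. dist w u < d / 2"
    unfolding eventually_nhds_metric using d(1) half_gt_zero by blast
  have 4: "\<forall>\<^sub>F w in nhds u. w \<in> U" using U u eventually_nhds_in_open by blast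
  from 1 2 3 4 show ?thesis
  proof eventually_elim
    case (elim w)
    have "continuous_on {r - h..r + h} (\<lambda>t. root_equation (w, t))"
      by (rule continuous_on_compose2[OF Ck_on_continuous[OF root_equation_Ck]])
        (use reg[OF elim(3)] in \<open>auto intro!: continuous_intros simp: abs_le_iff\<close>)
    from IVT2'[OF _ _ _ this, of 0] elim h obtain t where t: "r - h \<le> t" "t \<le> r + h" "root_equation (w, t) = 0"
      by auto
    then have "(w, t) \<in> regular_pairs" using reg[OF elim(3), of t] by (simp add: abs_le_iff)
    then show ?case using t h curvature_roots_iff_root_equation[OF elim(4)] by (intro bexI[of _ t]) auto
  qed
qed

end

section \<open>The map into the cylinder\<close>

lemma arccot_altdef: "arccot s = pi / 2 - arctan s"
  unfolding arccot_def
proof (rule the_equality)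
  have "cot (pi / 2 - arctan s) = tan (arctan s)"
    by (simp add: cot_def tan_def sin_diff cos_diff)
  then show "0 < pi / 2 - arctan s \<and> pi / 2 - arctan s < pi \<and> cot (pi / 2 - arctan s) = s"
    using arctan_bounded[of s] by (simp add: tan_arctan)
  fix t :: real assume t: "0 < t \<and> t < pi \<and> cot t = s"
  have "tan (pi / 2 - t) = s" using t by (simp add: cot_def tan_def sin_diff cos_diff)
  then have "arctan s = pi / 2 - t" using t by (intro arctan_unique) auto
  then show "t = pi / 2 - arctan s" by simp
qed

lemma arccot: "0 < arccot s" "arccot s < pi" "cot (arccot s) = s"
proof -
  show "0 < arccot s" "arccot s < pi" using arctan_bounded[of s] by (auto simp: arccot_altdef)
  have "cot (pi / 2 - arctan s) = tan (arctan s)"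
    by (simp add: cot_def tan_def sin_diff cos_diff)
  then show "cot (arccot s) = s" by (simp add: arccot_altdef tan_arctan)
qed

lemma arccot_cot: "0 < t \<Longrightarrow> t < pi \<Longrightarrow> arccot (cot t) = t"
proof -
  assume t: "0 < t" "t < pi"
  have "tan (pi / 2 - t) = cot t" by (simp add: cot_def tan_def sin_diff cos_diff)
  then have "arctan (cot t) = pi / 2 - t" using t by (intro arctan_unique) auto
  then show ?thesis by (simp add: arccot_altdef)
qed

lemma phibar_eq:
  "phibar \<phi> \<nu> s x = (cos (arccot (s x)) *\<^sub>R \<phi> x + sin (arccot (s x)) *\<^sub>R \<nu> x, arccot (s x))"
  by (simp add: phibar_def arccot_altdef sin_diff cos_diff sin_arctan cos_arctan scaleR_add_right)

text \<open>In the Lorentzian normal plane the orthogonal complement of a null line is this line.\<close>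

lemma null_pairing_collinear:
  fixes D :: "'e::euclidean_space \<Rightarrow> 'v::euclidean_space \<times> real"
  assumes D: "linear D" and dim: "DIM('v) = DIM('e) + 2"
    and pos: "\<And>X. X \<noteq> 0 \<Longrightarrow> lor (D X) (D X) > 0"
    and p: "p \<bullet> p = 1" "\<And>X. fst (D X) \<bullet> p = 0"
    and m: "m \<bullet> m = 1" "m \<bullet> p = 0" "\<And>X. m \<bullet> fst (D X) = snd (D X)"
    and w: "fst w \<bullet> p = 0" "\<And>X. lor w (D X) = 0" "lor w (m, 1) = 0"
  shows "w = snd w *\<^sub>R (m, 1)"
proof -
  have "fst w - snd w *\<^sub>R m = 0"
    by (rule null_frame_orthogonal_zero[OF D dim pos p m])
      (use w m in \<open>auto simp: lor_def inner_diff_left\<close>)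
  then show ?thesis by (simp add: prod_eq_iff)
qed

context hypersurface
begin

text \<open>Rotation of the frame \<open>(\<phi>, \<nu>)\<close> by the angle \<open>\<theta>\<close>. Up to the reparametrisation
  \<open>s = cot \<theta>\<close>, the map \<open>lift \<theta>\<close> is \<open>phibar\<close>, and \<open>(turn_normal \<theta>, 1)\<close> is a null normal of it.\<close>

definition turn :: "('e \<Rightarrow> real) \<Rightarrow> 'e \<Rightarrow> 'v" where
  "turn \<theta> u = cos (\<theta> u) *\<^sub>R \<phi> u + sin (\<theta> u) *\<^sub>R \<nu> u"

definition turn_normal :: "('e \<Rightarrow> real) \<Rightarrow> 'e \<Rightarrow> 'v" where
  "turn_normal \<theta> u = cos (\<theta> u) *\<^sub>R \<nu> u - sin (\<theta> u) *\<^sub>R \<phi> u"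

definition lift :: "('e \<Rightarrow> real) \<Rightarrow> 'e \<Rightarrow> 'v \<times> real" where
  "lift \<theta> u = (turn \<theta> u, \<theta> u)"

lemma lift_phibar: "lift (\<lambda>u. arccot (s u)) = phibar \<phi> \<nu> s"
  by (simp add: lift_def turn_def phibar_eq fun_eq_iff)

lemma lift_Ck2: "Ck_on 2 U \<theta> \<Longrightarrow> Ck_on 2 U (lift \<theta>)"
  unfolding lift_def[abs_def] turn_def
  by (intro Ck_on_Pair Ck_on_add Ck_on_scaleR Ck_on_sin Ck_on_cos U)
    (auto intro: Ck_on_mono[OF _ \<phi>_Ck] Ck_on_mono[OF _ \<nu>_Ck])

lemma turn_inner:
  assumes u: "u \<in> U"
  shows "turn \<theta> u \<bullet> turn \<theta> u = 1" "turn_normal \<theta> u \<bullet> turn_normal \<theta> u = 1"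
    "turn_normal \<theta> u \<bullet> turn \<theta> u = 0"
    "fder \<phi> u X \<bullet> turn \<theta> u = 0" "fder \<phi> u X \<bullet> turn_normal \<theta> u = 0"
proof -
  note * = \<phi>_unit[OF u] \<nu>_unit[OF u] \<nu>_\<phi>[OF u] \<nu>_d\<phi>[OF u, of X] d\<phi>_\<phi>[OF u, of X]
    inner_commute[of "\<phi> u" "\<nu> u"] inner_commute[of "fder \<phi> u X" "\<nu> u"]
  show "turn \<theta> u \<bullet> turn \<theta> u = 1" "turn_normal \<theta> u \<bullet> turn_normal \<theta> u = 1"
    using sin_cos_squared_add[of "\<theta> u"]
    by (simp_all add: turn_def turn_normal_def inner_add inner_diff * power2_eq_square)
  show "turn_normal \<theta> u \<bullet> turn \<theta> u = 0"
    "fder \<phi> u X \<bullet> turn \<theta> u = 0" "fder \<phi> u X \<bullet> turn_normal \<theta> u = 0"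
    by (simp_all add: turn_def turn_normal_def inner_add inner_diff *)
qed

lemma turn_der:
  assumes u: "u \<in> U" and t: "(\<theta> has_derivative \<theta>') (at u)"
  shows "(turn \<theta> has_derivative
      (\<lambda>X. \<theta>' X *\<^sub>R turn_normal \<theta> u + fder \<phi> u (cos (\<theta> u) *\<^sub>R X - sin (\<theta> u) *\<^sub>R A u X))) (at u)"
    and "(turn_normal \<theta> has_derivative
      (\<lambda>X. - \<theta>' X *\<^sub>R turn \<theta> u - fder \<phi> u (sin (\<theta> u) *\<^sub>R X + cos (\<theta> u) *\<^sub>R A u X))) (at u)"
proof -
  note l = linear_add[OF d\<phi>_linear[OF u]] linear_diff[OF d\<phi>_linear[OF u]] linear_scale[OF d\<phi>_linear[OF u]] d\<nu>_eq[OF u]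
  have c: "((\<lambda>u. cos (\<theta> u)) has_derivative (\<lambda>X. - sin (\<theta> u) * \<theta>' X)) (at u)"
    and s: "((\<lambda>u. sin (\<theta> u)) has_derivative (\<lambda>X. cos (\<theta> u) * \<theta>' X)) (at u)"
    using t by (auto intro!: derivative_eq_intros simp: mult.commute)
  have "(turn \<theta> has_derivative (\<lambda>X. (cos (\<theta> u) *\<^sub>R fder \<phi> u X + (- sin (\<theta> u) * \<theta>' X) *\<^sub>R \<phi> u)
     + (sin (\<theta> u) *\<^sub>R fder \<nu> u X + (cos (\<theta> u) * \<theta>' X) *\<^sub>R \<nu> u))) (at u)"
    unfolding turn_def[abs_def] by (intro has_derivative_add has_derivative_scaleR c s \<phi>_der \<nu>_der u)
  then show "(turn \<theta> has_derivative
      (\<lambda>X. \<theta>' X *\<^sub>R turn_normal \<theta> u + fder \<phi> u (cos (\<theta> u) *\<^sub>R X - sin (\<theta> u) *\<^sub>R A u X))) (at u)"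
    by (simp add: l turn_normal_def algebra_simps)
  have "(turn_normal \<theta> has_derivative (\<lambda>X. (cos (\<theta> u) *\<^sub>R fder \<nu> u X + (- sin (\<theta> u) * \<theta>' X) *\<^sub>R \<nu> u)
     - (sin (\<theta> u) *\<^sub>R fder \<phi> u X + (cos (\<theta> u) * \<theta>' X) *\<^sub>R \<phi> u))) (at u)"
    unfolding turn_normal_def[abs_def] by (intro has_derivative_diff has_derivative_scaleR c s \<phi>_der \<nu>_der u)
  then show "(turn_normal \<theta> has_derivative
      (\<lambda>X. - \<theta>' X *\<^sub>R turn \<theta> u - fder \<phi> u (sin (\<theta> u) *\<^sub>R X + cos (\<theta> u) *\<^sub>R A u X))) (at u)"
    by (simp add: l turn_def algebra_simps)
qed

text \<open>The tangential part of the derivative of \<open>lift \<theta>\<close>, equal to \<open>sin \<theta> (cot \<theta> - A)\<close>.\<close>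

definition stretch :: "('e \<Rightarrow> real) \<Rightarrow> 'e \<Rightarrow> 'e \<Rightarrow> 'e" where
  "stretch \<theta> u X = cos (\<theta> u) *\<^sub>R X - sin (\<theta> u) *\<^sub>R A u X"

lemma lift_fder:
  assumes u: "u \<in> U" and t: "\<theta> differentiable at u"
  shows "(lift \<theta> has_derivative (\<lambda>X. (fder \<theta> u X *\<^sub>R turn_normal \<theta> u + fder \<phi> u (stretch \<theta> u X), fder \<theta> u X))) (at u)"
    and "fder (lift \<theta>) u X = (fder \<theta> u X *\<^sub>R turn_normal \<theta> u + fder \<phi> u (stretch \<theta> u X), fder \<theta> u X)"
proof -
  have t: "(\<theta> has_derivative fder \<theta> u) (at u)" using t frechet_derivative_works by blast
  show "(lift \<theta> has_derivative (\<lambda>X. (fder \<theta> u X *\<^sub>R turn_normal \<theta> u + fder \<phi> u (stretch \<theta> u X), fder \<theta> u X))) (at u)"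
    unfolding lift_def[abs_def] stretch_def by (intro has_derivative_Pair turn_der u t)
  then show "fder (lift \<theta>) u X = (fder \<theta> u X *\<^sub>R turn_normal \<theta> u + fder \<phi> u (stretch \<theta> u X), fder \<theta> u X)"
    by (rule fder_eqI)
qed

text \<open>The component along \<open>turn_normal\<close> and the height have the same derivative; their contributions to the
  Lorentzian metric cancel.\<close>

lemma lift_metric:
  assumes u: "u \<in> U" and t: "\<theta> differentiable at u"
  shows "lor (fder (lift \<theta>) u X) (fder (lift \<theta>) u Y) = first_form u (stretch \<theta> u X) (stretch \<theta> u Y)"
  by (simp add: lift_fder[OF u t] lor_def first_form_def inner_add turn_inner[OF u]
    inner_commute[of "turn_normal \<theta> u" "fder \<phi> u _"])

lemma lift_normal:
  assumes u: "u \<in> U" and t: "\<theta> differentiable at u"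
  shows "turn_normal \<theta> u \<bullet> fst (fder (lift \<theta>) u X) = snd (fder (lift \<theta>) u X)"
  by (simp add: lift_fder[OF u t] inner_add turn_inner[OF u]
    inner_commute[of "turn_normal \<theta> u" "fder \<phi> u _"])

lemma lift_tangent:
  assumes u: "u \<in> U" and t: "\<theta> differentiable at u"
  shows "fst (fder (lift \<theta>) u X) \<bullet> turn \<theta> u = 0"
  by (simp add: lift_fder[OF u t] inner_add turn_inner[OF u])

lemma stretch_linear: "u \<in> U \<Longrightarrow> linear (stretch \<theta> u)"
  unfolding stretch_def[abs_def]
  by (rule linearI) (auto simp: linear_add[OF A_linear] linear_scale[OF A_linear] algebra_simps)

text \<open>Obtained by differentiating the orthogonality of the derivative of \<open>lift \<theta>\<close> and the null normal, so
  that no second derivative has to be computed.\<close>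

lemma lift_second_derivative:
  assumes t: "Ck_on 2 U \<theta>" and u: "u \<in> U"
  shows "lor (fder (\<lambda>w. fder (lift \<theta>) w Y) u X) (turn_normal \<theta> u, 1)
    = first_form u (stretch \<theta> u Y) (sin (\<theta> u) *\<^sub>R X + cos (\<theta> u) *\<^sub>R A u X)"
proof -
  have t2: "Ck_on (Suc (Suc 0)) U \<theta>" using t by (simp add: numeral_2_eq_2)
  have dt: "\<theta> differentiable at w" if "w \<in> U" for w using t2 that by simp
  have dd: "((\<lambda>w. fder (lift \<theta>) w Y) has_derivative fder (\<lambda>w. fder (lift \<theta>) w Y) u) (at u)"
    by (rule Ck_on_has_derivative[OF Ck_on_fder[OF lift_Ck2[OF t, unfolded numeral_2_eq_2]] u])
  have tu: "(\<theta> has_derivative fder \<theta> u) (at u)" using dt[OF u] frechet_derivative_works by blast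
  let ?m' = "\<lambda>X. - fder \<theta> u X *\<^sub>R turn \<theta> u - fder \<phi> u (sin (\<theta> u) *\<^sub>R X + cos (\<theta> u) *\<^sub>R A u X)"
  have "((\<lambda>w. lor (fder (lift \<theta>) w Y) (turn_normal \<theta> w, 1)) has_derivative
     (\<lambda>X. lor (fder (lift \<theta>) u Y) (?m' X, 0) + lor (fder (\<lambda>w. fder (lift \<theta>) w Y) u X) (turn_normal \<theta> u, 1))) (at u)"
    by (intro bounded_bilinear.FDERIV[OF bounded_bilinear_lor] dd has_derivative_Pair turn_der[OF u tu] has_derivative_const)
  then have "lor (fder (lift \<theta>) u Y) (?m' X, 0) + lor (fder (\<lambda>w. fder (lift \<theta>) w Y) u X) (turn_normal \<theta> u, 1) = 0"
    by (rule derivative_of_constant[OF U u, where c="0::real"]) (use lift_normal dt in \<open>simp add: lor_def inner_commute\<close>)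
  then have "lor (fder (\<lambda>w. fder (lift \<theta>) w Y) u X) (turn_normal \<theta> u, 1) = - lor (fder (lift \<theta>) u Y) (?m' X, 0)"
    by simp
  also have "\<dots> = first_form u (stretch \<theta> u Y) (sin (\<theta> u) *\<^sub>R X + cos (\<theta> u) *\<^sub>R A u X)"
    by (simp add: lor_def lift_fder[OF u dt[OF u]] inner_add inner_diff turn_inner[OF u] first_form_def
      inner_commute[of "turn_normal \<theta> u" "fder \<phi> u _"])
  finally show ?thesis .
qed

lemma stretch_cot:
  assumes "sin (\<theta> u) \<noteq> 0"
  shows "stretch \<theta> u X = sin (\<theta> u) *\<^sub>R (cot (\<theta> u) *\<^sub>R X - A u X)"
  using assms by (simp add: stretch_def cot_def scaleR_diff_right)

lemma inj_stretch_iff: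
  assumes u: "u \<in> U" and s: "sin (\<theta> u) \<noteq> 0"
  shows "inj (stretch \<theta> u) \<longleftrightarrow> (u, cot (\<theta> u)) \<in> regular_pairs"
  using u s by (simp add: regular_pairs_def inj_def stretch_cot[of \<theta> u, OF s])

lemma lift_pos_metric:
  assumes u: "u \<in> U" and t: "\<theta> differentiable at u" and inj: "inj (stretch \<theta> u)"
  shows "pos_metric (induced_metric lor flat (lift \<theta>) u)"
proof -
  have "bij (stretch \<theta> u)" using inj linear_inj_imp_surj[OF stretch_linear[OF u]] by (simp add: bij_def)
  from metric_trace_pullback(1)[OF first_form_pos[OF u] bilinear_inner stretch_linear[OF u] this]
  show ?thesis by (simp add: induced_metric_def[abs_def] diff1_flat lift_metric[OF u t])
qed

text \<open>Both the metric and the second fundamental form come from \<open>g\<close> through \<open>stretch\<close>, which is diagonal in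
  an eigenbasis of the shape operator; each eigenvector contributes
  \<open>(sin \<theta> + l cos \<theta>) / (cos \<theta> - l sin \<theta>)\<close>.\<close>

lemma lift_mean_curvature_trace:
  assumes t: "Ck_on 2 U \<theta>" and u: "u \<in> U" and s: "sin (\<theta> u) \<noteq> 0" and inj: "inj (stretch \<theta> u)"
    and E: "orthonormal_basis (first_form u) E" and l: "\<And>e. e \<in> E \<Longrightarrow> A u e = l e *\<^sub>R e"
  shows "metric_trace (induced_metric lor flat (lift \<theta>) u)
      (\<lambda>X Y. lor (diff2 flat (lift \<theta>) u X Y) (turn_normal \<theta> u, 1))
    = (\<Sum>e\<in>E. (l e * cot (\<theta> u) + 1) / (cot (\<theta> u) - l e))"
proof -
  note g = first_form_pos[OF u] and b = pos_metric_bilinear[OF first_form_pos[OF u] E]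
  have dt: "\<theta> differentiable at u" using t u by (simp add: numeral_2_eq_2)
  let ?S = "stretch \<theta> u"
  obtain R where R: "linear R" "R \<circ> ?S = id"
    using linear_injective_left_inverse[OF stretch_linear[OF u] inj] by blast
  have RS: "R (?S X) = X" for X using R(2) by (metis comp_apply id_apply)
  let ?w = "\<lambda>X. sin (\<theta> u) *\<^sub>R X + cos (\<theta> u) *\<^sub>R A u X"
  have w: "linear ?w"
    by (rule linearI) (auto simp: linear_add[OF A_linear[OF u]] linear_scale[OF A_linear[OF u]] algebra_simps)
  define q where "q X Y = first_form u Y (?w (R X))" for X Y
  have q: "bilinear q"
    unfolding bilinear_def q_def
    using linear_compose[OF R(1) linear_compose[OF w linear_bilinear_right[OF b]]] linear_bilinear_left[OF b]
    by (simp add: o_def)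
  have bij: "bij ?S" using inj linear_inj_imp_surj[OF stretch_linear[OF u]] by (simp add: bij_def)
  have "metric_trace (induced_metric lor flat (lift \<theta>) u)
      (\<lambda>X Y. lor (diff2 flat (lift \<theta>) u X Y) (turn_normal \<theta> u, 1))
    = metric_trace (\<lambda>X Y. first_form u (?S X) (?S Y)) (\<lambda>X Y. q (?S X) (?S Y))"
    by (simp add: induced_metric_def[abs_def] diff1_flat diff2_flat lift_metric[OF u dt]
      lift_second_derivative[OF t u] q_def RS)
  also have "\<dots> = metric_trace (first_form u) q" by (rule metric_trace_pullback(2)[OF g q stretch_linear[OF u] bij])
  also have "\<dots> = (\<Sum>e\<in>E. q e e)" by (rule metric_trace_eq[OF g E q])
  also have "\<dots> = (\<Sum>e\<in>E. (l e * cot (\<theta> u) + 1) / (cot (\<theta> u) - l e))"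
  proof (rule sum.cong[OF refl])
    fix e assume e: "e \<in> E"
    define \<beta> where "\<beta> = cos (\<theta> u) - sin (\<theta> u) * l e"
    have Se: "?S e = \<beta> *\<^sub>R e" by (simp add: stretch_def l[OF e] \<beta>_def algebra_simps)
    have "e \<noteq> 0" using orthonormal_pairing[OF g E e e] bilinear_lzero[OF b] by fastforce
    then have "?S e \<noteq> 0" using inj linear_injective_0[OF stretch_linear[OF u]] by blast
    then have \<beta>: "\<beta> \<noteq> 0" using Se by auto
    have "R e = (1 / \<beta>) *\<^sub>R R (?S e)" unfolding Se using \<beta> by (simp add: linear_scale[OF R(1)])
    then have "R e = (1 / \<beta>) *\<^sub>R e" by (simp add: RS)
    then have "?w (R e) = ((sin (\<theta> u) + cos (\<theta> u) * l e) / \<beta>) *\<^sub>R e"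
      by (simp add: linear_scale[OF A_linear[OF u]] l[OF e] algebra_simps add_divide_distrib)
    then have "q e e = (sin (\<theta> u) + cos (\<theta> u) * l e) / \<beta>"
      using orthonormal_pairing[OF g E e e] by (simp add: q_def bilinear_rmul[OF b])
    also have "\<dots> = (sin (\<theta> u) * (l e * cot (\<theta> u) + 1)) / (sin (\<theta> u) * (cot (\<theta> u) - l e))"
      using s by (simp add: \<beta>_def cot_def algebra_simps)
    also have "\<dots> = (l e * cot (\<theta> u) + 1) / (cot (\<theta> u) - l e)" using s by simp
    finally show "q e e = (l e * cot (\<theta> u) + 1) / (cot (\<theta> u) - l e)" .
  qed
  finally show ?thesis .
qed

lemma lift_ambient:
  assumes u: "u \<in> U" and t: "\<theta> differentiable at u"
  shows "ambient_form lor cylinder_tangent (lift \<theta> u)" "linear (diff1 flat (lift \<theta>) u)"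
    "range (diff1 flat (lift \<theta>) u) \<subseteq> cylinder_tangent (lift \<theta> u)"
    "(turn_normal \<theta> u, 1) \<in> normal_space lor cylinder_tangent flat (lift \<theta>) u"
proof -
  show "ambient_form lor cylinder_tangent (lift \<theta> u)"
    by (rule ambient_form_cylinder) (simp add: cylinder_def lift_def unit_sphere_def turn_inner[OF u])
  have "(lift \<theta> has_derivative fder (lift \<theta>) u) (at u)"
    using lift_fder(1)[OF u t] by (simp add: lift_fder(2)[OF u t, abs_def])
  then show "linear (diff1 flat (lift \<theta>) u)"
    using has_derivative_linear by (simp add: diff1_flat[abs_def])
  show "range (diff1 flat (lift \<theta>) u) \<subseteq> cylinder_tangent (lift \<theta> u)"
    by (rule image_subsetI) (simp add: cylinder_tangent_def sphere_tangent_def diff1_flat mem_Times_iff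
      lift_tangent[OF u t], simp add: lift_def lift_tangent[OF u t])
  show "(turn_normal \<theta> u, 1) \<in> normal_space lor cylinder_tangent flat (lift \<theta>) u"
    using lift_normal[OF u t] turn_inner[OF u]
    by (auto simp: normal_space_def cylinder_tangent_def sphere_tangent_def diff1_flat lift_def lor_def)
qed

lemma lift_mean_curvature_null_iff:
  assumes t: "Ck_on 2 U \<theta>" and u: "u \<in> U" and s: "sin (\<theta> u) \<noteq> 0" and inj: "inj (stretch \<theta> u)"
  shows "lor (cyl_mean_curvature flat (lift \<theta>) u) (turn_normal \<theta> u, 1) = 0
    \<longleftrightarrow> cot (\<theta> u) \<in> curvature_roots flat \<phi> \<nu> u"
proof -
  have dt: "\<theta> differentiable at u" using t u by (simp add: numeral_2_eq_2)
  obtain E l where E: "orthonormal_basis (first_form u) E" and l: "\<And>e. e \<in> E \<Longrightarrow> A u e = l e *\<^sub>R e"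
    using eigenbasis[OF u] by blast
  have "lor (cyl_mean_curvature flat (lift \<theta>) u) (turn_normal \<theta> u, 1)
    = (\<Sum>e\<in>E. (l e * cot (\<theta> u) + 1) / (cot (\<theta> u) - l e))"
    using mean_curvature_pairing[OF lift_ambient(1-3)[OF u dt] lift_pos_metric[OF u dt inj] lift_ambient(4)[OF u dt]]
      lift_mean_curvature_trace[OF t u s inj E l] by simp
  moreover have "cot (\<theta> u) \<notin> l ` E"
    using inj inj_stretch_iff[of u \<theta>, OF u s] regular_pair_iff[OF u E l] by simp
  ultimately show ?thesis using curvature_roots_iff[OF u E l] by simp
qed

lemma lift_null_mean_curvature:
  assumes u: "u \<in> U" and t: "\<theta> differentiable at u" and inj: "inj (stretch \<theta> u)"
    and H: "lor (cyl_mean_curvature flat (lift \<theta>) u) (turn_normal \<theta> u, 1) = 0"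
  shows "lor (cyl_mean_curvature flat (lift \<theta>) u) (cyl_mean_curvature flat (lift \<theta>) u) = 0"
proof -
  let ?H = "cyl_mean_curvature flat (lift \<theta>) u"
  note p = lift_pos_metric[OF u t inj]
  have n: "?H \<in> normal_space lor cylinder_tangent flat (lift \<theta>) u"
    by (rule mean_curvature_normal[OF lift_ambient(1-3)[OF u t] p])
  have "?H = snd ?H *\<^sub>R (turn_normal \<theta> u, 1)"
  proof (rule null_pairing_collinear[OF lift_ambient(2)[OF u t] dim])
    show "X \<noteq> 0 \<Longrightarrow> 0 < lor (diff1 flat (lift \<theta>) u X) (diff1 flat (lift \<theta>) u X)" for X
      using p by (auto simp: pos_metric_def induced_metric_def)
    show "turn \<theta> u \<bullet> turn \<theta> u = 1" "turn_normal \<theta> u \<bullet> turn_normal \<theta> u = 1" "turn_normal \<theta> u \<bullet> turn \<theta> u = 0"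
      by (simp_all add: turn_inner[OF u])
    show "fst (diff1 flat (lift \<theta>) u X) \<bullet> turn \<theta> u = 0"
      "turn_normal \<theta> u \<bullet> fst (diff1 flat (lift \<theta>) u X) = snd (diff1 flat (lift \<theta>) u X)" for X
      by (simp_all only: diff1_flat lift_tangent[OF u t] lift_normal[OF u t])
    show "fst ?H \<bullet> turn \<theta> u = 0" "lor ?H (diff1 flat (lift \<theta>) u X) = 0" for X
      using n by (auto simp: normal_space_def cylinder_tangent_def sphere_tangent_def lift_def)
  qed (rule H)
  then obtain c where "?H = c *\<^sub>R (turn_normal \<theta> u, 1)" by blast
  then show ?thesis by (simp add: lor_def turn_inner[OF u])
qed

lemma phibar_of_root:
  assumes s: "continuous_on U s" and root: "\<And>u. u \<in> U \<Longrightarrow> s u \<in> curvature_roots flat \<phi> \<nu> u"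
  shows "Ck_on 2 U (phibar \<phi> \<nu> s)"
    and "u \<in> U \<Longrightarrow> phibar \<phi> \<nu> s u \<in> cylinder"
    and "u \<in> U \<Longrightarrow> pos_metric (induced_metric lor flat (phibar \<phi> \<nu> s) u)"
    and "u \<in> U \<Longrightarrow> inj (diff1 flat (phibar \<phi> \<nu> s) u)"
    and "u \<in> U \<Longrightarrow> lor (cyl_mean_curvature flat (phibar \<phi> \<nu> s) u) (cyl_mean_curvature flat (phibar \<phi> \<nu> s) u) = 0"
proof -
  define \<theta> where "\<theta> u = arccot (s u)" for u
  have l: "phibar \<phi> \<nu> s = lift \<theta>" unfolding \<theta>_def by (rule lift_phibar[symmetric])
  have t: "Ck_on 2 U \<theta>"
    unfolding \<theta>_def arccot_altdef by (intro Ck_on_diff Ck_on_const Ck_on_arctan U root_function_Ck[OF s root])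
  have dt: "\<theta> differentiable at u" if "u \<in> U" for u using t that by (simp add: numeral_2_eq_2)
  have sn: "sin (\<theta> u) \<noteq> 0" for u using sin_gt_zero[of "\<theta> u"] arccot by (force simp: \<theta>_def)
  have ct: "cot (\<theta> u) = s u" for u by (simp add: \<theta>_def arccot)
  have inj: "inj (stretch \<theta> u)" if "u \<in> U" for u
    using root[OF that] curvature_roots_iff_root_equation[OF that] inj_stretch_iff[where \<theta>=\<theta>, OF that sn] by (simp add: ct)
  show "Ck_on 2 U (phibar \<phi> \<nu> s)" unfolding l by (rule lift_Ck2[OF t])
  show "u \<in> U \<Longrightarrow> phibar \<phi> \<nu> s u \<in> cylinder"
    unfolding l by (simp add: cylinder_def lift_def unit_sphere_def turn_inner)
  show p: "u \<in> U \<Longrightarrow> pos_metric (induced_metric lor flat (phibar \<phi> \<nu> s) u)"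
    unfolding l by (rule lift_pos_metric[OF _ dt inj])
  show "inj (diff1 flat (phibar \<phi> \<nu> s) u)" if u: "u \<in> U"
  proof -
    have "X = 0" if "diff1 flat (lift \<theta>) u X = 0" for X
      using p[OF u] that unfolding l pos_metric_def induced_metric_def
      by (metis bilinear_lor bilinear_lzero less_irrefl)
    then show ?thesis unfolding l using linear_injective_0[OF lift_ambient(2)[OF u dt[OF u]]] by blast
  qed
  show "u \<in> U \<Longrightarrow> lor (cyl_mean_curvature flat (phibar \<phi> \<nu> s) u) (cyl_mean_curvature flat (phibar \<phi> \<nu> s) u) = 0"
    unfolding l
    by (rule lift_null_mean_curvature[OF _ dt inj]) (use lift_mean_curvature_null_iff[OF t _ sn inj] root in \<open>auto simp: ct\<close>)
qed

end

section \<open>From a null normal back to a hypersurface\<close>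

text \<open>The inverse rotation: from an immersion into the cylinder and a null normal \<open>(m, 1)\<close> to a hypersurface
  of the sphere and its Gauss map. The constant \<open>c\<close> is a translation along the axis.\<close>

definition base_of :: "real \<Rightarrow> ('m \<Rightarrow> 'v::euclidean_space \<times> real) \<Rightarrow> ('m \<Rightarrow> 'v) \<Rightarrow> 'm \<Rightarrow> 'v" where
  "base_of c f m x = cos (snd (f x) + c) *\<^sub>R fst (f x) - sin (snd (f x) + c) *\<^sub>R m x"

definition normal_of :: "real \<Rightarrow> ('m \<Rightarrow> 'v::euclidean_space \<times> real) \<Rightarrow> ('m \<Rightarrow> 'v) \<Rightarrow> 'm \<Rightarrow> 'v" where
  "normal_of c f m x = sin (snd (f x) + c) *\<^sub>R fst (f x) + cos (snd (f x) + c) *\<^sub>R m x"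

text \<open>A spacelike immersion into the cylinder with a continuous null normal \<open>(m, 1)\<close>, in one chart.\<close>

locale null_normal =
  fixes U :: "'e::euclidean_space set" and f :: "'e \<Rightarrow> 'v::euclidean_space \<times> real" and m :: "'e \<Rightarrow> 'v" and k :: nat
  assumes dim: "DIM('v) = DIM('e) + 2" and U: "open U" and f_Ck: "Ck_on (Suc (Suc k)) U f"
    and cyl: "\<And>u. u \<in> U \<Longrightarrow> fst (f u) \<bullet> fst (f u) = 1"
    and pos: "\<And>u X. u \<in> U \<Longrightarrow> X \<noteq> 0 \<Longrightarrow> lor (fder f u X) (fder f u X) > 0"
    and m_cont: "continuous_on U m" and m_unit: "\<And>u. u \<in> U \<Longrightarrow> m u \<bullet> m u = 1"
    and m_f: "\<And>u. u \<in> U \<Longrightarrow> m u \<bullet> fst (f u) = 0"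
    and m_df: "\<And>u X. u \<in> U \<Longrightarrow> m u \<bullet> fst (fder f u X) = snd (fder f u X)"
begin

lemma m_Ck: "Ck_on (Suc k) U m"
  by (rule null_normal_Ck[OF U dim f_Ck cyl pos m_cont m_unit m_f m_df])

lemma f_der: "u \<in> U \<Longrightarrow> (f has_derivative fder f u) (at u)"
  by (rule Ck_on_has_derivative[OF f_Ck])

lemma m_der: "u \<in> U \<Longrightarrow> (m has_derivative fder m u) (at u)"
  by (rule Ck_on_has_derivative[OF m_Ck])

lemma df_linear: "u \<in> U \<Longrightarrow> linear (fder f u)"
  using f_der has_derivative_linear by blast

lemma dm_linear: "u \<in> U \<Longrightarrow> linear (fder m u)"
  using m_der has_derivative_linear by blast

lemma df_f: "u \<in> U \<Longrightarrow> fst (fder f u X) \<bullet> fst (f u) = 0"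
  by (rule cylinder_tangent_derivative[OF U _ f_der cyl])

lemma dm_m: "u \<in> U \<Longrightarrow> fder m u X \<bullet> m u = 0"
  using cylinder_tangent_derivative[OF U _ has_derivative_Pair[OF m_der has_derivative_const[of 0]], of u X] m_unit
  by simp

lemma dm_f: assumes u: "u \<in> U" shows "fder m u X \<bullet> fst (f u) = - snd (fder f u X)"
proof -
  have "((\<lambda>w. m w \<bullet> fst (f w)) has_derivative (\<lambda>X. m u \<bullet> fst (fder f u X) + fder m u X \<bullet> fst (f u))) (at u)"
    by (intro has_derivative_inner has_derivative_fst f_der m_der u)
  then have "m u \<bullet> fst (fder f u X) + fder m u X \<bullet> fst (f u) = 0"
    by (rule derivative_of_constant[OF U u, where c="0::real"]) (simp add: m_f)
  then show ?thesis using m_df[OF u, of X] by simp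
qed

lemma ambient:
  assumes u: "u \<in> U"
  shows "ambient_form lor cylinder_tangent (f u)" "linear (diff1 flat f u)"
    "range (diff1 flat f u) \<subseteq> cylinder_tangent (f u)"
    "(m u, 1) \<in> normal_space lor cylinder_tangent flat f u"
    "pos_metric (induced_metric lor flat f u)"
proof -
  show "ambient_form lor cylinder_tangent (f u)"
    by (rule ambient_form_cylinder) (simp add: cylinder_def unit_sphere_def mem_Times_iff cyl[OF u])
  show "linear (diff1 flat f u)" using df_linear[OF u] by (simp add: diff1_flat[abs_def])
  show "range (diff1 flat f u) \<subseteq> cylinder_tangent (f u)"
    by (rule image_subsetI) (simp add: cylinder_tangent_def sphere_tangent_def diff1_flat mem_Times_iff df_f[OF u])
  show "(m u, 1) \<in> normal_space lor cylinder_tangent flat f u"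
    using m_f[OF u] m_df[OF u]
    by (auto simp: normal_space_def cylinder_tangent_def sphere_tangent_def diff1_flat lor_def)
  have "bilinear (\<lambda>X Y. lor (fder f u X) (fder f u Y))"
    using linear_compose[OF df_linear[OF u] linear_bilinear_left[OF bilinear_lor]]
      linear_compose[OF df_linear[OF u] linear_bilinear_right[OF bilinear_lor]]
    by (simp add: bilinear_def o_def)
  then show "pos_metric (induced_metric lor flat f u)"
    using pos[OF u] by (auto simp: pos_metric_def induced_metric_def[abs_def] diff1_flat lor_def inner_commute)
qed

text \<open>As for hypersurfaces, obtained by differentiating an orthogonality relation.\<close>

lemma second_pairing:
  assumes u: "u \<in> U"
  shows "lor (diff2 flat f u X Y) (m u, 1) = - (fst (fder f u Y) \<bullet> fder m u X)"
proof -
  have dd: "((\<lambda>w. fder f w Y) has_derivative fder (\<lambda>w. fder f w Y) u) (at u)"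
    by (rule Ck_on_has_derivative[OF Ck_on_fder[OF f_Ck] u])
  have "((\<lambda>w. lor (fder f w Y) (m w, 1)) has_derivative
     (\<lambda>X. lor (fder f u Y) (fder m u X, 0) + lor (fder (\<lambda>w. fder f w Y) u X) (m u, 1))) (at u)"
    by (intro bounded_bilinear.FDERIV[OF bounded_bilinear_lor] dd has_derivative_Pair m_der[OF u] has_derivative_const)
  then have "lor (fder f u Y) (fder m u X, 0) + lor (fder (\<lambda>w. fder f w Y) u X) (m u, 1) = 0"
    by (rule derivative_of_constant[OF U u, where c="0::real"]) (use m_df in \<open>simp add: lor_def inner_commute\<close>)
  then show ?thesis by (simp add: diff2_flat lor_def)
qed

lemma base_normal_inner:
  assumes u: "u \<in> U"
  shows "base_of c f m u \<bullet> base_of c f m u = 1" "normal_of c f m u \<bullet> normal_of c f m u = 1"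
    "normal_of c f m u \<bullet> base_of c f m u = 0"
proof -
  note * = cyl[OF u] m_unit[OF u] m_f[OF u] inner_commute[of "fst (f u)" "m u"]
  show "base_of c f m u \<bullet> base_of c f m u = 1" "normal_of c f m u \<bullet> normal_of c f m u = 1"
    using sin_cos_squared_add[of "snd (f u) + c"]
    by (simp_all add: base_of_def normal_of_def inner_add inner_diff * power2_eq_square)
  show "normal_of c f m u \<bullet> base_of c f m u = 0"
    by (simp_all add: base_of_def normal_of_def inner_add inner_diff *)
qed

lemma base_of_Ck: "Ck_on (Suc k) U (base_of c f m)"
  unfolding base_of_def[abs_def]
  by (intro Ck_on_diff Ck_on_scaleR Ck_on_sin Ck_on_cos Ck_on_add Ck_on_const Ck_on_fst Ck_on_snd U m_Ck
    Ck_on_pred[OF f_Ck])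

lemma normal_of_continuous: "continuous_on U (normal_of c f m)"
  unfolding normal_of_def[abs_def] using Ck_on_continuous[OF f_Ck] m_cont by (intro continuous_intros)

lemma base_of_fder:
  assumes u: "u \<in> U"
  shows "fder (base_of c f m) u X = cos (snd (f u) + c) *\<^sub>R fst (fder f u X) - sin (snd (f u) + c) *\<^sub>R fder m u X
     - snd (fder f u X) *\<^sub>R normal_of c f m u"
proof (rule fder_eqI)
  have t: "((\<lambda>u. snd (f u) + c) has_derivative (\<lambda>X. snd (fder f u X))) (at u)"
    using f_der[OF u] by (auto intro!: derivative_eq_intros)
  have c: "((\<lambda>u. cos (snd (f u) + c)) has_derivative (\<lambda>X. - sin (snd (f u) + c) * snd (fder f u X))) (at u)"
    and s: "((\<lambda>u. sin (snd (f u) + c)) has_derivative (\<lambda>X. cos (snd (f u) + c) * snd (fder f u X))) (at u)"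
    using has_derivative_cos[OF t] has_derivative_sin[OF t] by (simp_all add: mult.commute)
  have "(base_of c f m has_derivative (\<lambda>X. (cos (snd (f u) + c) *\<^sub>R fst (fder f u X) + (- sin (snd (f u) + c) * snd (fder f u X)) *\<^sub>R fst (f u))
     - (sin (snd (f u) + c) *\<^sub>R fder m u X + (cos (snd (f u) + c) * snd (fder f u X)) *\<^sub>R m u))) (at u)"
    unfolding base_of_def[abs_def] by (intro has_derivative_diff has_derivative_scaleR c s has_derivative_fst f_der m_der u)
  then show "(base_of c f m has_derivative (\<lambda>X. cos (snd (f u) + c) *\<^sub>R fst (fder f u X) - sin (snd (f u) + c) *\<^sub>R fder m u X
     - snd (fder f u X) *\<^sub>R normal_of c f m u)) (at u)"
    by (simp add: normal_of_def algebra_simps)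
qed

text \<open>This is where the rotation angle has to be the height, up to a constant: the derivative of the
  angle cancels against \<open>m \<bullet> d\<psi>\<close>.\<close>

lemma normal_of_dbase:
  assumes u: "u \<in> U"
  shows "normal_of c f m u \<bullet> fder (base_of c f m) u X = 0"
proof -
  define s where "s = sin (snd (f u) + c)"
  define k where "k = cos (snd (f u) + c)"
  have sk: "s * s + k * k = 1" unfolding s_def k_def using sin_cos_squared_add[of "snd (f u) + c"]
    by (simp add: power2_eq_square)
  have 1: "normal_of c f m u \<bullet> fst (fder f u X) = k * snd (fder f u X)"
    using df_f[OF u, of X] m_df[OF u, of X]
    by (simp add: normal_of_def s_def k_def inner_add_left inner_commute[of "fst (f u)" "fst (fder f u X)"])
  have 2: "normal_of c f m u \<bullet> fder m u X = - s * snd (fder f u X)"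
    using dm_f[OF u, of X] dm_m[OF u, of X]
    by (simp add: normal_of_def s_def k_def inner_add_left inner_commute[of "fst (f u)" "fder m u X"]
      inner_commute[of "m u" "fder m u X"])
  have "normal_of c f m u \<bullet> fder (base_of c f m) u X = (k * k + s * s - 1) * snd (fder f u X)"
    unfolding base_of_fder[OF u] inner_diff_right inner_scaleR_right 1 2 base_normal_inner[OF u] s_def[symmetric] k_def[symmetric]
    by (simp add: algebra_simps)
  then show ?thesis using sk by simp
qed

text \<open>For angle zero the derivative of \<open>base_of\<close> would be the projection of the derivative of \<open>f\<close> along the null
  normal, which is injective as \<open>f\<close> is spacelike. Injectivity persists for small positive angles.\<close>

lemma base_of_immersion_for_small_angle:
  assumes u: "u \<in> U"
  obtains c where "0 < snd (f u) + c" "snd (f u) + c < pi" "inj (fder (base_of c f m) u)"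
proof -
  \<comment> \<open>the derivative of \<open>base_of\<close> at \<open>u\<close> as a function of the angle \<open>t\<close> at \<open>u\<close>\<close>
  define G where "G t X = cos t *\<^sub>R fst (fder f u X) - sin t *\<^sub>R fder m u X
     - snd (fder f u X) *\<^sub>R (sin t *\<^sub>R fst (f u) + cos t *\<^sub>R m u)" for t X
  have lin: "linear (G t)" for t
    unfolding G_def by (rule linearI)
      (auto simp: linear_add[OF df_linear[OF u]] linear_scale[OF df_linear[OF u]]
        linear_add[OF dm_linear[OF u]] linear_scale[OF dm_linear[OF u]] algebra_simps)
  have "inj (G 0)"
    unfolding linear_injective_0[OF lin]
  proof (intro allI impI, rule ccontr)
    fix X assume z: "G 0 X = 0" and "X \<noteq> 0"
    from z have "fst (fder f u X) = snd (fder f u X) *\<^sub>R m u" by (simp add: G_def)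
    then have "lor (fder f u X) (fder f u X) = 0" using m_unit[OF u] by (simp add: lor_def)
    then show False using pos[OF u \<open>X \<noteq> 0\<close>] by simp
  qed
  moreover have "open {t \<in> UNIV. inj (G t)}"
    by (rule open_linear_family_inj[OF open_UNIV lin]) (auto simp: G_def intro!: continuous_intros)
  ultimately obtain d where d: "d > 0" "\<And>t. \<bar>t\<bar> < d \<Longrightarrow> inj (G t)"
    unfolding open_dist by (force simp: dist_real_def)
  define t where "t = min (d / 2) 1"
  have t: "0 < t" "t < pi" "inj (G t)" using d pi_gt3 by (auto simp: t_def)
  define c where "c = t - snd (f u)"
  have "fder (base_of c f m) u = G t"
    by (rule ext) (simp add: base_of_fder[OF u] G_def normal_of_def c_def)
  then show thesis using t by (intro that[of c]) (auto simp: c_def)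
qed

end

section \<open>Null second fundamental form\<close>

lemma kernel_of_functional_nontrivial:
  fixes q :: "'e::euclidean_space \<Rightarrow> real"
  assumes "linear q" "2 \<le> DIM('e)"
  obtains X where "X \<noteq> 0" "q X = 0"
proof -
  have "\<not> inj q"
  proof
    assume "inj q"
    then have "dim (range q) = dim (UNIV :: 'e set)" by (intro dim_image_eq assms(1)) auto
    moreover have "dim (range q) \<le> DIM(real)" by (rule dim_subset_UNIV)
    ultimately show False using assms(2) by simp
  qed
  then show thesis using that linear_injective_0[OF assms(1)] by blast
qed

context null_normal
begin

text \<open>Write \<open>f = (\<psi>, \<tau>)\<close>. The hypothesis says that \<open>dm\<close> has no tangential part, which leaves
  \<open>dm = - d\<tau> \<psi>\<close>. The right side is differentiable, so \<open>m\<close> has symmetric second derivatives, and these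
  give \<open>d\<tau>(Y) d\<psi>(X) = d\<tau>(X) d\<psi>(Y)\<close>. In dimension at least two a nonzero \<open>X\<close> in the kernel of
  \<open>d\<tau>\<close> shows \<open>d\<tau> = 0\<close>. Then \<open>(0, 1)\<close> is normal, and the second fundamental form, a multiple of
  \<open>(m, 1)\<close>, is orthogonal to it, hence zero.\<close>

lemma totally_geodesic_if_null:
  assumes n: "2 \<le> DIM('e)"
    and null: "\<And>u X Y. u \<in> U \<Longrightarrow> lor (diff2 flat f u X Y) (m u, 1) = 0" and u: "u \<in> U"
  shows "cyl_second_ff flat f u X Y = 0"
proof -
  have dm: "fder m u X = - (snd (fder f u X) *\<^sub>R fst (f u))" if u: "u \<in> U" for u X
  proof -
    have d: "fst (fder f u Y) \<bullet> fder m u X = 0" for Y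
      using null[OF u, of X Y] second_pairing[OF u, of X Y] by simp
    have "fder m u X + snd (fder f u X) *\<^sub>R fst (f u) = 0"
    proof (rule null_frame_orthogonal_zero[OF df_linear[OF u] dim pos[OF u] cyl[OF u] df_f[OF u] m_unit[OF u] m_f[OF u] m_df[OF u]])
      show "(fder m u X + snd (fder f u X) *\<^sub>R fst (f u)) \<bullet> fst (f u) = 0"
        using dm_f[OF u, of X] cyl[OF u] by (simp add: inner_add_left)
      show "(fder m u X + snd (fder f u X) *\<^sub>R fst (f u)) \<bullet> m u = 0"
        using dm_m[OF u, of X] m_f[OF u] by (simp add: inner_add_left inner_commute[of "fst (f u)" "m u"])
      show "(fder m u X + snd (fder f u X) *\<^sub>R fst (f u)) \<bullet> fst (fder f u Y) = 0" for Y
        using d[of Y] df_f[OF u, of Y]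
        by (simp add: inner_add_left inner_commute[of "fder m u X"] inner_commute[of "fst (f u)"])
    qed
    then show ?thesis by (simp add: eq_neg_iff_add_eq_0)
  qed
  have f2: "Ck_on (Suc 1) U f" using f_Ck by (intro Ck_on_mono[OF _ f_Ck]) simp
  have c1: "Ck_on 1 U (\<lambda>u. - (snd (fder f u X) *\<^sub>R fst (f u)))" for X
    by (intro Ck_on_minus Ck_on_scaleR Ck_on_fst Ck_on_snd U Ck_on_fder[OF f2] Ck_on_pred[OF f2])
  have "Ck_on 1 U (\<lambda>u. fder m u X)" for X by (rule Ck_on_cong[OF U _ c1[of X]]) (simp add: dm)
  then have "Ck_on (Suc 1) U m" by (intro Ck_on_SucI[where f'="fder m"] U m_der)
  then have m2: "Ck_on 2 U m" by (simp only: Suc_1)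
  have f2': "Ck_on 2 U f" using f2 by (simp only: Suc_1)
  have d2m: "fder (\<lambda>w. fder m w Y) u X = - (snd (fder (\<lambda>w. fder f w Y) u X) *\<^sub>R fst (f u) + snd (fder f u Y) *\<^sub>R fst (fder f u X))"
    if u: "u \<in> U" for u X Y
  proof (rule fder_eqI)
    have dd: "((\<lambda>w. fder f w Y) has_derivative fder (\<lambda>w. fder f w Y) u) (at u)"
      by (rule Ck_on_has_derivative[OF _ u, of 0]) (use Ck_on_fder[OF f2] in simp)
    have "((\<lambda>w. - (snd (fder f w Y) *\<^sub>R fst (f w))) has_derivative
      (\<lambda>X. - (snd (fder f u Y) *\<^sub>R fst (fder f u X) + snd (fder (\<lambda>w. fder f w Y) u X) *\<^sub>R fst (f u)))) (at u)"
      by (intro has_derivative_minus has_derivative_scaleR has_derivative_fst has_derivative_snd dd f_der u)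
    then have "((\<lambda>w. fder m w Y) has_derivative
      (\<lambda>X. - (snd (fder f u Y) *\<^sub>R fst (fder f u X) + snd (fder (\<lambda>w. fder f w Y) u X) *\<^sub>R fst (f u)))) (at u)"
      by (rule has_derivative_transform_within_open[OF _ U u]) (simp add: dm)
    then show "((\<lambda>w. fder m w Y) has_derivative
      (\<lambda>X. - (snd (fder (\<lambda>w. fder f w Y) u X) *\<^sub>R fst (f u) + snd (fder f u Y) *\<^sub>R fst (fder f u X)))) (at u)"
      by (simp add: add.commute)
  qed
  have sym: "snd (fder f u Y) *\<^sub>R fst (fder f u X) = snd (fder f u X) *\<^sub>R fst (fder f u Y)" if u: "u \<in> U" for u X Y
    using second_derivative_symmetric[OF U m2 u, of X Y] second_derivative_symmetric[OF U f2' u, of X Y]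
    by (simp add: d2m[OF u])
  have dt: "snd (fder f u Y) = 0" if u: "u \<in> U" for u Y
  proof -
    have "linear (\<lambda>X. snd (fder f u X))" using linear_compose[OF df_linear[OF u] linear_snd] by (simp add: o_def)
    then obtain X where X: "X \<noteq> 0" "snd (fder f u X) = 0" by (rule kernel_of_functional_nontrivial[OF _ n])
    then have "fst (fder f u X) \<noteq> 0" using pos[OF u X(1)] by (auto simp: lor_def)
    then show ?thesis using sym[OF u, of Y X] X(2) by simp
  qed
  note a = ambient[OF u]
  let ?h = "cyl_second_ff flat f u X Y"
  have h: "?h \<in> normal_space lor cylinder_tangent flat f u" by (rule second_ff_normal[OF a(1-3,5)])
  have "?h = snd ?h *\<^sub>R (m u, 1)"
  proof (rule null_pairing_collinear[OF df_linear[OF u] dim pos[OF u] cyl[OF u] df_f[OF u] m_unit[OF u] m_f[OF u] m_df[OF u]])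
    show "fst ?h \<bullet> fst (f u) = 0" "lor ?h (fder f u X) = 0" for X
      using h by (auto simp: normal_space_def cylinder_tangent_def sphere_tangent_def diff1_flat)
    show "lor ?h (m u, 1) = 0" using second_ff_pairing[OF a(1-3,5,4), of X Y] null[OF u] by simp
  qed
  moreover have "snd ?h = 0"
  proof -
    have "(0, 1) \<in> normal_space lor cylinder_tangent flat f u"
      using dt[OF u] by (auto simp: normal_space_def cylinder_tangent_def sphere_tangent_def diff1_flat lor_def)
    from second_ff_pairing[OF a(1-3,5) this, of X Y]
    have "snd ?h = snd (fder (\<lambda>w. fder f w Y) u X)" by (simp add: lor_def diff2_flat)
    also have "\<dots> = 0"
    proof -
      have "((\<lambda>w. snd (fder f w Y)) has_derivative (\<lambda>X. snd (fder (\<lambda>w. fder f w Y) u X))) (at u)"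
        by (intro has_derivative_snd Ck_on_has_derivative[OF _ u, of 0]) (use Ck_on_fder[OF f2] in simp)
      moreover have "((\<lambda>w. snd (fder f w Y)) has_derivative (\<lambda>X. 0)) (at u)"
        by (rule has_derivative_transform_within_open[OF has_derivative_const U u]) (simp add: dt)
      ultimately have "(\<lambda>X. snd (fder (\<lambda>w. fder f w Y) u X)) = (\<lambda>X. 0)" by (rule has_derivative_unique)
      then show ?thesis by metis
    qed
    finally show ?thesis .
  qed
  ultimately show ?thesis by (metis scaleR_zero_left)
qed

end

section \<open>Passing to charts\<close>

lemma Ck_map_subset: "W' \<subseteq> W \<Longrightarrow> Ck_map M k W f \<Longrightarrow> Ck_map M k W' f"
  unfolding Ck_map_def by (meson Ck_on_subset Int_mono image_mono subset_refl)

lemma immersion_subset: "W' \<subseteq> W \<Longrightarrow> immersion M k Q W f \<Longrightarrow> immersion M k Q W' f"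
  unfolding immersion_def using Ck_map_subset by blast

definition null_normal_on ::
  "('m::topological_space, 'e::euclidean_space) charts \<Rightarrow> 'm set \<Rightarrow> ('m \<Rightarrow> 'v::euclidean_space \<times> real) \<Rightarrow> ('m \<Rightarrow> 'v) \<Rightarrow> bool" where
  "null_normal_on M W f m \<longleftrightarrow> open W \<and> continuous_on W m \<and>
     (\<forall>y\<in>W. m y \<bullet> m y = 1 \<and> (m y, 1) \<in> normal_space lor cylinder_tangent M f y)"

lemma null_normal_on_subset: "null_normal_on M W f m \<Longrightarrow> open W' \<Longrightarrow> W' \<subseteq> W \<Longrightarrow> null_normal_on M W' f m"
  unfolding null_normal_on_def using continuous_on_subset by blast

context
  fixes M :: "('m::{t2_space,second_countable_topology}, 'e::euclidean_space) charts"
  assumes M: "smooth_manifold M"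
begin

lemma chart_in_image: "y \<in> chart_dom M x \<Longrightarrow> y \<in> W \<Longrightarrow> chart M x y \<in> chart M x ` (chart_dom M x \<inter> W)"
  by blast

lemma coord_rep_differentiable:
  assumes "Ck_map M (Suc k) W f" "y \<in> chart_dom M x" "y \<in> W"
  shows "coord_rep M x f differentiable at (chart M x y)"
  using Ck_map_Ck_on[OF M assms(1), of x] assms(2,3) by simp

lemma diff1_range:
  assumes y: "y \<in> chart_dom M x" and f: "coord_rep M x f differentiable at (chart M x y)"
  shows "range (diff1 M f y) = range (fder (coord_rep M x f) (chart M x y))"
proof -
  have "range (diff1 M f y) = fder (coord_rep M x f) (chart M x y) ` range (trans_D M x y)"
    unfolding image_image diff1_change_chart[OF M y f, abs_def] ..
  also have "range (trans_D M x y) = UNIV" using trans_D_bij(2)[OF M y] by (simp add: bij_def)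
  finally show ?thesis .
qed

lemma immersion_in_chart:
  assumes y: "y \<in> chart_dom M x" and f: "coord_rep M x f differentiable at (chart M x y)"
  shows "inj (diff1 M f y) \<longleftrightarrow> inj (fder (coord_rep M x f) (chart M x y))"
proof -
  have e: "diff1 M f y = fder (coord_rep M x f) (chart M x y) \<circ> trans_D M x y"
    by (rule ext) (simp add: diff1_change_chart[OF M y f])
  have b: "inj (trans_D M x y)" "range (trans_D M x y) = UNIV"
    using trans_D_bij(2)[OF M y] by (auto simp: bij_def)
  show ?thesis
  proof
    assume "inj (diff1 M f y)"
    from inj_on_imageI[OF this[unfolded e]] show "inj (fder (coord_rep M x f) (chart M x y))" by (simp only: b(2))
  next
    assume "inj (fder (coord_rep M x f) (chart M x y))"
    from inj_compose[OF this b(1)] show "inj (diff1 M f y)" by (simp only: e)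
  qed
qed

lemma normal_space_in_chart:
  assumes y: "y \<in> chart_dom M x" and f: "coord_rep M x f differentiable at (chart M x y)"
  shows "normal_space B T M f y = normal_space B T flat (coord_rep M x f) (chart M x y)"
proof -
  have r: "(\<forall>v\<in>range (diff1 M f y). B w v = 0) \<longleftrightarrow> (\<forall>v\<in>range (fder (coord_rep M x f) (chart M x y)). B w v = 0)" for w
    by (simp only: diff1_range[OF y f])
  have "(\<forall>X. B w (diff1 M f y X) = 0) \<longleftrightarrow> (\<forall>X. B w (diff1 flat (coord_rep M x f) (chart M x y) X) = 0)" for w
    using r[of w] by (simp add: diff1_flat)
  then show ?thesis by (simp add: normal_space_def coord_rep_chart[OF M y])
qed

lemma spacelike_in_chart:
  assumes y: "y \<in> chart_dom M x" and f: "coord_rep M x f differentiable at (chart M x y)"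
    and sp: "spacelike M W f" "y \<in> W" and X: "X \<noteq> 0"
  shows "lor (fder (coord_rep M x f) (chart M x y) X) (fder (coord_rep M x f) (chart M x y) X) > 0"
proof -
  obtain Z where Z: "X = trans_D M x y Z" using trans_D_bij(2)[OF M y] by (metis bij_pointE)
  then have "Z \<noteq> 0" using X linear_0[OF trans_D_bij(1)[OF M y]] by auto
  then have "induced_metric lor M f y Z Z > 0" using sp by (simp add: spacelike_def)
  then show ?thesis by (simp add: induced_metric_def diff1_change_chart[OF M y f] Z)
qed

lemma hypersurface_in_chart:
  fixes \<phi> \<nu> :: "'m \<Rightarrow> 'v::euclidean_space"
  assumes dim: "DIM('v) = DIM('e) + 2" and W: "open W"
    and im: "immersion M 4 unit_sphere W \<phi>" and ga: "gauss_map M W \<phi> \<nu>"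
  shows "hypersurface (chart M x ` (chart_dom M x \<inter> W)) (coord_rep M x \<phi>) (coord_rep M x \<nu>)"
proof
  have c: "Ck_map M (Suc 3) W \<phi>" using im by (simp add: immersion_def)
  show "open (chart M x ` (chart_dom M x \<inter> W))" by (rule open_chart_image[OF M W])
  show "Ck_on 4 (chart M x ` (chart_dom M x \<inter> W)) (coord_rep M x \<phi>)"
    using Ck_map_Ck_on[OF M c] by (simp del: Ck_on.simps)
  show "continuous_on (chart M x ` (chart_dom M x \<inter> W)) (coord_rep M x \<nu>)"
    by (rule continuous_on_coord_rep[OF M]) (use ga in \<open>simp add: gauss_map_def\<close>)
  fix u assume "u \<in> chart M x ` (chart_dom M x \<inter> W)"
  then obtain y where y: "y \<in> chart_dom M x" "y \<in> W" and u: "u = chart M x y" by auto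
  note d = coord_rep_differentiable[OF c y]
  have n: "\<nu> y \<in> normal_space (\<bullet>) sphere_tangent flat (coord_rep M x \<phi>) u" "\<nu> y \<in> unit_sphere"
    using ga y(2) normal_space_in_chart[OF y(1) d] unfolding gauss_map_def u by auto
  show "coord_rep M x \<phi> u \<bullet> coord_rep M x \<phi> u = 1"
    using im y(2) by (auto simp: u coord_rep_chart[OF M y(1)] immersion_def unit_sphere_def)
  show "inj (fder (coord_rep M x \<phi>) u)"
    using im y(2) immersion_in_chart[OF y(1) d] by (simp add: u immersion_def)
  show "coord_rep M x \<nu> u \<bullet> coord_rep M x \<nu> u = 1"
    using n(2) by (simp add: u coord_rep_chart[OF M y(1)] unit_sphere_def)
  show "coord_rep M x \<nu> u \<bullet> coord_rep M x \<phi> u = 0" "coord_rep M x \<nu> u \<bullet> fder (coord_rep M x \<phi>) u X = 0" for X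
    using n(1) by (auto simp: u coord_rep_chart[OF M y(1)] normal_space_def sphere_tangent_def diff1_flat)
qed (rule dim)

lemma null_normal_in_chart:
  fixes f :: "'m \<Rightarrow> 'v::euclidean_space \<times> real"
  assumes dim: "DIM('v) = DIM('e) + 2" and f: "Ck_map M (Suc (Suc k)) W f" and cyl: "f ` W \<subseteq> cylinder"
    and sp: "spacelike M W f" and m: "null_normal_on M W f m"
  shows "null_normal (chart M x ` (chart_dom M x \<inter> W)) (coord_rep M x f) (coord_rep M x m) k"
proof
  show "open (chart M x ` (chart_dom M x \<inter> W))"
    using m by (intro open_chart_image[OF M]) (simp add: null_normal_on_def)
  show "Ck_on (Suc (Suc k)) (chart M x ` (chart_dom M x \<inter> W)) (coord_rep M x f)" by (rule Ck_map_Ck_on[OF M f])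
  show "continuous_on (chart M x ` (chart_dom M x \<inter> W)) (coord_rep M x m)"
    by (rule continuous_on_coord_rep[OF M]) (use m in \<open>simp add: null_normal_on_def\<close>)
  fix u assume "u \<in> chart M x ` (chart_dom M x \<inter> W)"
  then obtain y where y: "y \<in> chart_dom M x" "y \<in> W" and u: "u = chart M x y" by auto
  note d = coord_rep_differentiable[OF f y]
  have n: "(m y, 1) \<in> normal_space lor cylinder_tangent flat (coord_rep M x f) u" "m y \<bullet> m y = 1"
    using m y(2) normal_space_in_chart[OF y(1) d] unfolding null_normal_on_def u by auto
  show "fst (coord_rep M x f u) \<bullet> fst (coord_rep M x f u) = 1"
    using cyl y(2) by (auto simp: u coord_rep_chart[OF M y(1)] cylinder_def unit_sphere_def mem_Times_iff)
  show "0 < lor (fder (coord_rep M x f) u X) (fder (coord_rep M x f) u X)" if "X \<noteq> 0" for X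
    unfolding u by (rule spacelike_in_chart[OF y(1) d sp y(2) that])
  show "coord_rep M x m u \<bullet> coord_rep M x m u = 1" using n(2) by (simp add: u coord_rep_chart[OF M y(1)])
  show "coord_rep M x m u \<bullet> fst (coord_rep M x f u) = 0"
    "coord_rep M x m u \<bullet> fst (fder (coord_rep M x f) u X) = snd (fder (coord_rep M x f) u X)" for X
    using n(1) by (auto simp: u coord_rep_chart[OF M y(1)] normal_space_def cylinder_tangent_def
      sphere_tangent_def diff1_flat lor_def)
qed (rule dim)

text \<open>The last component of a null vector vanishes only if the vector does; dividing by it gives the normal form
  \<open>(m, 1)\<close>.\<close>

lemma null_normal_of_null_field:
  fixes f :: "'m \<Rightarrow> 'v::euclidean_space \<times> real"
  assumes "open W" and \<xi>: "null_normal_field M W f \<xi>"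
    and sub: "\<And>y. y \<in> W \<Longrightarrow> subspace (normal_space lor cylinder_tangent M f y)"
  shows "null_normal_on M W f (\<lambda>y. (1 / snd (\<xi> y)) *\<^sub>R fst (\<xi> y))"
    and "\<And>y. y \<in> W \<Longrightarrow> snd (\<xi> y) \<noteq> 0 \<and> \<xi> y = snd (\<xi> y) *\<^sub>R ((1 / snd (\<xi> y)) *\<^sub>R fst (\<xi> y), 1)"
proof -
  have ne: "snd (\<xi> y) \<noteq> 0" if "y \<in> W" for y
  proof
    assume z: "snd (\<xi> y) = 0"
    have "lor (\<xi> y) (\<xi> y) = 0" "\<xi> y \<noteq> 0" using \<xi> that by (auto simp: null_normal_field_def)
    then show False using z by (simp add: lor_def prod_eq_iff)
  qed
  show 2: "\<And>y. y \<in> W \<Longrightarrow> snd (\<xi> y) \<noteq> 0 \<and> \<xi> y = snd (\<xi> y) *\<^sub>R ((1 / snd (\<xi> y)) *\<^sub>R fst (\<xi> y), 1)"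
    using ne by (simp add: prod_eq_iff)
  show "null_normal_on M W f (\<lambda>y. (1 / snd (\<xi> y)) *\<^sub>R fst (\<xi> y))"
    unfolding null_normal_on_def
  proof (intro conjI ballI assms(1))
    show "continuous_on W (\<lambda>y. (1 / snd (\<xi> y)) *\<^sub>R fst (\<xi> y))"
      using \<xi> ne by (auto simp: null_normal_field_def intro!: continuous_intros)
    fix y assume y: "y \<in> W"
    have "lor (\<xi> y) (\<xi> y) = 0" using \<xi> y by (simp add: null_normal_field_def)
    then show "(1 / snd (\<xi> y)) *\<^sub>R fst (\<xi> y) \<bullet> (1 / snd (\<xi> y)) *\<^sub>R fst (\<xi> y) = 1"
      using ne[OF y] by (simp add: lor_def)
    have "(1 / snd (\<xi> y)) *\<^sub>R \<xi> y \<in> normal_space lor cylinder_tangent M f y"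
      using \<xi> y by (intro subspace_scale[OF sub[OF y]]) (simp add: null_normal_field_def)
    moreover have "(1 / snd (\<xi> y)) *\<^sub>R \<xi> y = ((1 / snd (\<xi> y)) *\<^sub>R fst (\<xi> y), 1)" using ne[OF y] by (simp add: prod_eq_iff)
    ultimately show "((1 / snd (\<xi> y)) *\<^sub>R fst (\<xi> y), 1) \<in> normal_space lor cylinder_tangent M f y" by simp
  qed
qed

lemma cylinder_ambient:
  fixes f :: "'m \<Rightarrow> 'v::euclidean_space \<times> real"
  assumes W: "open W" and f: "Ck_map M (Suc k) W f" and cyl: "f ` W \<subseteq> cylinder" and sp: "spacelike M W f" and y: "y \<in> W"
  shows "ambient_form lor cylinder_tangent (f y)" "linear (diff1 M f y)"
    "range (diff1 M f y) \<subseteq> cylinder_tangent (f y)" "pos_metric (induced_metric lor M f y)"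
proof -
  show "ambient_form lor cylinder_tangent (f y)" using cyl y by (intro ambient_form_cylinder) auto
  let ?U = "chart M y ` (chart_dom M y \<inter> W)"
  have u: "chart M y y \<in> ?U" using chart_in_image[OF chart_dom(2)[OF M] y] .
  have d: "(coord_rep M y f has_derivative fder (coord_rep M y f) (chart M y y)) (at (chart M y y))"
    by (rule Ck_on_has_derivative[OF Ck_map_Ck_on[OF M f] u])
  have e: "diff1 M f y = fder (coord_rep M y f) (chart M y y)" by (rule ext) (simp add: diff1_def)
  show l: "linear (diff1 M f y)" unfolding e using d has_derivative_linear by blast
  have "fst (diff1 M f y X) \<bullet> fst (coord_rep M y f (chart M y y)) = 0" for X
    unfolding e
    by (rule cylinder_tangent_derivative[OF open_chart_image[OF M W] u d])
      (use cyl in \<open>auto simp: coord_rep_chart[OF M] cylinder_def unit_sphere_def mem_Times_iff\<close>)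
  then show "range (diff1 M f y) \<subseteq> cylinder_tangent (f y)"
    by (intro image_subsetI) (simp add: coord_rep_chart_self[OF M] cylinder_tangent_def sphere_tangent_def mem_Times_iff)
  have "bilinear (\<lambda>X Y. lor (diff1 M f y X) (diff1 M f y Y))"
    using linear_compose[OF l linear_bilinear_left[OF bilinear_lor]]
      linear_compose[OF l linear_bilinear_right[OF bilinear_lor]]
    by (simp add: bilinear_def o_def)
  then show "pos_metric (induced_metric lor M f y)"
    using sp y by (auto simp: pos_metric_def induced_metric_def[abs_def] spacelike_def lor_def inner_commute)
qed

lemma null_second_ff_totally_geodesic:
  fixes f :: "'m \<Rightarrow> 'v::euclidean_space \<times> real"
  assumes dim: "DIM('v) = DIM('e) + 2" and n: "2 \<le> DIM('e)" and im: "immersion M 2 cylinder UNIV f"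
    and sp: "spacelike M UNIV f" and null: "null_second_ff M f"
  shows "totally_geodesic M f"
  unfolding totally_geodesic_def
proof (intro allI)
  fix x X Y
  have f: "Ck_map M (Suc (Suc 0)) UNIV f" and cyl: "f ` UNIV \<subseteq> cylinder"
    using im by (auto simp: immersion_def numeral_2_eq_2)
  obtain W \<xi> where W: "open W" "x \<in> W" and \<xi>: "null_normal_field M W f \<xi>"
    and h: "\<And>y X Y. y \<in> W \<Longrightarrow> \<exists>c. cyl_second_ff M f y X Y = c *\<^sub>R \<xi> y"
    using null unfolding null_second_ff_def by meson
  note amb = cylinder_ambient[OF open_UNIV f cyl sp UNIV_I]
  define m where "m y = (1 / snd (\<xi> y)) *\<^sub>R fst (\<xi> y)" for y
  note field = null_normal_of_null_field[OF W(1) \<xi> subspace_normal_space[OF amb], folded m_def]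
  have fW: "Ck_map M (Suc (Suc 0)) W f" "f ` W \<subseteq> cylinder" "spacelike M W f"
    using Ck_map_subset[OF _ f] cyl sp by (auto simp: spacelike_def)
  interpret null_normal "chart M x ` (chart_dom M x \<inter> W)" "coord_rep M x f" "coord_rep M x m" 0
    by (rule null_normal_in_chart[OF dim fW field(1)])
  have f2: "Ck_on 2 (chart M x ` (chart_dom M x \<inter> W)) (coord_rep M x f)"
    using Ck_map_Ck_on[OF M fW(1), of x] by (simp only: numeral_2_eq_2)
  have "lor (diff2 flat (coord_rep M x f) u X Y) (coord_rep M x m u, 1) = 0"
    if uW: "u \<in> chart M x ` (chart_dom M x \<inter> W)" for u X Y
  proof -
    obtain y where y: "y \<in> chart_dom M x" "y \<in> W" and u: "u = chart M x y" using uW by auto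
    have ne: "snd (\<xi> y) \<noteq> 0" and \<xi>y: "\<xi> y = snd (\<xi> y) *\<^sub>R (m y, 1)" using field(2)[OF y(2)] by auto
    have my: "(m y, 1) \<in> normal_space lor cylinder_tangent M f y" "m y \<bullet> m y = 1"
      using field(1) y(2) by (auto simp: null_normal_on_def)
    obtain X' Y' where XY: "X = trans_D M x y X'" "Y = trans_D M x y Y'"
      using trans_D_bij(2)[OF M y(1)] by (metis bij_pointE)
    obtain c where "cyl_second_ff M f y X' Y' = c *\<^sub>R \<xi> y" using h[OF y(2)] by blast
    then have "cyl_second_ff M f y X' Y' = (c * snd (\<xi> y)) *\<^sub>R (m y, 1)" using \<xi>y by (metis scaleR_scaleR)
    then have "lor (cyl_second_ff M f y X' Y') (m y, 1) = 0" using my(2) by (simp add: lor_def)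
    then have "lor (diff2 M f y X' Y') (m y, 1) = 0" using second_ff_pairing[OF amb my(1)] by simp
    moreover have "diff2 M f y X' Y' = diff2 flat (coord_rep M x f) u X Y
        + fder (coord_rep M x f) u (trans_D2 M x y X' Y')"
      using diff2_change_chart[OF M y(1) U _ f2, of X' Y'] uW by (simp add: u XY diff2_flat)
    moreover have "lor (fder (coord_rep M x f) u Z) (coord_rep M x m u, 1) = 0" for Z
      using m_df[OF uW, of Z] by (simp add: lor_def inner_commute)
    ultimately show ?thesis
      by (simp add: u coord_rep_chart[OF M y(1)] bilinear_ladd[OF bilinear_lor])
  qed
  from totally_geodesic_if_null[OF n this chart_in_image[OF chart_dom(2)[OF M] W(2)]]
  show "cyl_second_ff M f x X Y = 0" by (simp add: geometry_at_point(3)[OF M])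
qed

end

section \<open>The immersions attached to a hypersurface\<close>

text \<open>If every point of \<open>A\<close> has a point of \<open>B\<close> within half of the smallest gap of \<open>A\<close>, these points are in
  the same order, and by cardinality they are all of \<open>B\<close>.\<close>

lemma strictly_sorted_choice_close:
  fixes A B :: "real set"
  assumes fin: "finite A" "finite B" and card: "card A = card B"
    and gap: "\<And>a a'. a \<in> A \<Longrightarrow> a' \<in> A \<Longrightarrow> a < a' \<Longrightarrow> 2 * \<epsilon> \<le> a' - a"
    and close: "\<And>a. a \<in> A \<Longrightarrow> \<exists>b\<in>B. \<bar>b - a\<bar> < \<epsilon>" and i: "i < card A"
  shows "\<bar>sorted_list_of_set B ! i - sorted_list_of_set A ! i\<bar> < \<epsilon>"
proof -
  obtain t where t: "\<And>a. a \<in> A \<Longrightarrow> t a \<in> B \<and> \<bar>t a - a\<bar> < \<epsilon>" using close by metis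
  define xs where "xs = sorted_list_of_set A"
  have xs: "set xs = A" "length xs = card A" "sorted_wrt (<) xs" using fin by (auto simp: xs_def)
  have mono: "t a < t a'" if "a \<in> A" "a' \<in> A" "a < a'" for a a'
    using t[OF that(1)] t[OF that(2)] gap[OF that] by linarith
  have st: "sorted_wrt (<) (map t xs)"
    unfolding sorted_wrt_map
    by (rule sorted_wrt_mono_rel[OF _ xs(3)]) (use mono xs(1) in blast)
  have "inj_on t A" by (rule inj_onI) (metis mono less_irrefl neq_iff)
  then have "card (t ` A) = card B" using card by (simp add: card_image)
  moreover have "t ` A \<subseteq> B" using t by auto
  ultimately have "t ` A = B" using card_subset_eq fin(2) by blast
  then have "map t xs = sorted_list_of_set B"
    using st xs(1) fin(2) by (intro strict_sorted_equal) auto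
  then have "sorted_list_of_set B ! i = t (xs ! i)" using i xs(2) by (metis nth_map)
  moreover have "xs ! i \<in> A" using i xs nth_mem by metis
  ultimately show ?thesis using t by (simp add: xs_def)
qed

context
  fixes M :: "('m::{t2_space,second_countable_topology}, 'e::euclidean_space) charts"
    and \<phi> \<nu> :: "'m \<Rightarrow> 'v::euclidean_space" and W :: "'m set"
  assumes M: "smooth_manifold M" and dim: "DIM('v) = DIM('e) + 2" and W: "open W"
    and im: "immersion M 4 unit_sphere W \<phi>" and ga: "gauss_map M W \<phi> \<nu>"
begin

text \<open>The shape operators in two charts are conjugate by the derivative of the transition.\<close>

lemma curvatures_in_chart:
  assumes y: "y \<in> chart_dom M x" "y \<in> W"
  shows "principal_curvatures M \<phi> \<nu> y = principal_curvatures flat (coord_rep M x \<phi>) (coord_rep M x \<nu>) (chart M x y)"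
    and "curvature_mult M \<phi> \<nu> y k = curvature_mult flat (coord_rep M x \<phi>) (coord_rep M x \<nu>) (chart M x y) k"
    and "curvature_roots M \<phi> \<nu> y = curvature_roots flat (coord_rep M x \<phi>) (coord_rep M x \<nu>) (chart M x y)"
proof -
  interpret X: hypersurface "chart M x ` (chart_dom M x \<inter> W)" "coord_rep M x \<phi>" "coord_rep M x \<nu>"
    by (rule hypersurface_in_chart[OF M dim W im ga])
  interpret Y: hypersurface "chart M y ` (chart_dom M y \<inter> W)" "coord_rep M y \<phi>" "coord_rep M y \<nu>"
    by (rule hypersurface_in_chart[OF M dim W im ga])
  let ?u = "chart M x y" and ?v = "chart M y y" and ?L = "trans_D M x y"
  have u: "?u \<in> chart M x ` (chart_dom M x \<inter> W)" and v: "?v \<in> chart M y ` (chart_dom M y \<inter> W)"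
    using y chart_dom(2)[OF M] by blast+
  have L: "linear ?L" "inj ?L" "range ?L = UNIV" using trans_D_bij[OF M y(1)] by (auto simp: bij_def)
  have d: "coord_rep M x \<phi> differentiable at ?u" "coord_rep M x \<nu> differentiable at ?u"
    using X.\<phi>_der[OF u] X.\<nu>_der[OF u] by (auto simp: differentiable_def)
  have conj: "?L (Y.A ?v X) = X.A ?u (?L X)" for X
  proof (rule injD[OF X.\<phi>_inj[OF u]])
    show "fder (coord_rep M x \<phi>) ?u (?L (Y.A ?v X)) = fder (coord_rep M x \<phi>) ?u (X.A ?u (?L X))"
      using Y.d\<nu>_eq[OF v, of X] diff1_change_chart[OF M y(1) d(1)] diff1_change_chart[OF M y(1) d(2)]
      by (simp add: X.d\<nu>_eq[OF u] diff1_def)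
  qed
  have eig: "Y.A ?v X = k *\<^sub>R X \<longleftrightarrow> X.A ?u (?L X) = k *\<^sub>R ?L X" for X k
    using conj[of X] linear_scale[OF L(1), of k X] injD[OF L(2), of "Y.A ?v X" "k *\<^sub>R X"] by auto
  have s: "shape_operator M \<phi> \<nu> y = Y.A ?v" by (simp add: Y.A_def curvatures_at_point(1)[OF M])
  have L0: "?L X = 0 \<longleftrightarrow> X = 0" for X using L(1,2) linear_injective_0 linear_0 by metis
  have sur: "\<exists>Z. X = ?L Z" for X using L(3) by (metis rangeE UNIV_I)
  show p: "principal_curvatures M \<phi> \<nu> y = principal_curvatures flat (coord_rep M x \<phi>) (coord_rep M x \<nu>) ?u"
    unfolding principal_curvatures_def s X.A_def[symmetric] eig using L0 sur by (metis (no_types, opaque_lifting))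
  have m: "curvature_mult M \<phi> \<nu> y k = curvature_mult flat (coord_rep M x \<phi>) (coord_rep M x \<nu>) ?u k" for k
  proof -
    have "{X. X.A ?u X = k *\<^sub>R X} = ?L ` {X. Y.A ?v X = k *\<^sub>R X}"
    proof safe
      fix X assume "X.A ?u X = k *\<^sub>R X"
      moreover obtain Z where "X = ?L Z" using sur by blast
      ultimately show "X \<in> ?L ` {X. Y.A ?v X = k *\<^sub>R X}" by (simp add: eig)
    qed (simp add: eig)
    then show ?thesis
      unfolding curvature_mult_def s X.A_def[symmetric]
      using dim_image_eq[OF L(1) inj_on_subset[OF L(2) subset_UNIV], of "{X. Y.A ?v X = k *\<^sub>R X}"] by simp
  qed
  then show "curvature_mult M \<phi> \<nu> y k = curvature_mult flat (coord_rep M x \<phi>) (coord_rep M x \<nu>) ?u k" .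
  show "curvature_roots M \<phi> \<nu> y = curvature_roots flat (coord_rep M x \<phi>) (coord_rep M x \<nu>) ?u"
    by (simp add: curvature_roots_def curvature_poly_def p m)
qed

lemma manifold_roots_count:
  assumes x: "x \<in> W"
  shows "finite (curvature_roots M \<phi> \<nu> x)"
    and "card (curvature_roots M \<phi> \<nu> x) = (if sphere_mean_curvature M \<phi> x = 0
       then card (principal_curvatures M \<phi> \<nu> x) - 1 else card (principal_curvatures M \<phi> \<nu> x))"
proof -
  interpret hypersurface "chart M x ` (chart_dom M x \<inter> W)" "coord_rep M x \<phi>" "coord_rep M x \<nu>"
    by (rule hypersurface_in_chart[OF M dim W im ga])
  have u: "chart M x x \<in> chart M x ` (chart_dom M x \<inter> W)" using x chart_dom(2)[OF M] by blast
  show "finite (curvature_roots M \<phi> \<nu> x)"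
    and "card (curvature_roots M \<phi> \<nu> x) = (if sphere_mean_curvature M \<phi> x = 0
       then card (principal_curvatures M \<phi> \<nu> x) - 1 else card (principal_curvatures M \<phi> \<nu> x))"
    using curvature_roots_count[OF u] by (simp_all add: curvatures_at_point[OF M] geometry_at_point[OF M])
qed

lemma coord_rep_phibar: "coord_rep M x (phibar \<phi> \<nu> s) = phibar (coord_rep M x \<phi>) (coord_rep M x \<nu>) (coord_rep M x s)"
  by (simp add: fun_eq_iff coord_rep_def phibar_def)

lemma manifold_phibar:
  assumes s: "root_function M W \<phi> \<nu> s"
  shows "Ck_map M 2 W s" "immersion M 2 cylinder W (phibar \<phi> \<nu> s)"
    "spacelike M W (phibar \<phi> \<nu> s)" "marginally_trapped M W (phibar \<phi> \<nu> s)"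
proof -
  have c: "continuous_on (chart M x ` (chart_dom M x \<inter> W)) (coord_rep M x s)" for x
    by (rule continuous_on_coord_rep[OF M]) (use s in \<open>simp add: root_function_def\<close>)
  have r: "coord_rep M x s u \<in> curvature_roots flat (coord_rep M x \<phi>) (coord_rep M x \<nu>) u"
    if "u \<in> chart M x ` (chart_dom M x \<inter> W)" for x u
    using that s curvatures_in_chart(3) by (auto simp: root_function_def coord_rep_chart[OF M])
  note h = hypersurface_in_chart[OF M dim W im ga]
  note p = hypersurface.phibar_of_root[OF h c r, folded coord_rep_phibar]
  have u: "chart M x x \<in> chart M x ` (chart_dom M x \<inter> W)" if "x \<in> W" for x
    using that chart_dom(2)[OF M] by blast
  show "Ck_map M 2 W s"
    unfolding Ck_map_def using hypersurface.root_function_Ck[OF h c r] by blast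
  have "inj (diff1 M (phibar \<phi> \<nu> s) x)" if "x \<in> W" for x
    unfolding diff_at_point[OF M] by (rule p(4)[OF _ u[OF that]])
  moreover have "phibar \<phi> \<nu> s x \<in> cylinder" if "x \<in> W" for x
    using p(2)[OF _ u[OF that]] by (simp add: coord_rep_chart_self[OF M])
  ultimately show "immersion M 2 cylinder W (phibar \<phi> \<nu> s)"
    unfolding immersion_def Ck_map_def using p(1) by blast
  have pm: "pos_metric (induced_metric lor M (phibar \<phi> \<nu> s) x)" if "x \<in> W" for x
    unfolding geometry_at_point[OF M] by (rule p(3)[OF _ u[OF that]])
  then show "spacelike M W (phibar \<phi> \<nu> s)" by (simp add: spacelike_def pos_metric_def)
  show "marginally_trapped M W (phibar \<phi> \<nu> s)"
    unfolding marginally_trapped_def nondegenerate_def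
  proof (intro ballI conjI allI impI)
    fix x X assume x: "x \<in> W" and z: "\<forall>Y. induced_metric lor M (phibar \<phi> \<nu> s) x X Y = 0"
    show "X = 0" using pm[OF x] z unfolding pos_metric_def by (metis less_irrefl)
  next
    fix x assume x: "x \<in> W"
    show "lor (cyl_mean_curvature M (phibar \<phi> \<nu> s) x) (cyl_mean_curvature M (phibar \<phi> \<nu> s) x) = 0"
      unfolding geometry_at_point[OF M] by (rule p(5)[OF _ u[OF x]])
  qed
qed

lemma manifold_root_persists:
  assumes x: "x \<in> W" and r: "r \<in> curvature_roots M \<phi> \<nu> x" and \<epsilon>: "\<epsilon> > 0"
  shows "\<forall>\<^sub>F y in nhds x. \<exists>s\<in>curvature_roots M \<phi> \<nu> y. \<bar>s - r\<bar> < \<epsilon>"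
proof -
  interpret hypersurface "chart M x ` (chart_dom M x \<inter> W)" "coord_rep M x \<phi>" "coord_rep M x \<nu>"
    by (rule hypersurface_in_chart[OF M dim W im ga])
  have u: "chart M x x \<in> chart M x ` (chart_dom M x \<inter> W)" using x chart_dom(2)[OF M] by blast
  have "\<forall>\<^sub>F w in nhds (chart M x x). \<exists>s\<in>curvature_roots flat (coord_rep M x \<phi>) (coord_rep M x \<nu>) w. \<bar>s - r\<bar> < \<epsilon>"
    by (rule curvature_root_persists[OF u _ \<epsilon>]) (use r in \<open>simp add: curvatures_at_point[OF M]\<close>)
  then obtain S where S: "open S" "chart M x x \<in> S"
    "\<And>w. w \<in> S \<Longrightarrow> \<exists>s\<in>curvature_roots flat (coord_rep M x \<phi>) (coord_rep M x \<nu>) w. \<bar>s - r\<bar> < \<epsilon>"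
    unfolding eventually_nhds by blast
  have "open ({y \<in> chart_dom M x. chart M x y \<in> S} \<inter> W)"
    by (intro open_Int W open_chart_preimage[OF M S(1)])
  moreover have "x \<in> {y \<in> chart_dom M x. chart M x y \<in> S} \<inter> W" using x S chart_dom(2)[OF M] by blast
  moreover have "\<exists>s\<in>curvature_roots M \<phi> \<nu> y. \<bar>s - r\<bar> < \<epsilon>" if "y \<in> {y \<in> chart_dom M x. chart M x y \<in> S} \<inter> W" for y
    using that S(3) curvatures_in_chart(3)[of y x] by auto
  ultimately show ?thesis unfolding eventually_nhds by blast
qed

text \<open>The roots persist under small changes of the point and their number is constant, so the \<open>i\<close>-th smallest
  root is continuous.\<close>

lemma sorted_root_function:
  assumes N: "\<And>x. x \<in> W \<Longrightarrow> card (curvature_roots M \<phi> \<nu> x) = N" and i: "i < N"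
  shows "root_function M W \<phi> \<nu> (\<lambda>x. sorted_list_of_set (curvature_roots M \<phi> \<nu> x) ! i)"
  unfolding root_function_def
proof (intro conjI ballI)
  show "sorted_list_of_set (curvature_roots M \<phi> \<nu> x) ! i \<in> curvature_roots M \<phi> \<nu> x" if x: "x \<in> W" for x
    using nth_mem[of i "sorted_list_of_set (curvature_roots M \<phi> \<nu> x)"] manifold_roots_count(1)[OF x] N[OF x] i by simp
  show "continuous_on W (\<lambda>x. sorted_list_of_set (curvature_roots M \<phi> \<nu> x) ! i)"
    unfolding continuous_on_eq_continuous_at[OF W] isCont_def tendsto_iff
  proof (intro ballI allI impI)
    fix x e assume x: "x \<in> W" and e: "(0::real) < e"
    let ?R = "curvature_roots M \<phi> \<nu> x"
    have fR: "finite ?R" by (rule manifold_roots_count(1)[OF x])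
    define D where "D = (\<lambda>(a, b). b - a) ` {(a, b) \<in> ?R \<times> ?R. a < b}"
    have fD: "finite D" unfolding D_def by (intro finite_imageI finite_subset[OF _ finite_cartesian_product[OF fR fR]]) auto
    \<comment> \<open>at most \<open>e\<close> and at most half of each gap between roots at \<open>x\<close>\<close>
    define \<epsilon> where "\<epsilon> = Min (insert e ((\<lambda>d. d / 2) ` D))"
    have \<epsilon>: "\<epsilon> > 0" unfolding \<epsilon>_def using e fD by (auto simp: D_def)
    have \<epsilon>e: "\<epsilon> \<le> e" unfolding \<epsilon>_def using fD by (intro Min_le) auto
    have gap: "2 * \<epsilon> \<le> b - a" if "a \<in> ?R" "b \<in> ?R" "a < b" for a b
    proof -
      have "b - a \<in> D" using that by (force simp: D_def)
      then have "\<epsilon> \<le> (b - a) / 2" unfolding \<epsilon>_def using fD by (intro Min_le) auto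
      then show ?thesis by simp
    qed
    have "\<forall>\<^sub>F y in nhds x. \<forall>r\<in>?R. \<exists>s\<in>curvature_roots M \<phi> \<nu> y. \<bar>s - r\<bar> < \<epsilon>"
      using manifold_root_persists[OF x _ \<epsilon>] fR by (intro eventually_ball_finite) auto
    moreover have "\<forall>\<^sub>F y in nhds x. y \<in> W" using W x by (rule eventually_nhds_in_open)
    ultimately have "\<forall>\<^sub>F y in nhds x. dist (sorted_list_of_set (curvature_roots M \<phi> \<nu> y) ! i)
        (sorted_list_of_set (curvature_roots M \<phi> \<nu> x) ! i) < e"
    proof eventually_elim
      case (elim y)
      have "\<bar>sorted_list_of_set (curvature_roots M \<phi> \<nu> y) ! i - sorted_list_of_set ?R ! i\<bar> < \<epsilon>"
        by (rule strictly_sorted_choice_close[OF fR manifold_roots_count(1)[OF elim(2)] _ gap])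
          (use elim N x i in auto)
      then show ?case using \<epsilon>e by (simp add: dist_real_def)
    qed
    then show "\<forall>\<^sub>F y in at x. dist (sorted_list_of_set (curvature_roots M \<phi> \<nu> y) ! i)
        (sorted_list_of_set (curvature_roots M \<phi> \<nu> x) ! i) < e"
      by (simp add: eventually_nhds_conv_at)
  qed
qed

lemma enumerated_roots:
  assumes N: "\<And>x. x \<in> W \<Longrightarrow> card (curvature_roots M \<phi> \<nu> x) = N"
  obtains s :: "nat \<Rightarrow> 'm \<Rightarrow> real" where
    "\<forall>x\<in>W. bij_betw (\<lambda>i. s i x) {1..N} (curvature_roots M \<phi> \<nu> x)"
    "\<forall>i\<in>{1..N}. root_function M W \<phi> \<nu> (s i)"
proof (rule that; intro ballI)
  let ?s = "\<lambda>i x. sorted_list_of_set (curvature_roots M \<phi> \<nu> x) ! (i - 1)"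
  show bij: "bij_betw (\<lambda>i. ?s i x) {1..N} (curvature_roots M \<phi> \<nu> x)" if x: "x \<in> W" for x
  proof -
    have "bij_betw ((!) (sorted_list_of_set (curvature_roots M \<phi> \<nu> x))) {..<N} (curvature_roots M \<phi> \<nu> x)"
      using manifold_roots_count(1)[OF x] N[OF x] by (intro bij_betw_nth) auto
    moreover have "bij_betw (\<lambda>i. i - 1) {1..N} {..<N}"
      by (rule bij_betw_byWitness[where f'=Suc]) auto
    ultimately have "bij_betw ((!) (sorted_list_of_set (curvature_roots M \<phi> \<nu> x)) \<circ> (\<lambda>i. i - 1)) {1..N} (curvature_roots M \<phi> \<nu> x)"
      by (rule bij_betw_trans[rotated])
    then show ?thesis by (simp add: o_def)
  qed
  show "root_function M W \<phi> \<nu> (?s i)" if "i \<in> {1..N}" for i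
    by (rule sorted_root_function[OF N]) (use that in auto)
qed

end

section \<open>The two null directions of the normal plane\<close>

lemma fder_cong_open:
  assumes "open S" "u \<in> S" "\<And>w. w \<in> S \<Longrightarrow> f w = g w" "(f has_derivative f') (at u)"
  shows "(g has_derivative f') (at u)" "fder g u = f'"
proof -
  show g: "(g has_derivative f') (at u)"
    by (rule has_derivative_transform_within_open[OF assms(4,1,2,3)])
  show "fder g u = f'" using frechet_derivative_at[OF g] by simp
qed

lemma cyl_isometry_translation:
  "cyl_isometry (\<lambda>p::'v::euclidean_space \<times> real. p + (0, c))"
proof -
  have inj: "inj_on (\<lambda>p::'v \<times> real. p + (0, c)) cylinder" by (simp add: inj_on_def)
  have im: "(\<lambda>p::'v \<times> real. p + (0, c)) ` cylinder = cylinder"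
  proof safe
    fix a :: 'v and b assume "(a, b) \<in> cylinder"
    then have "(a, b - c) \<in> cylinder" by (simp add: cylinder_def)
    then show "(a, b) \<in> (\<lambda>p. p + (0, c)) ` cylinder" by (intro image_eqI[of _ _ "(a, b - c)"]) auto
  qed (auto simp: cylinder_def)
  have d: "fder (\<lambda>p::'v \<times> real. p + (0, c)) p X = X" for p X
    by (rule fder_eqI) (auto intro!: derivative_eq_intros)
  have inv: "p + (0, - c) = inv_into cylinder (\<lambda>p. p + (0, c)) p" if "p \<in> cylinder" for p :: "'v \<times> real"
    by (rule inv_into_f_eq[OF inj, symmetric]) (use that in \<open>auto simp: cylinder_def prod_eq_iff\<close>)
  show ?thesis
    unfolding cyl_isometry_def
  proof (intro conjI)
    show "bij_betw (\<lambda>p::'v \<times> real. p + (0, c)) cylinder cylinder" using inj im by (simp add: bij_betw_def)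
    show "\<exists>V G. open V \<and> cylinder \<subseteq> V \<and> smooth_on V G \<and> (\<forall>p\<in>cylinder. G p = p + (0, c)) \<and>
      (\<forall>p\<in>cylinder. \<forall>X\<in>cylinder_tangent p. \<forall>Y\<in>cylinder_tangent p.
        lor (fder G p X) (fder G p Y) = lor X (Y :: 'v \<times> real))"
      by (rule exI[of _ UNIV], rule exI[of _ "\<lambda>p. p + (0, c)"]) (simp add: smooth_on_translation d)
    show "\<exists>V G. open V \<and> cylinder \<subseteq> V \<and> smooth_on V G \<and>
      (\<forall>p::'v \<times> real\<in>cylinder. G p = inv_into cylinder (\<lambda>p. p + (0, c)) p)"
      by (rule exI[of _ UNIV], rule exI[of _ "\<lambda>p. p + (0, - c)"]) (simp add: smooth_on_translation inv)
  qed
qed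

context null_normal
begin

text \<open>The product of the mean curvature vector with the null normal, in a form whose continuity and
  independence of the chart can be seen.\<close>

definition null_trace :: "'e \<Rightarrow> real" where
  "null_trace u = metric_trace (induced_metric lor flat f u) (\<lambda>X Y. lor (diff2 flat f u X Y) (m u, 1))"

lemma null_trace_eq: "u \<in> U \<Longrightarrow> lor (cyl_mean_curvature flat f u) (m u, 1) = null_trace u"
  unfolding null_trace_def by (rule mean_curvature_pairing[OF ambient(1-3,5,4)])

lemma second_pairing_bilinear: "u \<in> U \<Longrightarrow> bilinear (\<lambda>X Y. lor (diff2 flat f u X Y) (m u, 1))"
  unfolding bilinear_def
  by (auto simp: second_pairing linear_add[OF dm_linear] linear_scale[OF dm_linear] linear_add[OF df_linear]
    linear_scale[OF df_linear] inner_add algebra_simps intro!: linearI)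

text \<open>The only ingredient that is not explicit is \<open>metric_sharp\<close>, which solves a linear system with
  continuous coefficients.\<close>

lemma null_trace_continuous: "continuous_on U null_trace"
proof -
  have cf: "continuous_on U (\<lambda>u. fder f u X)" for X using Ck_on_continuous[OF Ck_on_fder[OF f_Ck]] .
  have cm: "continuous_on U (\<lambda>u. fder m u X)" for X using Ck_on_continuous[OF Ck_on_fder[OF m_Ck]] .
  let ?g = "\<lambda>u. induced_metric lor flat f u"
  let ?G = "\<lambda>u v. \<Sum>c\<in>Basis. ?g u v c *\<^sub>R (c :: 'e)"
  have g: "pos_metric (?g u)" if "u \<in> U" for u using ambient(5)[OF that] .
  have gb: "bilinear (?g u)" if "u \<in> U" for u using g[OF that] by (simp add: pos_metric_def)
  have sharp: "?g u (metric_sharp (?g u) b) w = b \<bullet> w" if "u \<in> U" for u b w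
    using metric_sharp_works[OF g[OF that]] orthonormal_basis_exists[OF g[OF that]] by metis
  have cs: "continuous_on U (\<lambda>u. metric_sharp (?g u) b)" for b
  proof (rule linear_system_continuous[OF U])
    show "linear (?G u)" if "u \<in> U" for u
      by (rule linearI) (simp_all add: bilinear_ladd[OF gb[OF that]] bilinear_lmul[OF gb[OF that]]
          scaleR_add_left sum.distrib scaleR_sum_right)
    show "continuous_on U (\<lambda>u. ?G u z)" for z
      unfolding induced_metric_def diff1_flat
      by (intro continuous_on_sum continuous_on_scaleR continuous_on_const
        bounded_bilinear.continuous_on[OF bounded_bilinear_lor] cf)
    show "inj (?G u)" if "u \<in> U" for u
      unfolding linear_injective_0[OF \<open>u \<in> U \<Longrightarrow> linear (?G u)\<close>[OF that]]
    proof (intro allI impI)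
      fix v assume z: "?G u v = 0"
      have "?g u v c = 0" if "c \<in> Basis" for c
        using arg_cong[OF z, of "\<lambda>x. x \<bullet> c"] that by simp
      then have "?g u v (\<Sum>c\<in>Basis. (v \<bullet> c) *\<^sub>R c) = 0"
        by (simp add: linear_sum[OF linear_bilinear_right[OF gb[OF that]]] bilinear_rmul[OF gb[OF that]])
      then have "?g u v v = 0" by (simp only: euclidean_representation)
      then show "v = 0" using g[OF that] unfolding pos_metric_def by (metis less_irrefl)
    qed
    show "continuous_on U (\<lambda>u. b)" by simp
    show "?G u (metric_sharp (?g u) b) = b" if "u \<in> U" for u
      by (simp add: sharp[OF that] euclidean_representation)
  qed
  have e: "null_trace u = (\<Sum>b\<in>Basis. - (\<Sum>c\<in>Basis. (metric_sharp (?g u) b \<bullet> c) * (fst (fder f u c) \<bullet> fder m u b)))"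
    if "u \<in> U" for u
  proof -
    have l: "linear (\<lambda>Y. fst (fder f u Y) \<bullet> v)" for v
      using linear_compose[OF linear_compose[OF df_linear[OF that] linear_fst] linear_bilinear_left[OF bilinear_inner]]
      by (simp add: o_def)
    have "fst (fder f u Y) \<bullet> v = (\<Sum>c\<in>Basis. (Y \<bullet> c) * (fst (fder f u c) \<bullet> v))" for Y v
      by (subst linear_expansion[OF l]) simp
    then show ?thesis unfolding null_trace_def metric_trace_def second_pairing[OF that]
      by (intro sum.cong refl arg_cong[where f=uminus])
  qed
  have "continuous_on U (\<lambda>u. \<Sum>b\<in>Basis. - (\<Sum>c\<in>Basis. (metric_sharp (?g u) b \<bullet> c) * (fst (fder f u c) \<bullet> fder m u b)))"
    by (intro continuous_intros cf cm cs)
  then show ?thesis by (rule continuous_on_cong[THEN iffD1, rotated -1]) (auto simp: e)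
qed

end

text \<open>The null vectors \<open>(m, 1)\<close> and \<open>(n, 1)\<close> span the normal plane and their product
  \<open>m \<bullet> n - 1\<close> is not zero.\<close>

lemma null_decomposition:
  fixes D :: "'e::euclidean_space \<Rightarrow> 'v::euclidean_space \<times> real"
  assumes D: "linear D" and dim: "DIM('v) = DIM('e) + 2"
    and pos: "\<And>X. X \<noteq> 0 \<Longrightarrow> lor (D X) (D X) > 0"
    and p: "p \<bullet> p = 1" "\<And>X. fst (D X) \<bullet> p = 0"
    and m: "m \<bullet> m = 1" "m \<bullet> p = 0" "\<And>X. m \<bullet> fst (D X) = snd (D X)"
    and n: "n \<bullet> n = 1" "n \<bullet> p = 0" "\<And>X. n \<bullet> fst (D X) = snd (D X)" and mn: "m \<noteq> n"
    and w: "fst w \<bullet> p = 0" "\<And>X. lor w (D X) = 0"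
  shows "lor w w = 2 * (lor w (m, 1) * lor w (n, 1)) / (m \<bullet> n - 1)"
    and "lor w (m, 1) = 0 \<Longrightarrow> lor w (n, 1) = 0 \<Longrightarrow> w = 0"
proof -
  define d where "d = m \<bullet> n - 1"
  have "(m - n) \<bullet> (m - n) = - 2 * d"
    using m(1) n(1) by (simp add: d_def inner_diff inner_commute)
  moreover have "(m - n) \<bullet> (m - n) > 0" using mn by simp
  ultimately have d: "d \<noteq> 0" by auto
  define a where "a = lor w (n, 1) / d"
  define b where "b = lor w (m, 1) / d"
  note bl = bilinear_lsub[OF bilinear_lor] bilinear_lmul[OF bilinear_lor] bilinear_ladd[OF bilinear_lor]
    bilinear_rsub[OF bilinear_lor] bilinear_rmul[OF bilinear_lor] bilinear_radd[OF bilinear_lor]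
  have mm: "lor (m, 1) (m, 1) = 0" "lor (n, 1) (n, 1) = 0" "lor (m, 1) (n, 1) = d" "lor (n, 1) (m, 1) = d"
    using m(1) n(1) by (auto simp: lor_def d_def inner_commute)
  have md: "lor (m, 1) (D X) = 0" "lor (n, 1) (D X) = 0" for X using m(3) n(3) by (auto simp: lor_def)
  define w' where "w' = w - a *\<^sub>R (m, 1) - b *\<^sub>R (n, 1)"
  have w'n: "lor w' (n, 1) = 0" unfolding w'_def bl mm using d by (simp add: a_def)
  have w'm: "lor w' (m, 1) = 0" unfolding w'_def bl mm using d by (simp add: b_def)
  have w'D: "lor w' (D X) = 0" for X unfolding w'_def bl md w(2) by simp
  have w'p: "fst w' \<bullet> p = 0" using w(1) m(2) n(2) by (simp add: w'_def inner_diff_left)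
  have "w' = snd w' *\<^sub>R (m, 1)"
    by (rule null_pairing_collinear[OF D dim pos p m w'p w'D w'm])
  moreover from this have "lor w' (n, 1) = snd w' * d" using bilinear_lmul[OF bilinear_lor] mm(3) by (metis real_scaleR_def)
  ultimately have "w' = 0" using w'n d by (simp add: zero_prod_def)
  then have weq: "w = a *\<^sub>R (m, 1) + b *\<^sub>R (n, 1)" by (simp only: w'_def diff_diff_eq right_minus_eq)
  have "lor w w = lor (a *\<^sub>R (m, 1) + b *\<^sub>R (n, 1)) (a *\<^sub>R (m, 1) + b *\<^sub>R (n, 1))"
    by (simp only: weq[symmetric])
  also have "\<dots> = 2 * (a * b * d)" unfolding bl mm by simp
  finally have "lor w w = 2 * (a * b * d)" .
  then show "lor w w = 2 * (lor w (m, 1) * lor w (n, 1)) / (m \<bullet> n - 1)"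
    using d by (simp add: a_def b_def d_def)
  show "w = 0" if "lor w (m, 1) = 0" "lor w (n, 1) = 0" using weq that by (simp add: a_def b_def zero_prod_def)
qed

text \<open>Write \<open>f = (\<psi>, \<tau>)\<close>. Since \<open>f\<close> is spacelike, \<open>d\<psi>\<close> is injective and the
  gradient \<open>T\<close> of \<open>\<tau>\<close>, taken in the image of \<open>d\<psi>\<close>, has length less than one. The two null normals are
  \<open>(T \<plusminus> r N, 1)\<close>, where \<open>N\<close> is orthogonal to \<open>\<psi>\<close> and \<open>d\<psi>\<close> and \<open>r\<close> makes the first
  component a unit vector.\<close>

lemma local_null_normals:
  fixes f :: "'e::euclidean_space \<Rightarrow> 'v::euclidean_space \<times> real"
  assumes dim: "DIM('v) = DIM('e) + 2" and U: "open U" and f: "Ck_on (Suc 0) U f"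
    and cyl: "\<And>u. u \<in> U \<Longrightarrow> fst (f u) \<bullet> fst (f u) = 1"
    and pos: "\<And>u X. u \<in> U \<Longrightarrow> X \<noteq> 0 \<Longrightarrow> lor (fder f u X) (fder f u X) > 0" and u0: "u0 \<in> U"
  obtains V m n where "open V" "u0 \<in> V" "V \<subseteq> U" "continuous_on V m" "continuous_on V n"
    "\<And>u. u \<in> V \<Longrightarrow> m u \<bullet> m u = 1 \<and> m u \<bullet> fst (f u) = 0 \<and> (\<forall>X. m u \<bullet> fst (fder f u X) = snd (fder f u X))"
    "\<And>u. u \<in> V \<Longrightarrow> n u \<bullet> n u = 1 \<and> n u \<bullet> fst (f u) = 0 \<and> (\<forall>X. n u \<bullet> fst (fder f u X) = snd (fder f u X))"
    "\<And>u. u \<in> V \<Longrightarrow> m u \<noteq> n u"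
proof -
  let ?d = "\<lambda>u X. fst (fder f u X)" and ?t = "\<lambda>u X. snd (fder f u X)"
  have lin: "linear (fder f u)" if "u \<in> U" for u
    using Ck_on_has_derivative[OF f that] has_derivative_linear by blast
  have ld: "linear (?d u)" and lt: "linear (?t u)" if "u \<in> U" for u
    using linear_compose[OF lin[OF that] linear_fst] linear_compose[OF lin[OF that] linear_snd] by (simp_all add: o_def)
  have df: "?d u X \<bullet> fst (f u) = 0" if "u \<in> U" for u X
    by (rule cylinder_tangent_derivative[OF U that Ck_on_has_derivative[OF f that] cyl])
  have dpos: "?d u X \<bullet> ?d u X > 0" if "u \<in> U" "X \<noteq> 0" for u X
    using pos[OF that, unfolded lor_def] zero_le_square[of "?t u X"] by linarith
  have cf: "continuous_on U (\<lambda>u. fder f u X)" for X using Ck_on_continuous[OF Ck_on_fder[OF f]] .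
  have cd: "continuous_on U (\<lambda>u. ?d u X)" and ct: "continuous_on U (\<lambda>u. ?t u X)" for X
    by (intro continuous_intros cf)+
  have cf0: "continuous_on U (\<lambda>u. fst (f u))" using Ck_on_continuous[OF f] by (intro continuous_intros)
  have rep: "?d u X = (\<Sum>b\<in>Basis. (X \<bullet> b) *\<^sub>R ?d u b)" if "u \<in> U" for u X
    by (rule linear_expansion[OF ld[OF that]])
  have repi: "v \<bullet> ?d u X = (\<Sum>b\<in>Basis. (X \<bullet> b) * (v \<bullet> ?d u b))" if "u \<in> U" for u X v
    by (subst rep[OF that]) (simp add: inner_sum_right)
  have indep: "X = 0 \<and> \<alpha> = 0 \<and> \<beta> = 0"
    if u: "u \<in> U" and N: "N \<bullet> fst (f u) = 0" "\<And>X. N \<bullet> ?d u X = 0" "N \<noteq> 0"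
      and z: "?d u X + \<alpha> *\<^sub>R fst (f u) + \<beta> *\<^sub>R N = 0" for u N X \<alpha> \<beta>
  proof -
    have "N \<bullet> (?d u X + \<alpha> *\<^sub>R fst (f u) + \<beta> *\<^sub>R N) = 0" using z by simp
    then have b: "\<beta> = 0" using N by (simp add: inner_add_right)
    have "fst (f u) \<bullet> (?d u X + \<alpha> *\<^sub>R fst (f u) + \<beta> *\<^sub>R N) = 0" using z by simp
    then have a: "\<alpha> = 0" using b df[OF u, of X] cyl[OF u] by (simp add: inner_add_right inner_commute)
    have "?d u X = 0" using z a b by simp
    then show ?thesis using a b dpos[OF u, of X] by fastforce
  qed
  \<comment> \<open>\<open>N\<close> is fixed by the condition \<open>N u \<bullet> N0 = 1\<close>, where \<open>N0\<close> is such a normal vector at \<open>u0\<close>; it solves a linear system near \<open>u0\<close>\<close>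
  obtain N0 where N0: "N0 \<noteq> 0" "N0 \<bullet> fst (f u0) = 0" "\<And>X. N0 \<bullet> ?d u0 X = 0"
  proof -
    have "dim (insert (fst (f u0)) (range (?d u0))) \<le> Suc (dim (range (?d u0)))"
      by (simp add: dim_insert)
    also have "dim (range (?d u0)) \<le> DIM('e)"
      using dim_image_le[OF ld[OF u0], of UNIV] by simp
    finally have "dim (insert (fst (f u0)) (range (?d u0))) < DIM('v)" using dim by simp
    then obtain N where N: "N \<noteq> 0" "\<And>y. y \<in> span (insert (fst (f u0)) (range (?d u0))) \<Longrightarrow> orthogonal N y"
      by (rule orthogonal_to_subspace_exists) blast
    have "fst (f u0) \<in> span (insert (fst (f u0)) (range (?d u0)))"
      "?d u0 X \<in> span (insert (fst (f u0)) (range (?d u0)))" for X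
      by (intro span_base; simp)+
    then show thesis using N by (intro that[of N]) (auto simp: orthogonal_def)
  qed
  let ?G = "\<lambda>u z. ((\<Sum>b\<in>Basis. (z \<bullet> ?d u b) *\<^sub>R b) :: 'e, z \<bullet> fst (f u), z \<bullet> N0)"
  have lG: "linear (?G u)" for u
    by (rule linearI) (auto simp: inner_add_left scaleR_add_left sum.distrib scaleR_sum_right)
  have cG: "continuous_on U (\<lambda>u. ?G u z)" for z by (intro continuous_intros cd cf0)
  have sumz: "z \<bullet> ?d u X = 0" if "(\<Sum>b\<in>Basis. (z \<bullet> ?d u b) *\<^sub>R b) = (0::'e)" "u \<in> U" for z u X
  proof -
    have "z \<bullet> ?d u b = 0" if "b \<in> Basis" for b
      using arg_cong[OF \<open>(\<Sum>b\<in>Basis. (z \<bullet> ?d u b) *\<^sub>R b) = (0::'e)\<close>, of "\<lambda>x. x \<bullet> b"] that by simp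
    then show ?thesis by (subst repi[OF that(2)]) simp
  qed
  have "inj (?G u0)"
    unfolding linear_injective_0[OF lG]
  proof (intro allI impI)
    fix z assume "?G u0 z = 0"
    then have z: "(\<Sum>b\<in>Basis. (z \<bullet> ?d u0 b) *\<^sub>R b) = (0::'e)" "z \<bullet> fst (f u0) = 0" "z \<bullet> N0 = 0"
      by (auto simp: zero_prod_def)
    show "z = 0"
      by (rule frame_orthogonal_zero[OF ld[OF u0] dim indep[OF u0 N0(2,3,1)] sumz[OF z(1) u0] z(2,3)])
  qed
  define V where "V = {u \<in> U. inj (?G u)}"
  have V: "open V" "u0 \<in> V" "V \<subseteq> U"
    using open_linear_family_inj[OF U lG cG] u0 \<open>inj (?G u0)\<close> by (auto simp: V_def)
  have "\<exists>z. ?G u z = (0, 0, 1)" if "u \<in> V" for u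
  proof -
    have "surj (?G u)"
    proof -
      have "dim (range (?G u)) = dim (UNIV :: 'v set)"
        using that by (intro dim_image_eq lG) (auto simp: V_def)
      then have "span (range (?G u)) = UNIV" using dim by (subst dim_eq_full[symmetric]) simp
      then show ?thesis using lG[of u] by (simp add: linear_span_image)
    qed
    from surjD[OF this, of "(0, 0, 1)"] obtain z where "(0, 0, 1) = ?G u z" by blast
    then show ?thesis by (intro exI[of _ z]) (rule sym)
  qed
  then have "\<forall>u\<in>V. \<exists>z. ?G u z = (0, 0, 1)" by blast
  from bchoice[OF this] obtain N where N: "\<And>u. u \<in> V \<Longrightarrow> ?G u (N u) = (0, 0, 1)" by blast
  have cN: "continuous_on V N"
  proof (rule linear_system_continuous[where G="?G" and y=N, OF V(1) lG _ _ continuous_on_const N])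
    show "continuous_on V (\<lambda>u. ?G u z)" for z by (rule continuous_on_subset[OF cG V(3)])
    show "inj (?G u)" if "u \<in> V" for u using that unfolding V_def by blast
  qed
  have N1: "N u \<bullet> fst (f u) = 0" "N u \<noteq> 0" "N u \<bullet> ?d u X = 0" if "u \<in> V" for u X
    using N[OF that] sumz[of "N u" u X] that V(3) by auto
  \<comment> \<open>\<open>Z\<close> is the gradient of \<open>\<tau>\<close> for the metric \<open>h\<close> that \<open>\<psi>\<close> induces from the sphere\<close>
  let ?h = "\<lambda>u X Y. ?d u X \<bullet> ?d u Y"
  have h: "pos_metric (?h u)" if "u \<in> U" for u
    unfolding pos_metric_def bilinear_def using dpos[OF that]
    by (auto simp: inner_commute linear_add[OF ld[OF that]] linear_scale[OF ld[OF that]] inner_add_left inner_add_right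
      intro!: linearI)
  have "\<exists>Z. \<forall>Y. ?h u Z Y = ?t u Y" if "u \<in> U" for u
    using riesz_representation[OF h[OF that] lt[OF that]] by metis
  then obtain Z where Z: "\<And>u Y. u \<in> U \<Longrightarrow> ?h u (Z u) Y = ?t u Y" by metis
  have cZ: "continuous_on U Z"
  proof (rule linear_system_continuous[OF U, where G="\<lambda>u z. \<Sum>b\<in>Basis. ?h u z b *\<^sub>R b" and r="\<lambda>u. \<Sum>b\<in>Basis. ?t u b *\<^sub>R b"])
    show l: "linear (\<lambda>z. \<Sum>b\<in>Basis. ?h u z b *\<^sub>R b)" if "u \<in> U" for u
      by (rule linearI) (simp_all add: linear_add[OF ld[OF that]] linear_scale[OF ld[OF that]] inner_add_left
          scaleR_add_left sum.distrib scaleR_sum_right)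
    show "inj (\<lambda>z. \<Sum>b\<in>Basis. ?h u z b *\<^sub>R b)" if u: "u \<in> U" for u
      unfolding linear_injective_0[OF l[OF u]]
    proof (intro allI impI)
      fix z assume "(\<Sum>b\<in>Basis. ?h u z b *\<^sub>R b) = 0"
      from sumz[OF this u] have "?d u z \<bullet> ?d u z = 0" .
      then show "z = 0" using dpos[OF u, of z] by auto
    qed
  qed (use Z in \<open>auto intro!: continuous_intros cd ct\<close>)
  define T where "T u = ?d u (Z u)" for u
  have cT: "continuous_on U T"
  proof -
    have "continuous_on U (\<lambda>u. \<Sum>b\<in>Basis. (Z u \<bullet> b) *\<^sub>R ?d u b)" by (intro continuous_intros cZ cd)
    then show ?thesis by (rule continuous_on_cong[THEN iffD1, rotated -1]) (simp_all add: T_def rep[symmetric])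
  qed
  have TT: "T u \<bullet> T u < 1" if u: "u \<in> U" for u
  proof (cases "Z u = 0")
    case True
    then show ?thesis using linear_0[OF ld[OF u]] by (simp add: T_def)
  next
    case False
    have e: "?t u (Z u) = T u \<bullet> T u" using Z[OF u, of "Z u"] by (simp add: T_def)
    \<comment> \<open>the left side is the Lorentzian square of \<open>df (Z u)\<close>\<close>
    have "T u \<bullet> T u - (T u \<bullet> T u) * (T u \<bullet> T u) > 0"
      using pos[OF u False] by (simp add: lor_def e T_def[symmetric])
    then have "(T u \<bullet> T u) * (1 - T u \<bullet> T u) > 0" by (simp add: algebra_simps)
    then show ?thesis using inner_ge_zero[of "T u"] by (smt (verit) mult_nonneg_nonpos)
  qed
  define r where "r u = sqrt ((1 - T u \<bullet> T u) / (N u \<bullet> N u))" for u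
  have r: "r u > 0" "r u * r u * (N u \<bullet> N u) = 1 - T u \<bullet> T u" if "u \<in> V" for u
  proof -
    have p: "(1 - T u \<bullet> T u) / (N u \<bullet> N u) > 0" using TT N1(2)[OF that] that V(3) by (intro divide_pos_pos) auto
    then show "r u > 0" by (simp add: r_def)
    have "r u * r u = (1 - T u \<bullet> T u) / (N u \<bullet> N u)"
      unfolding r_def real_sqrt_mult_self using p by (rule abs_of_pos)
    then show "r u * r u * (N u \<bullet> N u) = 1 - T u \<bullet> T u" using N1(2)[OF that] by simp
  qed
  have cr: "continuous_on V r"
    unfolding r_def by (intro continuous_intros cN continuous_on_subset[OF cT V(3)]) (use N1 in auto)
  have good: "(T u + c *\<^sub>R N u) \<bullet> (T u + c *\<^sub>R N u) = 1 \<and> (T u + c *\<^sub>R N u) \<bullet> fst (f u) = 0 \<and>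
      (\<forall>X. (T u + c *\<^sub>R N u) \<bullet> ?d u X = ?t u X)" if u: "u \<in> V" and c: "c * c * (N u \<bullet> N u) = 1 - T u \<bullet> T u" for u c
    using N1[OF u] df[of u "Z u"] Z[of u] V(3) u c
    by (auto simp: T_def inner_add_left inner_add_right inner_commute[of "?d u (Z u)" "N u"] algebra_simps)
  show thesis
  proof (rule that[of V "\<lambda>u. T u + r u *\<^sub>R N u" "\<lambda>u. T u + (- r u) *\<^sub>R N u"])
    show "continuous_on V (\<lambda>u. T u + r u *\<^sub>R N u)" "continuous_on V (\<lambda>u. T u + (- r u) *\<^sub>R N u)"
      by (intro continuous_intros cN cr continuous_on_subset[OF cT V(3)])+
    show "T u + r u *\<^sub>R N u \<noteq> T u + (- r u) *\<^sub>R N u" if "u \<in> V" for u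
    proof
      assume "T u + r u *\<^sub>R N u = T u + (- r u) *\<^sub>R N u"
      then have "r u *\<^sub>R N u = - (r u *\<^sub>R N u)" by simp
      then have "r u *\<^sub>R N u + r u *\<^sub>R N u = 0" by (simp only: eq_neg_iff_add_eq_0)
      then have "(r u + r u) *\<^sub>R N u = 0" by (simp only: scaleR_add_left)
      then show False using r(1)[OF that] N1(2)[OF that] by simp
    qed
    show "(T u + r u *\<^sub>R N u) \<bullet> (T u + r u *\<^sub>R N u) = 1 \<and> (T u + r u *\<^sub>R N u) \<bullet> fst (f u) = 0 \<and>
      (\<forall>X. (T u + r u *\<^sub>R N u) \<bullet> ?d u X = ?t u X)" if "u \<in> V" for u
      by (rule good[OF that r(2)[OF that]])
    show "(T u + (- r u) *\<^sub>R N u) \<bullet> (T u + (- r u) *\<^sub>R N u) = 1 \<and> (T u + (- r u) *\<^sub>R N u) \<bullet> fst (f u) = 0 \<and>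
      (\<forall>X. (T u + (- r u) *\<^sub>R N u) \<bullet> ?d u X = ?t u X)" if "u \<in> V" for u
      by (rule good[OF that]) (use r(2)[OF that] in simp)
  qed (use V in auto)
qed

section \<open>Local reconstruction of the hypersurface\<close>

lemma continuous_on_cot_of:
  fixes f :: "'a::euclidean_space \<Rightarrow> real"
  shows "continuous_on S f \<Longrightarrow> (\<And>x. x \<in> S \<Longrightarrow> sin (f x) \<noteq> (0::real)) \<Longrightarrow> continuous_on S (\<lambda>x. cot (f x))"
  unfolding cot_def by (intro continuous_intros) auto

lemma rotate_back:
  fixes a b :: "'v::real_vector"
  assumes "k * k + s * s = (1::real)"
  shows "k *\<^sub>R (k *\<^sub>R a - s *\<^sub>R b) + s *\<^sub>R (s *\<^sub>R a + k *\<^sub>R b) = a"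
    and "k *\<^sub>R (s *\<^sub>R a + k *\<^sub>R b) - s *\<^sub>R (k *\<^sub>R a - s *\<^sub>R b) = b"
proof -
  have "k *\<^sub>R (k *\<^sub>R a - s *\<^sub>R b) + s *\<^sub>R (s *\<^sub>R a + k *\<^sub>R b) = (k * k + s * s) *\<^sub>R a"
    by (simp add: algebra_simps)
  then show "k *\<^sub>R (k *\<^sub>R a - s *\<^sub>R b) + s *\<^sub>R (s *\<^sub>R a + k *\<^sub>R b) = a" by (simp add: assms)
  have "k *\<^sub>R (s *\<^sub>R a + k *\<^sub>R b) - s *\<^sub>R (k *\<^sub>R a - s *\<^sub>R b) = (k * k + s * s) *\<^sub>R b"
    by (simp add: algebra_simps)
  then show "k *\<^sub>R (s *\<^sub>R a + k *\<^sub>R b) - s *\<^sub>R (k *\<^sub>R a - s *\<^sub>R b) = b" by (simp add: assms)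
qed

text \<open>The lift of the reconstructed hypersurface is the translated \<open>f\<close>, and its distinguished null normal
  is \<open>(m, 1)\<close>. So the criterion for roots applies to it.\<close>

lemma root_of_null_mean_curvature:
  assumes hyp: "hypersurface U (base_of c f m) (normal_of c f m)" and nn: "null_normal U f m (Suc k)"
    and u: "u \<in> U" and ran: "\<And>u. u \<in> U \<Longrightarrow> 0 < snd (f u) + c \<and> snd (f u) + c < pi"
    and H: "lor (cyl_mean_curvature flat f u) (m u, 1) = 0"
  shows "cot (snd (f u) + c) \<in> curvature_roots flat (base_of c f m) (normal_of c f m) u"
proof -
  interpret H: hypersurface U "base_of c f m" "normal_of c f m" by (rule hyp)
  interpret N: null_normal U f m "Suc k" by (rule nn)
  let ?t = "\<lambda>u. snd (f u) + c"
  have t: "Ck_on 2 U ?t"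
    by (intro Ck_on_add Ck_on_const Ck_on_snd N.U Ck_on_mono[OF _ N.f_Ck]) simp
  have dt: "?t differentiable at u" using t u by (simp add: numeral_2_eq_2)
  have sn: "sin (?t u) \<noteq> 0" using ran[OF u] sin_gt_zero[of "?t u"] by simp
  have L: "H.lift ?t w = f w + (0, c)" and tn: "H.turn_normal ?t w = m w" for w
  proof -
    have "H.turn ?t w = fst (f w)"
      unfolding H.turn_def base_of_def normal_of_def by (rule rotate_back(1)) (rule sin_cos_squared_add3)
    then show "H.lift ?t w = f w + (0, c)" by (simp add: H.lift_def prod_eq_iff)
    show "H.turn_normal ?t w = m w"
      unfolding H.turn_normal_def base_of_def normal_of_def by (rule rotate_back(2)) (rule sin_cos_squared_add3)
  qed
  have d1: "fder (H.lift ?t) w = fder f w" if "w \<in> U" for w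
  proof -
    have "((\<lambda>w. f w + (0, c)) has_derivative (\<lambda>X. fder f w X + 0)) (at w)"
      by (intro has_derivative_add N.f_der that has_derivative_const)
    then show ?thesis unfolding L[abs_def] using frechet_derivative_at by fastforce
  qed
  have d2: "fder (\<lambda>w. fder (H.lift ?t) w Y) u = fder (\<lambda>w. fder f w Y) u" for Y
    by (rule fder_cong_open(2)[OF N.U u _ Ck_on_has_derivative[OF Ck_on_fder[OF N.f_Ck] u]]) (simp add: d1)
  have inj: "inj (H.stretch ?t u)"
    unfolding linear_injective_0[OF H.stretch_linear[OF u]]
  proof (intro allI impI, rule ccontr)
    fix X assume "H.stretch ?t u X = 0" "X \<noteq> 0"
    then have "lor (fder f u X) (fder f u X) = 0"
      using H.lift_metric[OF u dt, of X X] d1[OF u] by (simp add: H.first_form_def linear_0[OF H.d\<phi>_linear[OF u]])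
    then show False using N.pos[OF u \<open>X \<noteq> 0\<close>] by simp
  qed
  have "lor (cyl_mean_curvature flat (H.lift ?t) u) (H.turn_normal ?t u, 1)
     = metric_trace (induced_metric lor flat (H.lift ?t) u) (\<lambda>X Y. lor (diff2 flat (H.lift ?t) u X Y) (H.turn_normal ?t u, 1))"
    by (rule mean_curvature_pairing[OF H.lift_ambient(1-3)[OF u dt] H.lift_pos_metric[OF u dt inj] H.lift_ambient(4)[OF u dt]])
  also have "\<dots> = metric_trace (induced_metric lor flat f u) (\<lambda>X Y. lor (diff2 flat f u X Y) (m u, 1))"
    by (simp add: induced_metric_def[abs_def] diff1_flat diff2_flat d1[OF u] d2 tn)
  also have "\<dots> = 0" using N.null_trace_eq[OF u] H by (simp add: N.null_trace_def)
  finally show ?thesis using H.lift_mean_curvature_null_iff[OF t u sn inj] by simp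
qed

context
  fixes M :: "('m::{t2_space,second_countable_topology}, 'e::euclidean_space) charts"
    and f :: "'m \<Rightarrow> 'v::euclidean_space \<times> real"
  assumes M: "smooth_manifold M" and dim: "DIM('v) = DIM('e) + 2"
    and im: "immersion M 5 cylinder UNIV f" and sp: "spacelike M UNIV f"
begin

lemma f_Ck5: "Ck_map M (Suc (Suc 3)) W f" and f_cyl: "f ` W \<subseteq> cylinder" and f_sp: "spacelike M W f"
proof -
  have "Ck_map M 5 UNIV f" using im by (simp add: immersion_def)
  then show "Ck_map M (Suc (Suc 3)) W f" using Ck_map_subset[of W UNIV] by (simp add: eval_nat_numeral)
  show "f ` W \<subseteq> cylinder" using im by (auto simp: immersion_def)
  show "spacelike M W f" using sp by (auto simp: spacelike_def)
qed

lemmas f_ambient = cylinder_ambient[OF M open_UNIV f_Ck5 f_cyl f_sp UNIV_I]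

lemmas chart_null_normal = null_normal_in_chart[OF M dim f_Ck5 f_cyl f_sp]

text \<open>Both sides are the trace of second derivatives paired with the null normal. The trace is invariant under
  linear isomorphisms, and the non-tensorial term is tangent.\<close>

lemma mean_curvature_in_chart:
  assumes m: "null_normal_on M W f m" and y: "y \<in> chart_dom M x" "y \<in> W"
  shows "lor (cyl_mean_curvature M f y) (m y, 1)
    = null_normal.null_trace (coord_rep M x f) (coord_rep M x m) (chart M x y)"
proof -
  interpret X: null_normal "chart M x ` (chart_dom M x \<inter> W)" "coord_rep M x f" "coord_rep M x m" 3
    by (rule chart_null_normal[OF m])
  let ?f = "coord_rep M x f" and ?u = "chart M x y" and ?L = "trans_D M x y"
  have u: "?u \<in> chart M x ` (chart_dom M x \<inter> W)" using y by blast
  have d: "?f differentiable at ?u" using X.f_der[OF u] by (auto simp: differentiable_def)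
  have f2: "Ck_on 2 (chart M x ` (chart_dom M x \<inter> W)) ?f" by (rule Ck_on_mono[OF _ X.f_Ck]) simp
  have my: "coord_rep M x m ?u = m y" by (rule coord_rep_chart[OF M y(1)])
  have n: "(m y, 1) \<in> normal_space lor cylinder_tangent M f y" using m y(2) by (simp add: null_normal_on_def)
  have "lor (fder ?f ?u Z) (m y, 1) = 0" for Z
    using X.m_df[OF u, of Z] by (simp add: lor_def inner_commute my)
  then have q: "lor (diff2 M f y X Y) (m y, 1) = lor (diff2 flat ?f ?u (?L X) (?L Y)) (coord_rep M x m ?u, 1)" for X Y
    using diff2_change_chart[OF M y(1) X.U u f2, of X Y]
    by (simp add: diff2_flat my bilinear_ladd[OF bilinear_lor])
  have i: "induced_metric lor M f y X Y = induced_metric lor flat ?f ?u (?L X) (?L Y)" for X Y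
    by (simp add: induced_metric_def diff1_change_chart[OF M y(1) d] diff1_flat)
  have "lor (cyl_mean_curvature M f y) (m y, 1)
      = metric_trace (induced_metric lor M f y) (\<lambda>X Y. lor (diff2 M f y X Y) (m y, 1))"
    by (rule mean_curvature_pairing[OF f_ambient n])
  also have "\<dots> = metric_trace (\<lambda>X Y. induced_metric lor flat ?f ?u (?L X) (?L Y))
      (\<lambda>X Y. lor (diff2 flat ?f ?u (?L X) (?L Y)) (coord_rep M x m ?u, 1))"
    by (simp add: q i[abs_def])
  also have "\<dots> = X.null_trace ?u"
    unfolding X.null_trace_def
    by (rule metric_trace_pullback(2)[OF X.ambient(5)[OF u] X.second_pairing_bilinear[OF u] trans_D_bij[OF M y(1)]])
  finally show ?thesis .
qed

lemma mean_curvature_pairing_continuous: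
  assumes m: "null_normal_on M W f m"
  shows "continuous_on W (\<lambda>y. lor (cyl_mean_curvature M f y) (m y, 1))"
proof (rule continuous_on_from_charts[OF M])
  show "open W" using m by (simp add: null_normal_on_def)
  fix x
  have "coord_rep M x (\<lambda>y. lor (cyl_mean_curvature M f y) (m y, 1)) u = null_normal.null_trace (coord_rep M x f) (coord_rep M x m) u"
    if "u \<in> chart M x ` (chart_dom M x \<inter> W)" for u
    using that mean_curvature_in_chart[OF m] by (auto simp: coord_rep_chart[OF M])
  then show "continuous_on (chart M x ` (chart_dom M x \<inter> W)) (coord_rep M x (\<lambda>y. lor (cyl_mean_curvature M f y) (m y, 1)))"
    using null_normal.null_trace_continuous[OF chart_null_normal[OF m, of x]] by (simp cong: continuous_on_cong)
qed

text \<open>The angle is the height plus a constant \<open>c\<close> that makes the rotated map an immersion near \<open>x\<close>; the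
  congruence is the translation by \<open>c\<close>.\<close>

lemma locally_congruent_if_null:
  assumes m: "null_normal_on M W f m" and x: "x \<in> W"
    and H: "\<And>y. y \<in> W \<Longrightarrow> lor (cyl_mean_curvature M f y) (m y, 1) = 0"
  shows "locally_congruent_to_phibar M f x"
proof -
  let ?I = "\<lambda>z W. chart M z ` (chart_dom M z \<inter> W)"
  interpret X: null_normal "?I x W" "coord_rep M x f" "coord_rep M x m" 3 by (rule chart_null_normal[OF m])
  have W: "open W" using m by (simp add: null_normal_on_def)
  have u0: "chart M x x \<in> ?I x W" using x chart_dom(2)[OF M] by blast
  obtain c where c: "0 < snd (coord_rep M x f (chart M x x)) + c" "snd (coord_rep M x f (chart M x x)) + c < pi"
    "inj (fder (base_of c (coord_rep M x f) (coord_rep M x m)) (chart M x x))"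
    by (rule X.base_of_immersion_for_small_angle[OF u0])
  define \<phi> where "\<phi> = base_of c f m"
  define \<nu> where "\<nu> = normal_of c f m"
  define s where "s y = cot (snd (f y) + c)" for y
  have cr: "coord_rep M z \<phi> = base_of c (coord_rep M z f) (coord_rep M z m)"
    "coord_rep M z \<nu> = normal_of c (coord_rep M z f) (coord_rep M z m)" for z
    by (simp_all add: \<phi>_def \<nu>_def fun_eq_iff coord_rep_def base_of_def normal_of_def)
  define S where "S = {u \<in> ?I x W. inj (fder (coord_rep M x \<phi>) u)} \<inter>
     (?I x W \<inter> (\<lambda>u. snd (coord_rep M x f u) + c) -` {0<..<pi})"
  have "open {u \<in> ?I x W. inj (fder (coord_rep M x \<phi>) u)}"
  proof (rule open_linear_family_inj[OF X.U])
    show "linear (fder (coord_rep M x \<phi>) u)" if "u \<in> ?I x W" for u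
      using Ck_on_has_derivative[OF X.base_of_Ck that] has_derivative_linear unfolding cr by blast
    show "continuous_on (?I x W) (\<lambda>u. fder (coord_rep M x \<phi>) u z)" for z
      unfolding cr by (rule Ck_on_continuous[OF Ck_on_fder[OF X.base_of_Ck]])
  qed
  moreover have "open (?I x W \<inter> (\<lambda>u. snd (coord_rep M x f u) + c) -` {0<..<pi})"
    using Ck_on_continuous[OF X.f_Ck]
    by (intro continuous_open_preimage X.U open_greaterThanLessThan continuous_intros)
  ultimately have S: "open S" by (simp add: S_def open_Int)
  have xS: "chart M x x \<in> S" using c u0 by (simp add: S_def cr)
  define V where "V = {y \<in> chart_dom M x. chart M x y \<in> S} \<inter> W"
  have V: "open V" "x \<in> V" "V \<subseteq> W" "V \<subseteq> chart_dom M x"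
    unfolding V_def using xS x chart_dom(2)[OF M] by (auto intro!: open_Int W open_chart_preimage[OF M S])
  have ran: "0 < snd (f y) + c \<and> snd (f y) + c < pi" if "y \<in> V" for y
  proof -
    have y: "y \<in> chart_dom M x" "chart M x y \<in> S" using that by (auto simp: V_def)
    from y(2) have "snd (coord_rep M x f (chart M x y)) + c \<in> {0<..<pi}" unfolding S_def by blast
    then show ?thesis by (simp add: coord_rep_chart[OF M y(1)])
  qed
  have mV: "null_normal_on M V f m" by (rule null_normal_on_subset[OF m V(1,3)])
  note nn = chart_null_normal[OF mV]
  have own: "chart M y y \<in> ?I y V" if "y \<in> V" for y using that chart_dom(2)[OF M] by blast
  have imV: "immersion M 4 unit_sphere V \<phi>"
    unfolding immersion_def
  proof (intro conjI ballI subsetI)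
    show "Ck_map M 4 V \<phi>"
      unfolding Ck_map_def cr using null_normal.base_of_Ck[OF nn] by (simp del: Ck_on.simps)
    show "a \<in> unit_sphere" if aV: "a \<in> \<phi> ` V" for a
    proof -
      obtain y where y: "y \<in> V" "a = \<phi> y" using aV by blast
      show ?thesis using null_normal.base_normal_inner(1)[OF nn own[OF y(1)], of c]
        unfolding cr[symmetric] by (simp add: y(2) coord_rep_chart_self[OF M] unit_sphere_def)
    qed
    show "inj (diff1 M \<phi> y)" if y: "y \<in> V" for y
    proof -
      have yd: "y \<in> chart_dom M x" and yS: "chart M x y \<in> S" using y by (auto simp: V_def)
      have u: "chart M x y \<in> ?I x W" using yS by (simp add: S_def)
      have "coord_rep M x \<phi> differentiable at (chart M x y)"
        unfolding cr using Ck_on_has_derivative[OF X.base_of_Ck u] by (auto simp: differentiable_def)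
      from immersion_in_chart[OF M yd this] show ?thesis using yS by (simp add: S_def)
    qed
  qed
  have gaV: "gauss_map M V \<phi> \<nu>"
    unfolding gauss_map_def
  proof (intro conjI ballI)
    show "continuous_on V \<nu>"
      by (rule continuous_on_from_charts[OF M V(1)]) (simp only: cr null_normal.normal_of_continuous[OF nn])
    fix y assume y: "y \<in> V"
    note o = null_normal.base_normal_inner[OF nn own[OF y], of c, folded cr, unfolded coord_rep_chart_self[OF M]]
    show "\<nu> y \<in> unit_sphere" using o(2) by (simp add: unit_sphere_def)
    have "\<nu> y \<bullet> fder (coord_rep M y \<phi>) (chart M y y) X = 0" for X
      using null_normal.normal_of_dbase[OF nn own[OF y], of c X] unfolding cr[symmetric]
      by (simp add: coord_rep_chart_self[OF M])
    then show "\<nu> y \<in> normal_space (\<bullet>) sphere_tangent M \<phi> y"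
      using o(3) by (simp add: normal_space_def sphere_tangent_def diff1_def)
  qed
  note hyp = hypersurface_in_chart[OF M dim V(1) imV gaV, unfolded cr]
  have ranc: "0 < snd (coord_rep M y f u) + c \<and> snd (coord_rep M y f u) + c < pi" if "u \<in> ?I y V" for y u
    using that ran by (auto simp: coord_rep_chart[OF M])
  have rf: "root_function M V \<phi> \<nu> s"
    unfolding root_function_def
  proof (intro conjI ballI)
    show "continuous_on V s"
    proof (rule continuous_on_from_charts[OF M V(1)])
      fix z
      have "coord_rep M z s = (\<lambda>u. cot (snd (coord_rep M z f u) + c))"
        by (simp add: fun_eq_iff coord_rep_def s_def)
      moreover have "continuous_on (?I z V) (\<lambda>u. cot (snd (coord_rep M z f u) + c))"
      proof (rule continuous_on_cot_of)
        show "continuous_on (?I z V) (\<lambda>u. snd (coord_rep M z f u) + c)"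
          by (intro continuous_intros Ck_on_continuous[OF null_normal.f_Ck[OF nn]])
        show "sin (snd (coord_rep M z f u) + c) \<noteq> 0" if "u \<in> ?I z V" for u
          using ranc[OF that] sin_gt_zero[of "snd (coord_rep M z f u) + c"] by simp
      qed
      ultimately show "continuous_on (?I z V) (coord_rep M z s)" by simp
    qed
    fix y assume y: "y \<in> V"
    have "lor (cyl_mean_curvature flat (coord_rep M y f) (chart M y y)) (coord_rep M y m (chart M y y), 1) = 0"
      using H[of y] y V(3) by (auto simp: geometry_at_point[OF M] coord_rep_chart_self[OF M])
    from root_of_null_mean_curvature[OF hyp nn[unfolded numeral_3_eq_3] own[OF y] ranc this]
    show "s y \<in> curvature_roots M \<phi> \<nu> y"
      by (simp add: s_def curvatures_at_point[OF M] cr coord_rep_chart_self[OF M])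
  qed
  have ph: "phibar \<phi> \<nu> s y = f y + (0, c)" if y: "y \<in> V" for y
  proof -
    let ?t = "snd (f y) + c"
    have a: "arccot (s y) = ?t" using ran[OF y] by (simp add: s_def arccot_cot)
    have "cos ?t *\<^sub>R \<phi> y + sin ?t *\<^sub>R \<nu> y = fst (f y)"
      unfolding \<phi>_def \<nu>_def base_of_def normal_of_def by (rule rotate_back(1)) (rule sin_cos_squared_add3)
    then show ?thesis by (simp add: phibar_eq a prod_eq_iff)
  qed
  have "(\<lambda>p. p + (0, c)) ` f ` V = phibar \<phi> \<nu> s ` V"
    unfolding image_image by (rule image_cong[OF refl]) (simp add: ph)
  then show ?thesis
    unfolding locally_congruent_to_phibar_def using V(1,2) imV gaV rf cyl_isometry_translation[of c] by blast
qed

lemma two_null_normals: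
  obtains V m n where "x \<in> V" "null_normal_on M V f m" "null_normal_on M V f n" "\<forall>y\<in>V. m y \<noteq> n y"
proof -
  let ?U = "chart M x ` (chart_dom M x \<inter> UNIV)" and ?f = "coord_rep M x f"
  have U: "open ?U" by (rule open_chart_image[OF M open_UNIV])
  have u0: "chart M x x \<in> ?U" using chart_dom(2)[OF M] by blast
  have fU: "Ck_on (Suc 0) ?U ?f" by (rule Ck_on_mono[OF _ Ck_map_Ck_on[OF M f_Ck5]]) simp
  have d: "?f differentiable at (chart M x y)" if "y \<in> chart_dom M x" for y
    by (rule coord_rep_differentiable[OF M f_Ck5 that UNIV_I])
  have cyl: "fst (?f u) \<bullet> fst (?f u) = 1" if "u \<in> ?U" for u
    using that f_cyl by (fastforce simp: coord_rep_chart[OF M] cylinder_def unit_sphere_def mem_Times_iff)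
  have pos: "lor (fder ?f u X) (fder ?f u X) > 0" if "u \<in> ?U" "X \<noteq> 0" for u X
    using that spacelike_in_chart[OF M _ d sp UNIV_I] by auto
  show thesis
  proof (rule local_null_normals[OF dim U fU cyl pos u0])
  fix V m n assume V: "open V" "chart M x x \<in> V" "V \<subseteq> ?U" and c: "continuous_on V m" "continuous_on V n"
    and m: "\<And>u. u \<in> V \<Longrightarrow> m u \<bullet> m u = 1 \<and> m u \<bullet> fst (?f u) = 0 \<and> (\<forall>X. m u \<bullet> fst (fder ?f u X) = snd (fder ?f u X))"
    and n: "\<And>u. u \<in> V \<Longrightarrow> n u \<bullet> n u = 1 \<and> n u \<bullet> fst (?f u) = 0 \<and> (\<forall>X. n u \<bullet> fst (fder ?f u X) = snd (fder ?f u X))"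
    and mn: "\<And>u. u \<in> V \<Longrightarrow> m u \<noteq> n u"
  define V' where "V' = {y \<in> chart_dom M x. chart M x y \<in> V}"
  have V': "open V'" unfolding V'_def by (rule open_chart_preimage[OF M V(1)])
  have nn: "null_normal_on M V' f (\<lambda>y. k (chart M x y))"
    if k: "continuous_on V k" "\<And>u. u \<in> V \<Longrightarrow> k u \<bullet> k u = 1 \<and> k u \<bullet> fst (?f u) = 0 \<and> (\<forall>X. k u \<bullet> fst (fder ?f u X) = snd (fder ?f u X))" for k
    unfolding null_normal_on_def
  proof (intro conjI ballI V')
    have "continuous_on V' (chart M x)"
      using chart_homeo[OF M, of x] by (auto simp: homeomorphism_def V'_def intro: continuous_on_subset)
    then show "continuous_on V' (\<lambda>y. k (chart M x y))"
      by (rule continuous_on_compose2[OF k(1)]) (auto simp: V'_def)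
    fix y assume "y \<in> V'"
    then have y: "y \<in> chart_dom M x" "chart M x y \<in> V" by (auto simp: V'_def)
    show "k (chart M x y) \<bullet> k (chart M x y) = 1" using k(2)[OF y(2)] by simp
    show "(k (chart M x y), 1) \<in> normal_space lor cylinder_tangent M f y"
      unfolding normal_space_in_chart[OF M y(1) d[OF y(1)]]
      using k(2)[OF y(2)] by (auto simp: normal_space_def cylinder_tangent_def sphere_tangent_def diff1_flat lor_def)
  qed
  show thesis
    by (rule that[OF _ nn[OF c(1) m] nn[OF c(2) n]]) (use V(2) chart_dom(2)[OF M] mn in \<open>auto simp: V'_def\<close>)
  qed
qed

lemma mean_curvature_decomposition:
  assumes m: "null_normal_on M V f m" and n: "null_normal_on M V f n" and mn: "\<And>y. y \<in> V \<Longrightarrow> m y \<noteq> n y" and y: "y \<in> V"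
    and null: "lor (cyl_mean_curvature M f y) (cyl_mean_curvature M f y) = 0"
  shows "lor (cyl_mean_curvature M f y) (m y, 1) = 0 \<or> lor (cyl_mean_curvature M f y) (n y, 1) = 0"
    and "lor (cyl_mean_curvature M f y) (m y, 1) = 0 \<Longrightarrow> lor (cyl_mean_curvature M f y) (n y, 1) = 0
      \<Longrightarrow> cyl_mean_curvature M f y = 0"
proof -
  let ?H = "cyl_mean_curvature M f y"
  note a = f_ambient[of y]
  have H: "?H \<in> normal_space lor cylinder_tangent M f y" by (rule mean_curvature_normal[OF a])
  have D: "X \<noteq> 0 \<Longrightarrow> 0 < lor (diff1 M f y X) (diff1 M f y X)" for X
    using a(4) by (auto simp: pos_metric_def induced_metric_def)
  have p: "fst (f y) \<bullet> fst (f y) = 1" "fst (diff1 M f y X) \<bullet> fst (f y) = 0" for X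
    using f_cyl[of UNIV] a(3) by (auto simp: cylinder_def unit_sphere_def cylinder_tangent_def sphere_tangent_def mem_Times_iff image_subset_iff)
  have N: "k y \<bullet> k y = 1" "k y \<bullet> fst (f y) = 0" "k y \<bullet> fst (diff1 M f y X) = snd (diff1 M f y X)"
    if "null_normal_on M V f k" for k X
    using that y by (auto simp: null_normal_on_def normal_space_def cylinder_tangent_def sphere_tangent_def lor_def)
  have h: "fst ?H \<bullet> fst (f y) = 0" "lor ?H (diff1 M f y X) = 0" for X
    using H by (auto simp: normal_space_def cylinder_tangent_def sphere_tangent_def)
  note dec = null_decomposition[OF a(2) dim D p N[OF m] N[OF n] mn[OF y] h]
  have "m y \<bullet> n y \<noteq> 1"
  proof
    assume "m y \<bullet> n y = 1"
    then have "(m y - n y) \<bullet> (m y - n y) = 0" using N(1)[OF m] N(1)[OF n] by (simp add: inner_diff inner_commute)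
    then show False using mn[OF y] by simp
  qed
  then show "lor ?H (m y, 1) = 0 \<or> lor ?H (n y, 1) = 0" using dec(1) null by simp
  show "lor ?H (m y, 1) = 0 \<Longrightarrow> lor ?H (n y, 1) = 0 \<Longrightarrow> ?H = 0" by (rule dec(2))
qed

context
  assumes mt: "marginally_trapped M UNIV f"
begin

lemma mean_curvature_null: "lor (cyl_mean_curvature M f y) (cyl_mean_curvature M f y) = 0"
  using mt by (simp add: marginally_trapped_def)

text \<open>If the product with one null normal is nonzero at \<open>x\<close>, then it is nonzero nearby by continuity, and the
  product with the other null normal vanishes there because the mean curvature vector is null.\<close>

lemma congruent_if_pairing_nonzero:
  assumes m: "null_normal_on M V f m" and n: "null_normal_on M V f n" and mn: "\<And>y. y \<in> V \<Longrightarrow> m y \<noteq> n y"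
    and x: "x \<in> V" and ne: "lor (cyl_mean_curvature M f x) (m x, 1) \<noteq> 0"
  shows "locally_congruent_to_phibar M f x"
proof -
  let ?q = "\<lambda>y. lor (cyl_mean_curvature M f y) (m y, 1)"
  have V: "open V" using m by (simp add: null_normal_on_def)
  have o: "open (V \<inter> ?q -` (- {0}))"
    by (rule continuous_open_preimage[OF mean_curvature_pairing_continuous[OF m] V]) auto
  show ?thesis
  proof (rule locally_congruent_if_null[OF null_normal_on_subset[OF n o]])
    show "x \<in> V \<inter> ?q -` (- {0})" using x ne by simp
    show "lor (cyl_mean_curvature M f y) (n y, 1) = 0" if "y \<in> V \<inter> ?q -` (- {0})" for y
      using that mean_curvature_decomposition(1)[OF m n mn _ mean_curvature_null, of y] by auto
  qed auto
qed

lemma congruent_if_mean_curvature_nonzero: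
  assumes "cyl_mean_curvature M f x \<noteq> 0"
  shows "locally_congruent_to_phibar M f x"
proof -
  obtain V m n where x: "x \<in> V" and m: "null_normal_on M V f m" and n: "null_normal_on M V f n"
    and ne: "\<forall>y\<in>V. m y \<noteq> n y" by (rule two_null_normals[of x])
  have mn: "m y \<noteq> n y" if "y \<in> V" for y using ne that by blast
  have "lor (cyl_mean_curvature M f x) (m x, 1) \<noteq> 0 \<or> lor (cyl_mean_curvature M f x) (n x, 1) \<noteq> 0"
    using mean_curvature_decomposition(2)[OF m n mn x mean_curvature_null] assms by blast
  then show ?thesis
    using congruent_if_pairing_nonzero[OF m n mn x] congruent_if_pairing_nonzero[OF n m _ x] mn by metis
qed

lemma congruent_if_null_near:
  assumes "null_mean_curvature_near M f x"
  shows "locally_congruent_to_phibar M f x"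
proof -
  obtain U \<xi> where U: "open U" "x \<in> U" and \<xi>: "null_normal_field M U f \<xi>"
    and H: "\<And>y. y \<in> U \<Longrightarrow> \<exists>c. cyl_mean_curvature M f y = c *\<^sub>R \<xi> y"
    using assms unfolding null_mean_curvature_near_def by blast
  note field = null_normal_of_null_field[OF M U(1) \<xi> subspace_normal_space[OF f_ambient]]
  show ?thesis
  proof (rule locally_congruent_if_null[OF field(1) U(2)])
    fix y assume y: "y \<in> U"
    obtain c where c: "cyl_mean_curvature M f y = c *\<^sub>R \<xi> y" using H[OF y] by blast
    have "lor (\<xi> y) (\<xi> y) = 0" using \<xi> y by (simp add: null_normal_field_def)
    moreover have "((1 / snd (\<xi> y)) *\<^sub>R fst (\<xi> y), 1) = (1 / snd (\<xi> y)) *\<^sub>R \<xi> y"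
      using field(2)[OF y] by (simp add: prod_eq_iff)
    ultimately show "lor (cyl_mean_curvature M f y) ((1 / snd (\<xi> y)) *\<^sub>R fst (\<xi> y), 1) = 0"
      unfolding c by (simp only: bilinear_lmul[OF bilinear_lor] bilinear_rmul[OF bilinear_lor]) simp
  qed
qed

text \<open>An open set without congruent points would consist of points with vanishing mean curvature vector, at which
  either of the two null normals can be used for the reconstruction.\<close>

lemma congruent_points_dense: "closure {x. locally_congruent_to_phibar M f x} = UNIV"
proof (rule ccontr)
  let ?C = "closure {x. locally_congruent_to_phibar M f x}"
  assume "?C \<noteq> UNIV"
  then obtain x where x: "x \<notin> ?C" by blast
  obtain V m n where xV: "x \<in> V" and m: "null_normal_on M V f m" and "null_normal_on M V f n"
    "\<forall>y\<in>V. m y \<noteq> n y" by (rule two_null_normals[of x])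
  have "open V" using m by (simp add: null_normal_on_def)
  then have o: "open (V \<inter> - ?C)" by (intro open_Int open_Compl closed_closure)
  have H0: "cyl_mean_curvature M f y = 0" if "y \<in> V \<inter> - ?C" for y
  proof (rule ccontr)
    assume "cyl_mean_curvature M f y \<noteq> 0"
    from congruent_if_mean_curvature_nonzero[OF this] have "y \<in> {x. locally_congruent_to_phibar M f x}" by simp
    then have "y \<in> ?C" by (rule subsetD[OF closure_subset])
    then show False using that by simp
  qed
  have "locally_congruent_to_phibar M f x"
  proof (rule locally_congruent_if_null[OF null_normal_on_subset[OF m o]])
    show "x \<in> V \<inter> - ?C" using x xV by simp
    show "lor (cyl_mean_curvature M f y) (m y, 1) = 0" if "y \<in> V \<inter> - ?C" for y
      unfolding H0[OF that] by (rule bilinear_lzero[OF bilinear_lor])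
  qed simp
  then have "x \<in> {x. locally_congruent_to_phibar M f x}" by simp
  then have "x \<in> ?C" by (rule subsetD[OF closure_subset])
  then show False using x by simp
qed

end

end

section \<open>Surfaces\<close>

lemma phibar_surface_eq:
  assumes "\<sigma> \<in> {1, -1}"
  shows "phibar_surface \<sigma> \<phi> \<nu> a = phibar \<phi> \<nu> (\<lambda>x. a x + \<sigma> * sqrt ((a x)\<^sup>2 + 1))"
proof (rule ext)
  fix x
  define q where "q = sqrt ((a x)\<^sup>2 + 1)"
  have q: "q\<^sup>2 = (a x)\<^sup>2 + 1" unfolding q_def by (simp add: add_nonneg_nonneg)
  have s: "\<sigma>\<^sup>2 = 1" using assms by auto
  have "1 + (a x + \<sigma> * q)\<^sup>2 = 1 + ((a x)\<^sup>2 + 2 * (\<sigma> * a x * q) + \<sigma>\<^sup>2 * q\<^sup>2)"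
    by (simp add: power2_eq_square algebra_simps)
  also have "\<dots> = 2 * ((a x)\<^sup>2 + 1 + \<sigma> * a x * q)" unfolding s q by simp
  finally have "sqrt (1 + (a x + \<sigma> * q)\<^sup>2) = sqrt 2 * sqrt ((a x)\<^sup>2 + 1 + \<sigma> * a x * q)"
    by (simp only: real_sqrt_mult)
  then show "phibar_surface \<sigma> \<phi> \<nu> a x = phibar \<phi> \<nu> (\<lambda>x. a x + \<sigma> * sqrt ((a x)\<^sup>2 + 1)) x"
    by (simp add: phibar_surface_def phibar_def q_def)
qed

text \<open>Both values \<open>a \<plusminus> sqrt (a\<^sup>2 + 1)\<close> are the roots of \<open>s\<^sup>2 - 2 a s - 1\<close>, and \<open>k1 + k2\<close> times this
  is the polynomial of the principal curvatures. At \<open>s = k1\<close> its value is \<open>(k1\<^sup>2 + 1) (k1 - k2)\<close>.\<close>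

lemma surface_root_algebra:
  fixes a k1 k2 :: real
  assumes \<sigma>: "\<sigma> \<in> {1, -1}" and sum: "k1 + k2 \<noteq> 0" and a: "a = (k1 * k2 - 1) / (k1 + k2)"
    and s: "s = a + \<sigma> * sqrt (a\<^sup>2 + 1)"
  shows "(k1 * s + 1) * (s - k2) + (k2 * s + 1) * (s - k1) = 0"
    and "k1 \<noteq> k2 \<Longrightarrow> s \<noteq> k1 \<and> s \<noteq> k2"
proof -
  have "(s - a)\<^sup>2 = \<sigma>\<^sup>2 * (sqrt (a\<^sup>2 + 1))\<^sup>2" unfolding s by (simp add: power_mult_distrib)
  also have "\<dots> = a\<^sup>2 + 1" using \<sigma> by (auto simp: add_nonneg_nonneg)
  finally have "s * s - 2 * a * s - 1 = 0" by (simp add: power2_eq_square algebra_simps)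
  then have "(k1 + k2) * (s * s - 2 * a * s - 1) = 0" by simp
  moreover have ha: "(k1 + k2) * a = k1 * k2 - 1" using sum by (simp add: a)
  have "(k1 + k2) * (s * s - 2 * a * s - 1) = (k1 + k2) * (s * s) - 2 * ((k1 + k2) * a) * s - (k1 + k2)"
    by (simp add: algebra_simps)
  then have "(k1 + k2) * (s * s - 2 * a * s - 1) = (k1 + k2) * (s * s) - 2 * (k1 * k2 - 1) * s - (k1 + k2)"
    unfolding ha .
  ultimately show 1: "(k1 * s + 1) * (s - k2) + (k2 * s + 1) * (s - k1) = 0" by (simp add: algebra_simps)
  have p: "k\<^sup>2 + 1 \<noteq> 0" for k :: real by (smt (verit) zero_le_power2)
  show "s \<noteq> k1 \<and> s \<noteq> k2" if "k1 \<noteq> k2"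
  proof (intro conjI notI)
    assume "s = k1"
    then have "(k1\<^sup>2 + 1) * (k1 - k2) = 0" using 1 by (simp add: power2_eq_square)
    then show False using p that by simp
  next
    assume "s = k2"
    then have "(k2\<^sup>2 + 1) * (k2 - k1) = 0" using 1 by (simp add: power2_eq_square)
    then show False using p that by simp
  qed
qed

context hypersurface
begin

lemma sum_two_curvatures:
  assumes n: "DIM('e) = 2" and u: "u \<in> U" and E: "orthonormal_basis (first_form u) E"
    and l: "\<And>e. e \<in> E \<Longrightarrow> A u e = l e *\<^sub>R e" and k: "principal_curvatures flat \<phi> \<nu> u = {k1, k2}"
  shows "l ` E = {k1, k2}" "(\<Sum>e\<in>E. F (l e)) = F k1 + (F k2 :: real)"
proof -
  show lE: "l ` E = {k1, k2}" using principal_curvatures_eq[OF u E l] k by simp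
  have "card E = 2" using card_orthonormal[OF first_form_pos[OF u] E] n by simp
  then obtain e1 e2 where e: "E = {e1, e2}" "e1 \<noteq> e2" by (meson card_2_iff)
  then have "{l e1, l e2} = {k1, k2}" using lE by simp
  then show "(\<Sum>e\<in>E. F (l e)) = F k1 + F k2" using e by (auto simp: doubleton_eq_iff add.commute)
qed

lemma mean_curvature_surface:
  assumes n: "DIM('e) = 2" and u: "u \<in> U" and k: "principal_curvatures flat \<phi> \<nu> u = {k1, k2}"
  shows "sphere_mean_curvature flat \<phi> u = 0 \<longleftrightarrow> k1 + k2 = 0"
proof -
  obtain E l where E: "orthonormal_basis (first_form u) E" and l: "\<And>e. e \<in> E \<Longrightarrow> A u e = l e *\<^sub>R e"
    using eigenbasis[OF u] by blast
  show ?thesis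
    using sphere_mean_curvature_eq[OF u E l] sum_two_curvatures(2)[OF n u E l k, of "\<lambda>x. x"] by simp
qed

lemma surface_root:
  assumes n: "DIM('e) = 2" and u: "u \<in> U" and k: "principal_curvatures flat \<phi> \<nu> u = {k1, k2}"
    and s: "s \<noteq> k1" "s \<noteq> k2" and eq: "(k1 * s + 1) * (s - k2) + (k2 * s + 1) * (s - k1) = 0"
  shows "s \<in> curvature_roots flat \<phi> \<nu> u"
proof -
  obtain E l where E: "orthonormal_basis (first_form u) E" and l: "\<And>e. e \<in> E \<Longrightarrow> A u e = l e *\<^sub>R e"
    using eigenbasis[OF u] by blast
  note t = sum_two_curvatures[OF n u E l k]
  have "(k1 * s + 1) / (s - k1) + (k2 * s + 1) / (s - k2) = 0"
    using s eq by (simp add: add_frac_eq)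
  then show ?thesis
    using curvature_roots_iff[OF u E l, of s] t(1) t(2)[of "\<lambda>k. (k * s + 1) / (s - k)"] s by simp
qed

text \<open>The two functions \<open>k1\<close>, \<open>k2\<close> may jump by being exchanged, but \<open>k1 + k2\<close> and
  \<open>k1\<^sup>2 + k2\<^sup>2\<close> are the traces of the shape operator and of its square.\<close>

lemma surface_coeff_continuous:
  assumes n: "DIM('e) = 2" and k: "\<And>u. u \<in> U \<Longrightarrow> principal_curvatures flat \<phi> \<nu> u = {k1 u, k2 u}"
    and ne: "\<And>u. u \<in> U \<Longrightarrow> k1 u + k2 u \<noteq> 0"
  shows "continuous_on U (surface_coeff k1 k2)"
proof -
  define t1 where "t1 u = (\<Sum>b\<in>Basis. b \<bullet> A u b)" for u
  define t2 where "t2 u = (\<Sum>b\<in>Basis. b \<bullet> (\<Sum>c\<in>Basis. (A u b \<bullet> c) *\<^sub>R A u c))" for u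
  have cA: "continuous_on U (\<lambda>u. A u X)" for X by (rule Ck_on_continuous[OF A_Ck])
  have c: "continuous_on U t1" "continuous_on U t2" unfolding t1_def t2_def by (intro continuous_intros cA)+
  have t: "t1 u = k1 u + k2 u" "t2 u = (k1 u)\<^sup>2 + (k2 u)\<^sup>2" if u: "u \<in> U" for u
  proof -
    obtain E l where E: "orthonormal_basis (first_form u) E" and l: "\<And>e. e \<in> E \<Longrightarrow> A u e = l e *\<^sub>R e"
      using eigenbasis[OF u] by blast
    note g = first_form_pos[OF u] and s = sum_two_curvatures(2)[OF n u E l k[OF u]]
    have "t1 u = (\<Sum>e\<in>E. l e)"
      unfolding t1_def trace_endomorphism[OF g E A_linear[OF u]]
      using eigen_coordinate[OF g E A_linear[OF u] l] orthonormal_pairing[OF g E] by (intro sum.cong) auto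
    then show "t1 u = k1 u + k2 u" using s[of "\<lambda>x. x"] by simp
    have AA: "linear (\<lambda>X. A u (A u X))" using linear_compose[OF A_linear[OF u] A_linear[OF u]] by (simp add: o_def)
    have "(\<Sum>c\<in>Basis. (A u b \<bullet> c) *\<^sub>R A u c) = A u (\<Sum>c\<in>Basis. (A u b \<bullet> c) *\<^sub>R c)" for b
      by (simp add: linear_sum[OF A_linear[OF u]] linear_scale[OF A_linear[OF u]])
    then have "t2 u = (\<Sum>b\<in>Basis. b \<bullet> A u (A u b))" by (simp add: t2_def euclidean_representation)
    also have "\<dots> = (\<Sum>e\<in>E. first_form u (A u (A u e)) e)" by (rule trace_endomorphism[OF g E AA])
    also have "\<dots> = (\<Sum>e\<in>E. (l e)\<^sup>2)"
      using eigen_coordinate[OF g E A_linear[OF u] l] orthonormal_pairing[OF g E] by (intro sum.cong) (auto simp: power2_eq_square)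
    finally show "t2 u = (k1 u)\<^sup>2 + (k2 u)\<^sup>2" using s[of "\<lambda>x. x\<^sup>2"] by simp
  qed
  have "continuous_on U (\<lambda>u. (((t1 u)\<^sup>2 - t2 u) / 2 - 1) / t1 u)"
    by (intro continuous_intros c) (use t ne in auto)
  moreover have "(((t1 u)\<^sup>2 - t2 u) / 2 - 1) / t1 u = surface_coeff k1 k2 u" if "u \<in> U" for u
    by (simp add: t[OF that] surface_coeff_def power2_sum)
  ultimately show ?thesis by (simp cong: continuous_on_cong)
qed

text \<open>At an umbilic point one of the two values \<open>a \<plusminus> sqrt (a\<^sup>2 + 1)\<close> is the principal curvature itself. For it
  \<open>stretch\<close> vanishes, and the derivative has rank at most one.\<close>

lemma umbilic_not_immersed:
  assumes n: "DIM('e) = 2" and u: "u \<in> U" and k: "principal_curvatures flat \<phi> \<nu> u = {k, k}"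
    and s: "s u = k" and d: "phibar \<phi> \<nu> s differentiable at u"
  shows "\<not> inj (diff1 flat (phibar \<phi> \<nu> s) u)"
proof -
  let ?t = "\<lambda>u. arccot (s u)"
  note L = lift_phibar[of s]
  obtain E l where E: "orthonormal_basis (first_form u) E" and l: "\<And>e. e \<in> E \<Longrightarrow> A u e = l e *\<^sub>R e"
    using eigenbasis[OF u] by blast
  have lk: "l e = k" if "e \<in> E" for e using sum_two_curvatures(1)[OF n u E l k] that by auto
  have Ak: "A u X = k *\<^sub>R X" for X
  proof -
    have "A u X = (\<Sum>e\<in>E. (l e * first_form u X e) *\<^sub>R e)"
      by (rule eigen_expansion[OF first_form_pos[OF u] E A_linear[OF u] l])
    also have "\<dots> = (\<Sum>e\<in>E. k *\<^sub>R (first_form u X e *\<^sub>R e))" by (rule sum.cong) (simp_all add: lk)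
    finally show ?thesis by (simp only: scaleR_sum_right[symmetric] orthonormal_expansion[OF first_form_pos[OF u] E])
  qed
  have "?t = (\<lambda>u. snd (phibar \<phi> \<nu> s u))" by (simp add: phibar_def)
  moreover obtain D where "(phibar \<phi> \<nu> s has_derivative D) (at u)" using d by (auto simp: differentiable_def)
  ultimately have "(?t has_derivative (\<lambda>X. snd (D X))) (at u)" by (auto intro: has_derivative_snd)
  then have dt: "?t differentiable at u" by (auto simp: differentiable_def)
  have sn: "sin (?t u) \<noteq> 0" using sin_gt_zero[of "?t u"] arccot[of "s u"] by simp
  have st: "stretch ?t u X = 0" for X by (simp add: stretch_cot[of ?t u, OF sn] arccot Ak s)
  have "(?t has_derivative fder ?t u) (at u)" using dt frechet_derivative_works by blast
  from has_derivative_linear[OF this] obtain X where X: "X \<noteq> 0" "fder ?t u X = 0"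
    by (rule kernel_of_functional_nontrivial) (use n in auto)
  have "fder (phibar \<phi> \<nu> s) u X = 0"
    unfolding L[symmetric] lift_fder(2)[OF u dt] st X(2) by (simp add: linear_0[OF d\<phi>_linear[OF u]] zero_prod_def)
  moreover have "fder (phibar \<phi> \<nu> s) u 0 = 0"
    using d linear_0[OF linear_frechet_derivative] by blast
  ultimately have e: "diff1 flat (phibar \<phi> \<nu> s) u X = diff1 flat (phibar \<phi> \<nu> s) u 0" by (simp add: diff1_flat)
  show ?thesis
  proof
    assume "inj (diff1 flat (phibar \<phi> \<nu> s) u)"
    from this e have "X = 0" by (rule injD)
    then show False using X(1) by contradiction
  qed
qed

end

text \<open>Away from umbilic points the value is never a principal curvature; at an umbilic point this is
  excluded by the assumption that the map is an immersion.\<close>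

lemma surface_root_function:
  fixes M :: "('m::{t2_space,second_countable_topology}, 'e::euclidean_space) charts"
    and \<phi> \<nu> :: "'m \<Rightarrow> 'v::euclidean_space"
  assumes M: "smooth_manifold M" and dim: "DIM('v) = DIM('e) + 2" and n: "DIM('e) = 2"
    and im: "immersion M 4 unit_sphere UNIV \<phi>" and ga: "gauss_map M UNIV \<phi> \<nu>"
    and H: "\<And>x. sphere_mean_curvature M \<phi> x \<noteq> 0"
    and k: "\<And>x. principal_curvatures M \<phi> \<nu> x = {\<kappa>1 x, \<kappa>2 x}"
    and \<sigma>: "\<sigma> \<in> {1, -1}" and W: "open W"
    and alt: "(\<forall>x\<in>W. \<kappa>1 x \<noteq> \<kappa>2 x) \<or> immersion M 2 cylinder W (phibar_surface \<sigma> \<phi> \<nu> (surface_coeff \<kappa>1 \<kappa>2))"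
  shows "root_function M W \<phi> \<nu> (\<lambda>x. surface_coeff \<kappa>1 \<kappa>2 x + \<sigma> * sqrt ((surface_coeff \<kappa>1 \<kappa>2 x)\<^sup>2 + 1))"
    (is "root_function M W \<phi> \<nu> ?s")
proof -
  let ?I = "\<lambda>z. chart M z ` (chart_dom M z \<inter> UNIV)"
  note hyp = hypersurface_in_chart[OF M dim open_UNIV im ga]
  have own: "chart M x x \<in> ?I x" for x using chart_dom(2)[OF M] by blast
  have k': "principal_curvatures flat (coord_rep M x \<phi>) (coord_rep M x \<nu>) (chart M x x) = {\<kappa>1 x, \<kappa>2 x}" for x
    using k[of x] by (simp add: curvatures_at_point[OF M])
  have sum: "\<kappa>1 x + \<kappa>2 x \<noteq> 0" for x
    using hypersurface.mean_curvature_surface[OF hyp n own k', of x] H[of x] by (simp add: geometry_at_point[OF M])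
  have ca: "continuous_on UNIV (surface_coeff \<kappa>1 \<kappa>2)"
  proof (rule continuous_on_from_charts[OF M open_UNIV])
    fix x
    have "coord_rep M x (surface_coeff \<kappa>1 \<kappa>2) = surface_coeff (coord_rep M x \<kappa>1) (coord_rep M x \<kappa>2)"
      by (simp add: fun_eq_iff coord_rep_def surface_coeff_def)
    moreover have "continuous_on (?I x) (surface_coeff (coord_rep M x \<kappa>1) (coord_rep M x \<kappa>2))"
    proof (rule hypersurface.surface_coeff_continuous[OF hyp n])
      fix u assume "u \<in> ?I x"
      then obtain y where y: "y \<in> chart_dom M x" "u = chart M x y" by auto
      show "principal_curvatures flat (coord_rep M x \<phi>) (coord_rep M x \<nu>) u = {coord_rep M x \<kappa>1 u, coord_rep M x \<kappa>2 u}"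
        using curvatures_in_chart(1)[OF M dim open_UNIV im ga y(1) UNIV_I] k[of y]
        by (simp add: y(2) coord_rep_chart[OF M y(1)])
      show "coord_rep M x \<kappa>1 u + coord_rep M x \<kappa>2 u \<noteq> 0"
        using sum by (simp add: y(2) coord_rep_chart[OF M y(1)])
    qed
    ultimately show "continuous_on (?I x) (coord_rep M x (surface_coeff \<kappa>1 \<kappa>2))" by simp
  qed
  have alg: "(\<kappa>1 x * ?s x + 1) * (?s x - \<kappa>2 x) + (\<kappa>2 x * ?s x + 1) * (?s x - \<kappa>1 x) = 0"
    "\<kappa>1 x \<noteq> \<kappa>2 x \<Longrightarrow> ?s x \<noteq> \<kappa>1 x \<and> ?s x \<noteq> \<kappa>2 x" for x
    by (rule surface_root_algebra(1)[OF \<sigma> sum[of x] _ refl], rule surface_coeff_def,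
        rule surface_root_algebra(2)[OF \<sigma> sum[of x] _ refl], rule surface_coeff_def)
  show ?thesis
    unfolding root_function_def
  proof (intro conjI ballI)
    show "continuous_on W ?s"
      by (intro continuous_intros continuous_on_subset[OF ca]) auto
    fix x assume x: "x \<in> W"
    have "?s x \<noteq> \<kappa>1 x \<and> ?s x \<noteq> \<kappa>2 x"
    proof (cases "\<kappa>1 x = \<kappa>2 x")
      case False
      then show ?thesis by (rule alg(2))
    next
      case True
      then have im2: "immersion M 2 cylinder W (phibar \<phi> \<nu> ?s)"
        using alt x phibar_surface_eq[OF \<sigma>, of \<phi> \<nu> "surface_coeff \<kappa>1 \<kappa>2"] by auto
      have c2: "Ck_map M (Suc 1) W (phibar \<phi> \<nu> ?s)" using im2 by (simp add: immersion_def numeral_2_eq_2)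
      have e: "coord_rep M x (phibar \<phi> \<nu> ?s) = phibar (coord_rep M x \<phi>) (coord_rep M x \<nu>) (coord_rep M x ?s)"
        by (simp add: fun_eq_iff coord_rep_def phibar_def)
      have "inj (diff1 flat (coord_rep M x (phibar \<phi> \<nu> ?s)) (chart M x x))"
        using im2 x by (simp add: immersion_def diff_at_point[OF M])
      moreover have "coord_rep M x (phibar \<phi> \<nu> ?s) differentiable at (chart M x x)"
        by (rule coord_rep_differentiable[OF M c2 chart_dom(2)[OF M] x])
      ultimately have "coord_rep M x ?s (chart M x x) \<noteq> \<kappa>1 x"
        using hypersurface.umbilic_not_immersed[OF hyp n own, of x "\<kappa>1 x" "coord_rep M x ?s"] k'[of x] True
        unfolding e by auto
      then show ?thesis using True by (simp add: coord_rep_chart_self[OF M])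
    qed
    then have "?s x \<in> curvature_roots flat (coord_rep M x \<phi>) (coord_rep M x \<nu>) (chart M x x)"
      by (intro hypersurface.surface_root[OF hyp n own k'] alg(1)) auto
    then show "?s x \<in> curvature_roots M \<phi> \<nu> x" by (simp add: curvatures_at_point[OF M])
  qed
qed

lemma phibar_of_root_function:
  fixes M :: "('m::{t2_space,second_countable_topology}, 'e::euclidean_space) charts"
    and \<phi> \<nu> :: "'m \<Rightarrow> 'v::euclidean_space"
  assumes M: "smooth_manifold M" and dim: "DIM('v) = DIM('e) + 2"
    and im: "immersion M 4 unit_sphere UNIV \<phi>" and ga: "gauss_map M UNIV \<phi> \<nu>" and W: "open W"
    and s: "root_function M W \<phi> \<nu> s"
  shows "Ck_map M 2 W s \<and> immersion M 2 cylinder W (phibar \<phi> \<nu> s) \<and> spacelike M W (phibar \<phi> \<nu> s) \<and>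
    marginally_trapped M W (phibar \<phi> \<nu> s)"
proof -
  have "gauss_map M W \<phi> \<nu>" using ga by (auto simp: gauss_map_def intro: continuous_on_subset)
  from manifold_phibar[OF M dim W immersion_subset[OF subset_UNIV im] this s] show ?thesis by blast
qed

theorem theorem3:
  fixes M :: "('m::{t2_space,second_countable_topology}, 'e::euclidean_space) charts"
  assumes "smooth_manifold M"
    and "DIM('v::euclidean_space) = DIM('e) + 2"
  shows
    "(2 \<le> DIM('e) \<longrightarrow>
       \<not> (\<exists>f :: 'm \<Rightarrow> 'v \<times> real.
             immersion M 2 cylinder UNIV f \<and> spacelike M UNIV f \<and>
             null_second_ff M f \<and> \<not> totally_geodesic M f))
     \<and>
     (\<forall>\<phi> \<nu> :: 'm \<Rightarrow> 'v.
        immersion M 4 unit_sphere UNIV \<phi> \<and> gauss_map M UNIV \<phi> \<nu> \<longrightarrow>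
        (\<forall>x. finite (curvature_roots M \<phi> \<nu> x) \<and>
             card (curvature_roots M \<phi> \<nu> x) =
               (if sphere_mean_curvature M \<phi> x = 0
                then card (principal_curvatures M \<phi> \<nu> x) - 1
                else card (principal_curvatures M \<phi> \<nu> x)))
        \<and>
        (\<forall>W p N. open W \<and>
               (\<forall>x\<in>W. card (principal_curvatures M \<phi> \<nu> x) = p) \<and>
               ((\<forall>x\<in>W. sphere_mean_curvature M \<phi> x = 0) \<and> N = p - 1 \<or>
                (\<forall>x\<in>W. sphere_mean_curvature M \<phi> x \<noteq> 0) \<and> N = p) \<longrightarrow>
           (\<exists>s :: nat \<Rightarrow> 'm \<Rightarrow> real.
              (\<forall>x\<in>W. bij_betw (\<lambda>i. s i x) {1..N} (curvature_roots M \<phi> \<nu> x)) \<and>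
              (\<forall>i\<in>{1..N}. Ck_map M 2 W (s i) \<and>
                 immersion M 2 cylinder W (phibar \<phi> \<nu> (s i)) \<and>
                 spacelike M W (phibar \<phi> \<nu> (s i)) \<and>
                 marginally_trapped M W (phibar \<phi> \<nu> (s i)))))
        \<and>
        (\<forall>W s. open W \<and> root_function M W \<phi> \<nu> s \<longrightarrow>
           immersion M 2 cylinder W (phibar \<phi> \<nu> s) \<and>
           spacelike M W (phibar \<phi> \<nu> s) \<and>
           marginally_trapped M W (phibar \<phi> \<nu> s)))
     \<and>
     (\<forall>f :: 'm \<Rightarrow> 'v \<times> real.
        immersion M 5 cylinder UNIV f \<and> spacelike M UNIV f \<and> marginally_trapped M UNIV f \<longrightarrow>
        (\<forall>x. null_mean_curvature_near M f x \<longrightarrow> locally_congruent_to_phibar M f x) \<and>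
        (\<forall>x. cyl_mean_curvature M f x \<noteq> 0 \<longrightarrow> locally_congruent_to_phibar M f x) \<and>
        closure {x. locally_congruent_to_phibar M f x} = UNIV)
     \<and>
     (DIM('e) = 2 \<longrightarrow>
       (\<forall>(\<phi> :: 'm \<Rightarrow> 'v) \<nu> \<kappa>1 \<kappa>2.
          immersion M 4 unit_sphere UNIV \<phi> \<and> gauss_map M UNIV \<phi> \<nu> \<and>
          (\<forall>x. sphere_mean_curvature M \<phi> x \<noteq> 0) \<and>
          (\<forall>x. principal_curvatures M \<phi> \<nu> x = {\<kappa>1 x, \<kappa>2 x}) \<longrightarrow>
          (\<forall>\<sigma>\<in>{1, -1}. \<forall>W. open W \<and>
             ((\<forall>x\<in>W. \<kappa>1 x \<noteq> \<kappa>2 x) \<or>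
              immersion M 2 cylinder W (phibar_surface \<sigma> \<phi> \<nu> (surface_coeff \<kappa>1 \<kappa>2))) \<longrightarrow>
             immersion M 2 cylinder W (phibar_surface \<sigma> \<phi> \<nu> (surface_coeff \<kappa>1 \<kappa>2)) \<and>
             spacelike M W (phibar_surface \<sigma> \<phi> \<nu> (surface_coeff \<kappa>1 \<kappa>2)) \<and>
             marginally_trapped M W (phibar_surface \<sigma> \<phi> \<nu> (surface_coeff \<kappa>1 \<kappa>2)))))"
proof -
  note M = assms(1) and dim = assms(2)
  show ?thesis
  proof (intro conjI impI allI, goal_cases)
    case 1
    then show ?case using null_second_ff_totally_geodesic[OF M dim] by blast
  next
    case (2 \<phi> \<nu> x)
    then show ?case using manifold_roots_count(1)[OF M dim open_UNIV _ _ UNIV_I] by blast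
  next
    case (3 \<phi> \<nu> x)
    then show ?case using manifold_roots_count(2)[OF M dim open_UNIV _ _ UNIV_I] by blast
  next
    case (4 \<phi> \<nu> W p N)
    then have im: "immersion M 4 unit_sphere UNIV \<phi>" and ga: "gauss_map M UNIV \<phi> \<nu>" and W: "open W"
      and p: "\<And>x. x \<in> W \<Longrightarrow> card (principal_curvatures M \<phi> \<nu> x) = p"
      and N: "(\<forall>x\<in>W. sphere_mean_curvature M \<phi> x = 0) \<and> N = p - 1 \<or> (\<forall>x\<in>W. sphere_mean_curvature M \<phi> x \<noteq> 0) \<and> N = p"
      by auto
    have gaW: "gauss_map M W \<phi> \<nu>" using ga by (auto simp: gauss_map_def intro: continuous_on_subset)
    have c: "card (curvature_roots M \<phi> \<nu> x) = N" if "x \<in> W" for x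
      using manifold_roots_count(2)[OF M dim open_UNIV im ga UNIV_I, of x] p[OF that] N that by auto
    obtain s :: "nat \<Rightarrow> 'm \<Rightarrow> real" where
      s: "\<forall>x\<in>W. bij_betw (\<lambda>i. s i x) {1..N} (curvature_roots M \<phi> \<nu> x)"
      "\<forall>i\<in>{1..N}. root_function M W \<phi> \<nu> (s i)"
      by (rule enumerated_roots[OF M dim W immersion_subset[OF subset_UNIV im] gaW c])
    have "Ck_map M 2 W (s i) \<and> immersion M 2 cylinder W (phibar \<phi> \<nu> (s i)) \<and>
        spacelike M W (phibar \<phi> \<nu> (s i)) \<and> marginally_trapped M W (phibar \<phi> \<nu> (s i))" if "i \<in> {1..N}" for i
      by (rule phibar_of_root_function[OF M dim im ga W]) (use s(2) that in blast)
    then show ?case using s(1) by (intro exI[of _ s] conjI ballI) auto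
  next
    case (5 \<phi> \<nu> W s)
    then show ?case using phibar_of_root_function[OF M dim, of \<phi> \<nu> W s] by blast
  next
    case (6 \<phi> \<nu> W s)
    then show ?case using phibar_of_root_function[OF M dim, of \<phi> \<nu> W s] by blast
  next
    case (7 \<phi> \<nu> W s)
    then show ?case using phibar_of_root_function[OF M dim, of \<phi> \<nu> W s] by blast
  next
    case (8 f x)
    then show ?case using congruent_if_null_near[OF M dim] by blast
  next
    case (9 f x)
    then show ?case using congruent_if_mean_curvature_nonzero[OF M dim] by blast
  next
    case (10 f)
    then show ?case using congruent_points_dense[OF M dim] by blast
  next
    case (11 \<phi> \<nu> \<kappa>1 \<kappa>2)
    then have n: "DIM('e) = 2" and im: "immersion M 4 unit_sphere UNIV \<phi>" and ga: "gauss_map M UNIV \<phi> \<nu>"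
      and H: "\<And>x. sphere_mean_curvature M \<phi> x \<noteq> 0" and k: "\<And>x. principal_curvatures M \<phi> \<nu> x = {\<kappa>1 x, \<kappa>2 x}"
      by auto
    show ?case
    proof (intro ballI allI impI)
      fix \<sigma> W assume \<sigma>: "\<sigma> \<in> {1, - 1 :: real}" and W: "open W \<and> ((\<forall>x\<in>W. \<kappa>1 x \<noteq> \<kappa>2 x) \<or>
        immersion M 2 cylinder W (phibar_surface \<sigma> \<phi> \<nu> (surface_coeff \<kappa>1 \<kappa>2)))"
      from phibar_of_root_function[OF M dim im ga _ surface_root_function[OF M dim n im ga H k \<sigma>, of W]] W
      show "immersion M 2 cylinder W (phibar_surface \<sigma> \<phi> \<nu> (surface_coeff \<kappa>1 \<kappa>2)) \<and>
        spacelike M W (phibar_surface \<sigma> \<phi> \<nu> (surface_coeff \<kappa>1 \<kappa>2)) \<and>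
        marginally_trapped M W (phibar_surface \<sigma> \<phi> \<nu> (surface_coeff \<kappa>1 \<kappa>2))"
        unfolding phibar_surface_eq[OF \<sigma>] by blast
    qed
  qed
qed

end
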